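(* Let $n=3$ and let $f_1,\ldots,f_m$ be real-analytic vector fields on $\mathbb{R}^3$ satisfying Hörmander's bracket generating condition $\mathrm{Lie}_{\{f_1,\ldots,f_m\}}(x)=\mathbb{R}^3$ for every $x\in\mathbb{R}^3$. Let $\mathcal{K}\subset\mathbb{R}^3$ be a nonempty closed set. Then the Lipschitz singular support $\operatorname{sing\,supp}_{Lip}\mathcal{T}_{\mathcal{K}}$ of the minimum time function $\mathcal{T}_{\mathcal{K}}$, regarded as a function on the open set $\mathbb{R}^3\setminus\mathcal{K}$, is a set of (Lebesgue) measure zero.
   Context: Control system: $y'(t)=f(y(t))u(t)=\sum_{i=1}^m u_i(t)f_i(y(t))$ for a.e. $t\ge 0$, where the controls are the Lebesgue measurable maps $u:[0,+\infty[\to\bar B^m_1(0)$ and $\bar B_1^m(0)$ is the closed unit ball of $\mathbb{R}^m$ (Euclidean norm). The vector fields are not assumed to be linearly independent nor to have sublinear growth ($m\ge 1$ is arbitrary). For $x\in\mathbb{R}^n$ and a control $u$, $y_{x,u}$ denotes the solution (on its interval of existence) with $y_{x,u}(0)=x$. The minimum time function with target $\mathcal{K}$ is $\mathcal{T}_{\mathcal{K}}(x)=\inf\{t\ge 0 : y_{x,u}(t)\in\mathcal{K}\text{ for some control }u\}$; under Hörmander's condition it is finite everywhere. Commutators: $[f,g](x)=Dg(x)(f(x))-Df(x)(g(x))$. $\mathrm{Lie}_{\{f_1,\ldots,f_m\}}$ is the Lie algebra generated by $f_1,\dots,f_m$ and all their iterated commutators, and $\mathrm{Lie}_{\{f_1,\ldots,f_m\}}(x)=\{g(x):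 g\in \mathrm{Lie}_{\{f_1,\ldots,f_m\}}\}$. For a real-valued function $g$ on an open set $\Omega\subset\mathbb{R}^n$, the Lipschitz singular support $\operatorname{sing\,supp}_{Lip} g$ is the smallest (relatively) closed subset of $\Omega$ such that $g$ is locally Lipschitz outside it; i.e. $x\in\Omega$ is not in it if and only if $g$ is Lipschitz continuous on some open set containing $x$. *)

theory Defs
  imports "HOL-Analysis.Analysis"
begin

(* Near every point a the map is the sum of a power series in several variables. The
   coefficients are indexed by multi-indices \<alpha> :: 'n \<Rightarrow> nat; has_sum over all multi-indices
   is unconditional, i.e. absolute, convergence. *)
definition real_analytic :: "(real^'n \<Rightarrow> real^'k) \<Rightarrow> bool" where
  "real_analytic f \<longleftrightarrow>
     (\<forall>a. \<exists>r>0. \<exists>c :: ('n \<Rightarrow> nat) \<Rightarrow> real^'k. \<forall>x\<in>ball a r.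
        ((\<lambda>\<alpha>. (\<Prod>i\<in>UNIV. (x $ i - a $ i) ^ \<alpha> i) *\<^sub>R c \<alpha>) has_sum f x) UNIV)"

definition lie_bracket ::
  "(real^'n \<Rightarrow> real^'n) \<Rightarrow> (real^'n \<Rightarrow> real^'n) \<Rightarrow> real^'n \<Rightarrow> real^'n" where
  "lie_bracket f g x = frechet_derivative g (at x) (f x) - frechet_derivative f (at x) (g x)"

(* frechet_derivative is only meaningful for differentiable maps; the Lie algebra is used
   for families F of analytic fields only, all of whose members are again analytic. *)
inductive_set lie_algebra :: "(real^'n \<Rightarrow> real^'n) set \<Rightarrow> (real^'n \<Rightarrow> real^'n) set"
  for F :: "(real^'n \<Rightarrow> real^'n) set" where
  gen: "f \<in> F \<Longrightarrow> f \<in> lie_algebra F"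
| zero: "(\<lambda>x. 0) \<in> lie_algebra F"
| add: "f \<in> lie_algebra F \<Longrightarrow> g \<in> lie_algebra F \<Longrightarrow> (\<lambda>x. f x + g x) \<in> lie_algebra F"
| scale: "f \<in> lie_algebra F \<Longrightarrow> (\<lambda>x. c *\<^sub>R f x) \<in> lie_algebra F"
| bracket: "f \<in> lie_algebra F \<Longrightarrow> g \<in> lie_algebra F \<Longrightarrow> lie_bracket f g \<in> lie_algebra F"

definition hoermander :: "('m \<Rightarrow> real^'n \<Rightarrow> real^'n) \<Rightarrow> bool" where
  "hoermander f \<longleftrightarrow> (\<forall>x. {g x | g. g \<in> lie_algebra (range f)} = UNIV)"

definition abs_cont_on :: "real \<Rightarrow> real \<Rightarrow> (real \<Rightarrow> 'a::metric_space) \<Rightarrow> bool" where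
  "abs_cont_on a b y \<longleftrightarrow>
     (\<forall>e>0. \<exists>d>0. \<forall>(k::nat) (s::nat \<Rightarrow> real) (t::nat \<Rightarrow> real).
        (\<forall>i<k. a \<le> s i \<and> s i \<le> t i \<and> t i \<le> b) \<longrightarrow>
        disjoint_family_on (\<lambda>i. {s i<..<t i}) {..<k} \<longrightarrow>
        (\<Sum>i<k. t i - s i) < d \<longrightarrow> (\<Sum>i<k. dist (y (s i)) (y (t i))) < e)"

(* Values at negative times are irrelevant. *)
definition controls :: "(real \<Rightarrow> real^'m) set" where
  "controls = {u. u \<in> borel_measurable (lebesgue_on {0..}) \<and> (\<forall>t\<ge>0. u t \<in> cball 0 1)}"

(* y is a (Caratheodory) solution on [0,T] of the control system with y(0) = x. *)
definition trajectory_on ::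
  "('m::finite \<Rightarrow> real^'n \<Rightarrow> real^'n) \<Rightarrow> (real \<Rightarrow> real^'m) \<Rightarrow> real^'n \<Rightarrow> real \<Rightarrow> (real \<Rightarrow> real^'n) \<Rightarrow> bool"
  where
  "trajectory_on f u x T y \<longleftrightarrow>
     y 0 = x \<and> abs_cont_on 0 T y \<and>
     (AE t in lebesgue_on {0..T}.
        (y has_vector_derivative (\<Sum>i\<in>UNIV. (u t $ i) *\<^sub>R f i (y t))) (at t within {0..T}))"

(* For locally Lipschitz fields solutions are unique, so a solution y on [0,t] is the restriction
   of the maximal one; the times t with such a y are those in the interval of existence. The
   infimum is a real one: the set is nonempty whenever K is nonempty and f is bracket generating. *)
definition min_time ::
  "('m::finite \<Rightarrow> real^'n \<Rightarrow> real^'n) \<Rightarrow> (real^'n) set \<Rightarrow> real^'n \<Rightarrow> real" where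
  "min_time f K x = Inf {t. t \<ge> 0 \<and> (\<exists>u\<in>controls. \<exists>y. trajectory_on f u x t y \<and> y t \<in> K)}"

definition sing_supp_Lip :: "'a::metric_space set \<Rightarrow> ('a \<Rightarrow> real) \<Rightarrow> 'a set" where
  "sing_supp_Lip \<Omega> g =
     {x \<in> \<Omega>. \<not> (\<exists>U. open U \<and> x \<in> U \<and> U \<subseteq> \<Omega> \<and> (\<exists>L. L-lipschitz_on U g))}"

lemma sing_supp_Lip_smallest:
  fixes g :: "'a::metric_space \<Rightarrow> real"
  defines "P \<equiv> \<lambda>\<Omega> C. closedin (top_of_set \<Omega>) C \<and>
     (\<forall>x\<in>\<Omega> - C. \<exists>U. open U \<and> x \<in> U \<and> U \<subseteq> \<Omega> - C \<and> (\<exists>L. L-lipschitz_on U g))"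
  assumes "open \<Omega>"
  shows "P \<Omega> (sing_supp_Lip \<Omega> g)" and "P \<Omega> C \<Longrightarrow> sing_supp_Lip \<Omega> g \<subseteq> C"
proof -
  let ?S = "sing_supp_Lip \<Omega> g"
  have sub: "U \<subseteq> \<Omega> - ?S" if "open U" "U \<subseteq> \<Omega>" "L-lipschitz_on U g" for U L
    using that unfolding sing_supp_Lip_def by blast
  have loc: "\<exists>U. open U \<and> x \<in> U \<and> U \<subseteq> \<Omega> - ?S \<and> (\<exists>L. L-lipschitz_on U g)"
    if "x \<in> \<Omega> - ?S" for x
    using that sub unfolding sing_supp_Lip_def by blast
  have "open (\<Omega> - ?S)"
    by (subst open_subopen) (use loc in blast)
  then have "openin (top_of_set \<Omega>) (\<Omega> - ?S)"
    by (simp add: open_subset)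
  moreover have "?S \<subseteq> \<Omega>"
    unfolding sing_supp_Lip_def by blast
  ultimately show "P \<Omega> ?S"
    unfolding P_def closedin_def using loc by simp
  show "P \<Omega> C \<Longrightarrow> ?S \<subseteq> C"
    unfolding P_def sing_supp_Lip_def by blast
qed

end

theory Submission
  imports Defs "HOL-Complex_Analysis.Cauchy_Integral_Formula"
begin

text \<open>
  Outside the zero set of an analytic function that does not vanish identically, the fields near a
  point either span the whole space or a contact distribution (a plane field with a transversal
  bracket); otherwise the fields would be involutive everywhere, against the bracket generating
  condition. In both cases there are, for nearby points \<open>x\<close> and \<open>z\<close>, diffeomorphisms moving
  \<open>z\<close> to \<open>x\<close> that preserve the distribution, equal the identity off a small ball disjoint from
  \<open>K\<close>, and are \<open>C |x - z|\<close>-close to the identity together with their derivative: flows of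
  cut-off contact vector fields. They carry a trajectory from \<open>z\<close> to \<open>K\<close> to a trajectory from
  \<open>x\<close> to \<open>K\<close> whose controls have norm at most \<open>1 + C |x - z|\<close>. Rescaling time gives
  \<open>T(x) \<le> (1 + C |x - z|) T(z)\<close>, so the minimum time function is locally Lipschitz there;
  no optimality of the trajectories is needed. If \<open>K\<close> could not be reached at all, the infimum
  would be the constant \<open>Inf {}\<close>.
\<close>

subsection \<open>Maps of class C^k\<close>

text \<open>Multiplying a field that preserves a plane field by a cutoff destroys the invariance.
  Contact fields are therefore generated by scalar functions (contact Hamiltonians), and the cutoff
  is applied to the function. Three functions generate a frame at the base point, and combinations
  of the frame with coefficients depending on time alone still preserve the plane field, so motion
  in every direction is available. Where three of the fields span the space nothing has to be
  preserved, and cut-off constant fields serve, with the zero covector field as constraint.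

  If \<phi> preserves the distribution, the defect D\<phi>(f j p) - f j (\<phi> p) lies in the
  distribution at \<phi> p and has size O(|x - z|). Writing it with bounded coefficients in the
  fields gives a control matrix, the identity plus O(|x - z|), and this is the source of the factor
  1 + C |x - z|.

  In dimension three all rank conditions are triple products of fields and brackets. Each case needs
  one of them to be nonzero at a single point; analyticity makes it nonzero almost
  everywhere.\<close>

primrec Ck :: "nat \<Rightarrow> ('a::real_normed_vector \<Rightarrow> 'b::real_normed_vector) \<Rightarrow> bool" where
  "Ck 0 f \<longleftrightarrow> continuous_on UNIV f"
| "Ck (Suc k) f \<longleftrightarrow>
     (\<forall>x. f differentiable at x) \<and> (\<forall>v. Ck k (\<lambda>x. frechet_derivative f (at x) v))"

lemma Ck_has_derivative:
  "Ck (Suc k) f \<Longrightarrow> (f has_derivative frechet_derivative f (at x)) (at x)"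
  by (simp add: frechet_derivative_works[symmetric])

lemma Ck_SucI:
  assumes "\<And>x. (f has_derivative f' x) (at x)" "\<And>v. Ck k (\<lambda>x. f' x v)"
  shows "Ck (Suc k) f"
proof -
  have "frechet_derivative f (at x) = f' x" for x
    using assms(1) frechet_derivative_at by metis
  then show ?thesis
    using assms by (auto simp: differentiable_def)
qed

lemma Ck_continuous: "Ck k f \<Longrightarrow> continuous_on S f"
  by (cases k)
    (auto intro: continuous_on_subset continuous_at_imp_continuous_on
      differentiable_imp_continuous_within)

lemma Ck_SucD: "Ck (Suc k) f \<Longrightarrow> Ck k f"
proof (induction k arbitrary: f)
  case 0
  then show ?case using Ck_continuous by (auto simp del: Ck.simps(2))
next
  case (Suc k)
  then show ?case by (metis Ck.simps(2))
qed

lemma Ck_const: "Ck k (\<lambda>x. c)"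
proof (induction k arbitrary: c)
  case (Suc k)
  show ?case by (rule Ck_SucI[where f'="\<lambda>x v. 0"]) (use Suc in auto)
qed simp

lemma Ck_ident: "Ck k (\<lambda>x. x)"
  by (cases k) (auto intro!: Ck_SucI[where f'="\<lambda>x v. v"] Ck_const simp del: Ck.simps(2)
      simp: has_derivative_ident)

lemma Ck_add:
  "Ck k f \<Longrightarrow> Ck k g \<Longrightarrow> Ck k (\<lambda>x. f x + g x)"
proof (induction k arbitrary: f g)
  case 0
  then show ?case by (auto intro: continuous_intros)
next
  case (Suc k)
  show ?case
    by (rule Ck_SucI[where f'="\<lambda>x v. frechet_derivative f (at x) v + frechet_derivative g (at x) v"])
      (use Suc in \<open>auto intro!: has_derivative_add Ck_has_derivative[of k] simp del: Ck.simps(2)\<close>, simp_all)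
qed

lemma (in bounded_bilinear) Ck:
  "Ck k f \<Longrightarrow> Ck k g \<Longrightarrow> Ck k (\<lambda>x. prod (f x) (g x))"
proof (induction k arbitrary: f g)
  case 0
  then show ?case by (auto intro: continuous_on)
next
  case (Suc k)
  show ?case
  proof (rule Ck_SucI)
    show "((\<lambda>x. prod (f x) (g x)) has_derivative
       (\<lambda>v. prod (f x) (frechet_derivative g (at x) v) + prod (frechet_derivative f (at x) v) (g x))) (at x)" for x
      using Suc.prems by (intro FDERIV Ck_has_derivative)
    show "Ck k (\<lambda>x. prod (f x) (frechet_derivative g (at x) v) + prod (frechet_derivative f (at x) v) (g x))" for v
      using Suc.prems Suc.IH Ck_SucD[OF Suc.prems(1)] Ck_SucD[OF Suc.prems(2)] by (intro Ck_add) auto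
  qed
qed

lemmas Ck_scaleR = bounded_bilinear.Ck[OF bounded_bilinear_scaleR]
lemmas Ck_inner = bounded_bilinear.Ck[OF bounded_bilinear_inner]
lemmas Ck_mult = bounded_bilinear.Ck[OF bounded_bilinear_mult]

lemma Ck_scaleR_const: "Ck k f \<Longrightarrow> Ck k (\<lambda>x. c *\<^sub>R f x)"
  by (rule Ck_scaleR[OF Ck_const])

lemma Ck_minus: "Ck k f \<Longrightarrow> Ck k (\<lambda>x. - f x)"
  using Ck_scaleR_const[of k f "-1"] by simp

lemma Ck_diff: "Ck k f \<Longrightarrow> Ck k g \<Longrightarrow> Ck k (\<lambda>x. f x - g x)"
  using Ck_add[of k f "\<lambda>x. - g x"] Ck_minus[of k g] by simp

lemma Ck_sum: "(\<And>i. i \<in> I \<Longrightarrow> Ck k (f i)) \<Longrightarrow> Ck k (\<lambda>x. \<Sum>i\<in>I. f i x)"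
  by (induction I rule: infinite_finite_induct) (auto intro: Ck_add Ck_const)

lemma frechet_derivative_euclidean:
  fixes f :: "'a::euclidean_space \<Rightarrow> 'b::real_normed_vector"
  assumes "f differentiable at x"
  shows "frechet_derivative f (at x) v = (\<Sum>b\<in>Basis. (v \<bullet> b) *\<^sub>R frechet_derivative f (at x) b)"
proof -
  interpret bounded_linear "frechet_derivative f (at x)"
    using assms by (simp add: frechet_derivative_works has_derivative_bounded_linear)
  show ?thesis
    by (subst euclidean_representation[of v, symmetric], subst sum) (simp add: scaleR)
qed

text \<open>\<open>Ck\<close> speaks of derivatives in fixed directions only. Expanding the moving
  direction \<open>g x\<close> over the finite basis reduces to these; Lie brackets are derivatives
  in moving directions.\<close>

lemma Ck_frechet_derivative:
  fixes f :: "'a::euclidean_space \<Rightarrow> 'b::real_normed_vector"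
  assumes "Ck (Suc k) f" "Ck k g"
  shows "Ck k (\<lambda>x. frechet_derivative f (at x) (g x))"
proof -
  have "Ck k (\<lambda>x. \<Sum>b\<in>Basis. (g x \<bullet> b) *\<^sub>R frechet_derivative f (at x) b)"
    using assms by (intro Ck_sum Ck_scaleR Ck_inner Ck_const) auto
  moreover have "frechet_derivative f (at x) (g x) =
      (\<Sum>b\<in>Basis. (g x \<bullet> b) *\<^sub>R frechet_derivative f (at x) b)" for x
    using assms(1) by (intro frechet_derivative_euclidean) simp
  ultimately show ?thesis by presburger
qed

lemma Ck_lie_bracket:
  assumes "Ck (Suc k) f" "Ck (Suc k) g"
  shows "Ck k (lie_bracket f g)"
  unfolding lie_bracket_def[abs_def]
  by (intro Ck_diff Ck_frechet_derivative assms Ck_SucD[OF assms(1)] Ck_SucD[OF assms(2)])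

section \<open>Cutoff functions of finite smoothness\<close>

lemma max_0_power_has_derivative:
  fixes t :: real
  shows "((\<lambda>t. max 0 t ^ Suc (Suc m)) has_field_derivative real (Suc (Suc m)) * max 0 t ^ Suc m) (at t)"
proof -
  consider "t < 0" | "t > 0" | "t = 0" by linarith
  then show ?thesis
  proof cases
    case 1
    show ?thesis
      by (rule has_field_derivative_transform_within_open[where f="\<lambda>t. 0" and S="{..<0}"])
        (use 1 in \<open>auto simp: max_def\<close>)
  next
    case 2
    show ?thesis
      by (rule has_field_derivative_transform_within_open[where f="\<lambda>t. t ^ Suc (Suc m)" and S="{0<..}"])
        (use 2 DERIV_pow[of "Suc (Suc m)" t] in \<open>simp_all add: max_def mult.commute del: power_Suc\<close>)
  next
    case 3
    have "((\<lambda>t::real. max 0 t ^ Suc m) \<longlongrightarrow> max 0 0 ^ Suc m) (at 0)"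
      by (intro tendsto_intros)
    then have "((\<lambda>t::real. max 0 t ^ Suc m) \<longlongrightarrow> 0) (at 0)" by simp
    then have lim: "((\<lambda>t::real. \<bar>max 0 t ^ Suc m\<bar>) \<longlongrightarrow> 0) (at 0)"
      by (rule tendsto_rabs_zero)
    have bound: "\<forall>t::real. norm (max 0 t ^ Suc (Suc m) / t) \<le> \<bar>max 0 t ^ Suc m\<bar>"
    proof
      show "norm (max 0 t ^ Suc (Suc m) / t) \<le> \<bar>max 0 t ^ Suc m\<bar>" for t :: real
        by (cases "t > 0") simp_all
    qed
    have "((\<lambda>t::real. max 0 t ^ Suc (Suc m) / t) \<longlongrightarrow> 0) (at 0)"
      by (rule Lim_null_comparison[OF always_eventually[OF bound] lim])
    then show ?thesis
      unfolding has_field_derivative_iff 3 by (simp del: power_Suc)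
  qed
qed

text \<open>A truncated polynomial as cutoff: only finitely many derivatives are ever taken.
  Differentiation lowers \<open>m\<close> by one up to a linear factor, so the class follows by
  induction; the exponent \<open>m + 2\<close> keeps the exponent of the derivative positive even
  for \<open>m = 0\<close>.\<close>

definition bump :: "nat \<Rightarrow> 'a::euclidean_space \<Rightarrow> real \<Rightarrow> 'a \<Rightarrow> real" where
  "bump m x0 r x = max 0 (r\<^sup>2 - (x - x0) \<bullet> (x - x0)) ^ Suc (Suc m)"

lemma bump_has_derivative:
  "(bump m x0 r has_derivative (\<lambda>v. real (Suc (Suc m)) * max 0 (r\<^sup>2 - (x - x0) \<bullet> (x - x0)) ^ Suc m
     * (- 2 * ((x - x0) \<bullet> v)))) (at x)"
proof -
  have "((\<lambda>x. r\<^sup>2 - (x - x0) \<bullet> (x - x0)) has_derivative (\<lambda>v. - 2 * ((x - x0) \<bullet> v))) (at x)"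
    by (auto intro!: derivative_eq_intros simp: inner_commute)
  from has_derivative_compose[OF this has_field_derivative_imp_has_derivative[OF max_0_power_has_derivative[of m]]]
  show ?thesis unfolding bump_def[abs_def] by simp
qed

lemma Ck_bump: "k \<le> m \<Longrightarrow> Ck k (bump m x0 r)"
proof (induction k arbitrary: m)
  case 0
  then show ?case unfolding bump_def[abs_def] by (auto intro!: continuous_intros)
next
  case (Suc k)
  show ?case
  proof (rule Ck_SucI[OF bump_has_derivative])
    fix v
    obtain l where m: "m = Suc l" using Suc.prems by (cases m) auto
    have "Ck k (\<lambda>x. (real (Suc (Suc m)) * bump l x0 r x) * (- 2 * ((x - x0) \<bullet> v)))"
      using Suc m by (intro Ck_mult Ck_const Ck_inner Ck_diff Ck_ident) auto
    then show "Ck k (\<lambda>x. real (Suc (Suc m)) * max 0 (r\<^sup>2 - (x - x0) \<bullet> (x - x0)) ^ Suc m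
        * (- 2 * ((x - x0) \<bullet> v)))"
      by (simp add: bump_def m mult_ac)
  qed
qed

lemma bump_eq_0: "x \<notin> cball x0 r \<Longrightarrow> r \<ge> 0 \<Longrightarrow> bump m x0 r x = 0"
proof -
  assume "x \<notin> cball x0 r" "r \<ge> 0"
  then have "r\<^sup>2 \<le> (norm (x - x0))\<^sup>2"
    by (intro power_mono) (auto simp: dist_norm norm_minus_commute)
  then show ?thesis by (simp add: bump_def power2_norm_eq_inner)
qed

subsection \<open>Power series in several variables\<close>

text \<open>In finite dimension unconditional convergence is absolute. This turns convergence at one
  point into a numerical majorant.\<close>

lemma abs_summable_on_vec:
  fixes f :: "'a \<Rightarrow> real^'k"
  assumes "f summable_on A"
  shows "(\<lambda>x. norm (f x)) summable_on A"
proof -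
  have "(\<lambda>x. norm (f x $ i)) summable_on A" for i
    using summable_on_bounded_linear[OF bounded_linear_vec_nth assms]
    by (rule summable_on_iff_abs_summable_on_real[THEN iffD1])
  then have "(\<lambda>x. \<Sum>i\<in>I. norm (f x $ i)) summable_on A" for I
    by (induction I rule: infinite_finite_induct) (auto intro: summable_on_add)
  from this[of UNIV] show ?thesis
    by (rule summable_on_comparison_test) (use norm_le_l1_cart in auto)
qed

lemma has_sum_sum:
  fixes f :: "'i \<Rightarrow> 'a \<Rightarrow> 'b::topological_comm_monoid_add"
  assumes "\<And>i. i \<in> I \<Longrightarrow> (f i has_sum s i) A"
  shows "((\<lambda>x. \<Sum>i\<in>I. f i x) has_sum (\<Sum>i\<in>I. s i)) A"
  using assms by (induction I rule: infinite_finite_induct) (auto intro: has_sum_add has_sum_0)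

lemma infinite_UNIV_multi_index: "infinite (UNIV :: ('n \<Rightarrow> nat) set)"
proof
  assume "finite (UNIV :: ('n \<Rightarrow> nat) set)"
  then have "finite (range (\<lambda>k::nat. \<lambda>i::'n. k))"
    by (rule finite_subset[rotated]) simp
  moreover have "inj (\<lambda>k::nat. \<lambda>i::'n. k)"
    by (simp add: inj_def fun_eq_iff)
  ultimately show False
    using finite_imageD by blast
qed

definition mpow :: "('n::finite \<Rightarrow> nat) \<Rightarrow> real^'n \<Rightarrow> real" where
  "mpow \<alpha> y = (\<Prod>i\<in>UNIV. (y $ i) ^ \<alpha> i)"

text \<open>The j-th partial derivative of the monomial \<open>mpow \<alpha>\<close>. For
  \<open>\<alpha> j = 0\<close> the factor \<open>real (\<alpha> j)\<close> kills the term, so the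
  truncated exponent \<open>\<alpha> j - 1\<close> does no harm.\<close>

definition dmpow :: "'n \<Rightarrow> ('n::finite \<Rightarrow> nat) \<Rightarrow> real^'n \<Rightarrow> real" where
  "dmpow j \<alpha> y = real (\<alpha> j) * (y $ j) ^ (\<alpha> j - 1) * (\<Prod>i\<in>UNIV - {j}. (y $ i) ^ \<alpha> i)"

lemma mpow_has_derivative:
  "((\<lambda>x. mpow \<alpha> (x - a)) has_derivative (\<lambda>v. \<Sum>j\<in>UNIV. (v $ j) * dmpow j \<alpha> (x - a))) (at x within S)"
proof -
  have "((\<lambda>x. ((x - a) $ i) ^ \<alpha> i) has_derivative
      (\<lambda>v. v $ i * (real (\<alpha> i) * ((x - a) $ i) ^ (\<alpha> i - 1)))) (at x within S)" for i
    by (auto intro!: derivative_eq_intros bounded_linear_imp_has_derivative bounded_linear_vec_nth simp: mult_ac)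
  from has_derivative_prod[OF this, where I=UNIV]
  show ?thesis unfolding mpow_def dmpow_def by (simp add: mult.assoc)
qed

lemma mult_half_power_le: "real k * (1/2) ^ (k - 1) \<le> 1"
proof (cases k)
  case (Suc l)
  have "real (Suc l) \<le> 2 ^ l"
    by (induction l) auto
  then show ?thesis using Suc by (simp add: field_simps power_divide)
qed simp

text \<open>Halving the radius absorbs the exponent brought down by differentiation, because k /
  2^(k - 1) is at most 1. The differentiated series is thus dominated by the original one at the
  corner (\<rho>, ..., \<rho>).\<close>

lemma dmpow_bound:
  assumes "\<rho> > 0" "\<And>i. \<bar>y $ i\<bar> \<le> \<rho> / 2"
  shows "\<bar>dmpow j \<alpha> y\<bar> \<le> mpow \<alpha> (\<chi> i. \<rho>) / \<rho>"
proof -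
  have "(\<Prod>i\<in>UNIV - {j}. \<bar>y $ i\<bar> ^ \<alpha> i) \<le> (\<Prod>i\<in>UNIV - {j}. \<rho> ^ \<alpha> i)"
    using assms by (intro prod_mono conjI power_mono) (auto intro: order_trans[OF assms(2)])
  moreover have "real (\<alpha> j) * \<bar>y $ j\<bar> ^ (\<alpha> j - 1) \<le> \<rho> ^ \<alpha> j / \<rho>"
  proof (cases "\<alpha> j")
    case (Suc l)
    have "real (\<alpha> j) * \<bar>y $ j\<bar> ^ (\<alpha> j - 1) \<le> real (\<alpha> j) * (\<rho> / 2) ^ (\<alpha> j - 1)"
      using assms by (intro mult_left_mono power_mono) auto
    also have "\<dots> = (real (\<alpha> j) * (1/2) ^ (\<alpha> j - 1)) * \<rho> ^ (\<alpha> j - 1)"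
      by (simp add: power_divide)
    also have "\<dots> \<le> 1 * \<rho> ^ (\<alpha> j - 1)"
      using assms by (intro mult_right_mono mult_half_power_le) auto
    finally show ?thesis using Suc assms by simp
  qed (use assms in auto)
  ultimately have "\<bar>dmpow j \<alpha> y\<bar> \<le> (\<rho> ^ \<alpha> j / \<rho>) * (\<Prod>i\<in>UNIV - {j}. \<rho> ^ \<alpha> i)"
    unfolding dmpow_def abs_mult abs_prod power_abs using assms
    by (intro mult_mono) (auto intro!: prod_nonneg)
  also have "\<dots> = mpow \<alpha> (\<chi> i. \<rho>) / \<rho>"
    unfolding mpow_def by (simp add: prod.remove[of UNIV j])
  finally show ?thesis .
qed

text \<open>Raising the j-th exponent by one is injective and misses exactly the multi-indices with
  \<open>\<alpha> j = 0\<close>, whose terms vanish. A differentiated series is therefore again a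
  power series about the same centre.\<close>

lemma dmpow_reindex:
  fixes c :: "('n::finite \<Rightarrow> nat) \<Rightarrow> 'b::real_normed_vector"
  assumes "((\<lambda>\<alpha>. dmpow j \<alpha> y *\<^sub>R c \<alpha>) has_sum s) UNIV"
  shows "((\<lambda>\<beta>. mpow \<beta> y *\<^sub>R (real (Suc (\<beta> j)) *\<^sub>R c (\<beta>(j := Suc (\<beta> j))))) has_sum s) UNIV"
proof -
  let ?e = "\<lambda>\<beta>::'n \<Rightarrow> nat. \<beta>(j := Suc (\<beta> j))"
  have "inj ?e"
  proof (rule injI)
    fix \<beta> \<gamma> :: "'n \<Rightarrow> nat" assume eq: "?e \<beta> = ?e \<gamma>"
    show "\<beta> = \<gamma>"
    proof
      fix i show "\<beta> i = \<gamma> i" using fun_cong[OF eq, of i] by (auto split: if_splits)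
    qed
  qed
  moreover have "((\<lambda>\<alpha>. dmpow j \<alpha> y *\<^sub>R c \<alpha>) has_sum s) (range ?e)"
  proof (subst has_sum_cong_neutral[where T=UNIV])
    fix \<alpha> :: "'n \<Rightarrow> nat" assume "\<alpha> \<in> UNIV - range ?e"
    moreover have "\<alpha> \<in> range ?e" if "\<alpha> j > 0"
      by (rule range_eqI[of _ _ "\<alpha>(j := \<alpha> j - 1)"]) (use that in auto)
    ultimately have "\<alpha> j = 0" by blast
    then show "dmpow j \<alpha> y *\<^sub>R c \<alpha> = 0" by (simp add: dmpow_def)
  qed (use assms in auto)
  ultimately have "((\<lambda>\<beta>. dmpow j (?e \<beta>) y *\<^sub>R c (?e \<beta>)) has_sum s) UNIV"
    by (subst (asm) has_sum_reindex) (auto simp: o_def)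
  moreover have "dmpow j (?e \<beta>) y = mpow \<beta> y * real (Suc (\<beta> j))" for \<beta>
  proof -
    have "(\<Prod>i\<in>UNIV - {j}. (y $ i) ^ (?e \<beta>) i) = (\<Prod>i\<in>UNIV - {j}. (y $ i) ^ \<beta> i)"
      by (rule prod.cong) auto
    then show ?thesis
      unfolding dmpow_def mpow_def by (simp add: prod.remove[of UNIV j])
  qed
  ultimately show ?thesis by simp
qed

text \<open>Termwise differentiation. Absolute convergence at the single corner point yields one
  summable majorant for all partial derivatives on a smaller ball.\<close>

lemma power_series_has_derivative:
  fixes c :: "('n::finite \<Rightarrow> nat) \<Rightarrow> real^'k"
  assumes "r > 0" and fs: "\<forall>x\<in>ball a r. ((\<lambda>\<alpha>. mpow \<alpha> (x - a) *\<^sub>R c \<alpha>) has_sum f x) UNIV"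
  shows "\<exists>s>0. \<exists>g. \<forall>x\<in>ball a s.
    (\<forall>j. ((\<lambda>\<alpha>. dmpow j \<alpha> (x - a) *\<^sub>R c \<alpha>) has_sum g j x) UNIV) \<and>
    (f has_derivative (\<lambda>v. \<Sum>j\<in>UNIV. v $ j *\<^sub>R g j x)) (at x)"
proof -
  \<comment> \<open>With n coordinates, the norm of (\<rho>, ..., \<rho>) is at most n \<rho> = r /
    2, so the corner lies inside the ball of convergence.\<close>
  define \<rho> where "\<rho> = r / (2 * real CARD('n))"
  have \<rho>: "\<rho> > 0" using assms(1) by (simp add: \<rho>_def)
  have "norm ((\<chi> i. \<rho>) :: real^'n) \<le> (\<Sum>i\<in>(UNIV::'n set). \<rho>)"
    using norm_le_l1_cart[of "(\<chi> i. \<rho>) :: real^'n"] \<rho> by simp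
  also have "\<dots> < r" using assms(1) by (simp add: \<rho>_def)
  finally have "a + (\<chi> i. \<rho>) \<in> ball a r" by (simp add: dist_norm)
  from bspec[OF fs this] have "(\<lambda>\<alpha>. norm (mpow \<alpha> (\<chi> i. \<rho>) *\<^sub>R c \<alpha>)) summable_on UNIV"
    by (intro abs_summable_on_vec) (auto simp: summable_on_def)
  then obtain S where "((\<lambda>\<alpha>. norm (mpow \<alpha> (\<chi> i. \<rho>) *\<^sub>R c \<alpha>)) has_sum S) UNIV"
    by (auto simp: summable_on_def)
  \<comment> \<open>An enumeration of the multi-indices turns unconditional sums into ordinary
    series, to which the theorems on uniform limits and derivatives of series apply.\<close>
  moreover define e where "e = from_nat_into (UNIV :: ('n \<Rightarrow> nat) set)"
  then have e: "bij_betw e UNIV UNIV"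
    using bij_betw_from_nat_into[OF countableI_type infinite_UNIV_multi_index] by simp
  ultimately have "((\<lambda>k. norm (mpow (e k) (\<chi> i. \<rho>) *\<^sub>R c (e k))) has_sum S) UNIV"
    by (subst has_sum_reindex_bij_betw[OF e])
  then have M: "summable (\<lambda>k. norm (mpow (e k) (\<chi> i. \<rho>) *\<^sub>R c (e k)) / \<rho>)"
    by (intro summable_divide) (auto dest!: has_sum_imp_sums simp: summable_def)
  define B where "B = ball a (\<rho> / 2)"
  have bd: "norm (dmpow j (e k) (x - a) *\<^sub>R c (e k)) \<le> norm (mpow (e k) (\<chi> i. \<rho>) *\<^sub>R c (e k)) / \<rho>"
    if "x \<in> B" for x j k
  proof -
    have "\<bar>(x - a) $ i\<bar> \<le> \<rho> / 2" for i
      using that component_le_norm_cart[of "x - a" i] by (simp add: B_def dist_norm norm_minus_commute)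
    from dmpow_bound[OF \<rho> this, of j "e k"]
    have "\<bar>dmpow j (e k) (x - a)\<bar> * norm (c (e k)) \<le> mpow (e k) (\<chi> i. \<rho>) / \<rho> * norm (c (e k))"
      by (rule mult_right_mono) simp
    also have "\<dots> \<le> \<bar>mpow (e k) (\<chi> i. \<rho>)\<bar> / \<rho> * norm (c (e k))"
      using \<rho> by (intro mult_right_mono divide_right_mono) auto
    finally show ?thesis by simp
  qed
  define g where "g j x = (\<Sum>k. dmpow j (e k) (x - a) *\<^sub>R c (e k))" for j x
  have g: "((\<lambda>\<alpha>. dmpow j \<alpha> (x - a) *\<^sub>R c \<alpha>) has_sum g j x) UNIV" if "x \<in> B" for j x
  proof -
    have ns: "summable (\<lambda>k. norm (dmpow j (e k) (x - a) *\<^sub>R c (e k)))"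
      by (rule summable_comparison_test'[OF M, where N=0], unfold real_norm_def abs_norm_cancel, rule bd[OF that])
    then have "(\<lambda>k. dmpow j (e k) (x - a) *\<^sub>R c (e k)) sums g j x"
      unfolding g_def by (rule summable_sums[OF summable_norm_cancel])
    then have "((\<lambda>k. dmpow j (e k) (x - a) *\<^sub>R c (e k)) has_sum g j x) UNIV"
      using ns by (intro norm_summable_imp_has_sum)
    then show ?thesis by (subst (asm) has_sum_reindex_bij_betw[OF e])
  qed
  have unif: "uniform_limit B (\<lambda>n x. \<Sum>k<n. dmpow j (e k) (x - a) *\<^sub>R c (e k)) (g j) sequentially" for j
    unfolding g_def[abs_def] by (rule Weierstrass_m_test[OF _ M]) (rule bd)
  have sub: "B \<subseteq> ball a r"
  proof -
    have "real CARD('n) \<ge> 1" by (simp add: Suc_leI)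
    then have "\<rho> \<le> r / 1"
      unfolding \<rho>_def using assms(1) by (intro divide_left_mono) linarith+
    then show ?thesis using \<rho> unfolding B_def by (intro subset_ball) simp
  qed
  have fsums: "(\<lambda>k. mpow (e k) (x - a) *\<^sub>R c (e k)) sums f x" if "x \<in> B" for x
    using fs[rule_format, of x] that sub
    by (intro has_sum_imp_sums) (subst has_sum_reindex_bij_betw[OF e], auto)
  have "\<exists>h. \<forall>x\<in>B. (\<lambda>k. mpow (e k) (x - a) *\<^sub>R c (e k)) sums h x \<and>
      (h has_derivative (\<lambda>v. \<Sum>j\<in>UNIV. v $ j *\<^sub>R g j x)) (at x within B)"
  proof (rule has_derivative_series)
    show "convex B" by (simp add: B_def)
    show "a \<in> B" using \<rho> by (simp add: B_def)
    then show "(\<lambda>k. mpow (e k) (a - a) *\<^sub>R c (e k)) sums f a" by (rule fsums)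
    show "((\<lambda>x. mpow (e k) (x - a) *\<^sub>R c (e k)) has_derivative
       (\<lambda>v. (\<Sum>j\<in>UNIV. v $ j * dmpow j (e k) (x - a)) *\<^sub>R c (e k))) (at x within B)" for k x
      by (intro has_derivative_scaleR_left mpow_has_derivative)
    fix \<epsilon> :: real assume "\<epsilon> > 0"
    \<comment> \<open>The differential is a sum over the coordinate directions; each of them
      receives an equal share of \<epsilon>.\<close>
    define \<eta> where "\<eta> = \<epsilon> / real CARD('n)"
    have \<eta>: "\<eta> > 0" using \<open>\<epsilon> > 0\<close> by (simp add: \<eta>_def)
    have "\<forall>\<^sub>F n in sequentially. \<forall>j. \<forall>x\<in>B.
        dist (\<Sum>k<n. dmpow j (e k) (x - a) *\<^sub>R c (e k)) (g j x) < \<eta>"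
      using unif \<eta> by (intro eventually_all_finite) (auto simp: uniform_limit_iff)
    then show "\<forall>\<^sub>F n in sequentially. \<forall>x\<in>B. \<forall>h.
        norm ((\<Sum>k<n. (\<Sum>j\<in>UNIV. h $ j * dmpow j (e k) (x - a)) *\<^sub>R c (e k))
          - (\<Sum>j\<in>UNIV. h $ j *\<^sub>R g j x)) \<le> \<epsilon> * norm h"
    proof eventually_elim
      case (elim n)
      show ?case
      proof (intro ballI allI)
        fix x h assume "x \<in> B"
        have "(\<Sum>k<n. (\<Sum>j\<in>UNIV. h $ j * dmpow j (e k) (x - a)) *\<^sub>R c (e k))
            = (\<Sum>k<n. \<Sum>j\<in>UNIV. h $ j *\<^sub>R dmpow j (e k) (x - a) *\<^sub>R c (e k))"
          by (simp add: scaleR_sum_left)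
        also have "\<dots> = (\<Sum>j\<in>UNIV. h $ j *\<^sub>R (\<Sum>k<n. dmpow j (e k) (x - a) *\<^sub>R c (e k)))"
          by (subst sum.swap) (simp add: scaleR_sum_right)
        finally have "norm ((\<Sum>k<n. (\<Sum>j\<in>UNIV. h $ j * dmpow j (e k) (x - a)) *\<^sub>R c (e k))
          - (\<Sum>j\<in>UNIV. h $ j *\<^sub>R g j x)) =
          norm (\<Sum>j\<in>UNIV. h $ j *\<^sub>R ((\<Sum>k<n. dmpow j (e k) (x - a) *\<^sub>R c (e k)) - g j x))"
          by (simp add: sum_subtractf scaleR_diff_right)
        also have "\<dots> \<le> (\<Sum>j\<in>(UNIV::'n set). norm h * \<eta>)"
        proof (rule sum_norm_le)
          fix j
          have "norm ((\<Sum>k<n. dmpow j (e k) (x - a) *\<^sub>R c (e k)) - g j x) \<le> \<eta>"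
            using elim \<open>x \<in> B\<close> by (auto simp: dist_norm intro: less_imp_le)
          then show "norm (h $ j *\<^sub>R ((\<Sum>k<n. dmpow j (e k) (x - a) *\<^sub>R c (e k)) - g j x)) \<le> norm h * \<eta>"
            unfolding norm_scaleR real_norm_def by (intro mult_mono component_le_norm_cart) auto
        qed
        also have "\<dots> = \<epsilon> * norm h" by (simp add: \<eta>_def)
        finally show "norm ((\<Sum>k<n. (\<Sum>j\<in>UNIV. h $ j * dmpow j (e k) (x - a)) *\<^sub>R c (e k))
          - (\<Sum>j\<in>UNIV. h $ j *\<^sub>R g j x)) \<le> \<epsilon> * norm h" .
      qed
    qed
  qed
  then obtain h where h: "\<And>x. x \<in> B \<Longrightarrow> (\<lambda>k. mpow (e k) (x - a) *\<^sub>R c (e k)) sums h x"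
      "\<And>x. x \<in> B \<Longrightarrow> (h has_derivative (\<lambda>v. \<Sum>j\<in>UNIV. v $ j *\<^sub>R g j x)) (at x within B)"
    by blast
  have B: "open B" by (simp add: B_def)
  have hf: "h x = f x" if "x \<in> B" for x
    using h(1)[OF that] fsums[OF that] by (rule sums_unique2)
  have f': "(f has_derivative (\<lambda>v. \<Sum>j\<in>UNIV. v $ j *\<^sub>R g j x)) (at x)" if "x \<in> B" for x
  proof (rule has_derivative_transform_within_open[OF _ B that hf])
    show "(h has_derivative (\<lambda>v. \<Sum>j\<in>UNIV. v $ j *\<^sub>R g j x)) (at x)"
      using h(2)[OF that] by (simp only: at_within_open[OF that B])
  qed
  show ?thesis
    using g f' \<rho> unfolding B_def
    by (intro exI[of _ "\<rho> / 2"] exI[of _ g] conjI ballI allI) auto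
qed

lemma real_analytic_iff_mpow:
  "real_analytic f \<longleftrightarrow>
     (\<forall>a. \<exists>r>0. \<exists>c. \<forall>x\<in>ball a r. ((\<lambda>\<alpha>. mpow \<alpha> (x - a) *\<^sub>R c \<alpha>) has_sum f x) UNIV)"
  by (simp add: real_analytic_def mpow_def)

lemma real_analytic_has_derivative:
  fixes f :: "real^'n \<Rightarrow> real^'k"
  assumes "real_analytic f"
  shows "\<exists>s>0. \<exists>c g. \<forall>x\<in>ball a s.
    (\<forall>j. ((\<lambda>\<alpha>. dmpow j \<alpha> (x - a) *\<^sub>R c \<alpha>) has_sum g j x) UNIV) \<and>
    (f has_derivative (\<lambda>v. \<Sum>j\<in>UNIV. v $ j *\<^sub>R g j x)) (at x)"
proof -
  obtain r c where "r > 0"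
    and "\<forall>y\<in>ball a r. ((\<lambda>\<alpha>. mpow \<alpha> (y - a) *\<^sub>R c \<alpha>) has_sum f y) UNIV"
    using assms[unfolded real_analytic_iff_mpow, rule_format] by blast
  from power_series_has_derivative[OF this] show ?thesis
    by blast
qed

lemma real_analytic_differentiable:
  fixes f :: "real^'n \<Rightarrow> real^'k"
  assumes "real_analytic f"
  shows "f differentiable at x"
proof -
  from real_analytic_has_derivative[OF assms, of x]
  obtain s c g where s: "s > 0"
    and sg: "\<forall>y\<in>ball x s. (\<forall>j. ((\<lambda>\<alpha>. dmpow j \<alpha> (y - x) *\<^sub>R c \<alpha>) has_sum g j y) UNIV) \<and>
    (f has_derivative (\<lambda>v. \<Sum>j\<in>UNIV. v $ j *\<^sub>R g j y)) (at y)"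
    by (elim exE conjE)
  have "x \<in> ball x s" using s by simp
  from bspec[OF sg this, THEN conjunct2] show ?thesis
    by (rule differentiableI)
qed

lemma real_analytic_directional_derivative:
  fixes f :: "real^'n \<Rightarrow> real^'k"
  assumes "real_analytic f"
  shows "real_analytic (\<lambda>x. frechet_derivative f (at x) v)"
  unfolding real_analytic_iff_mpow
proof
  fix a
  from real_analytic_has_derivative[OF assms, of a]
  obtain s c g where s: "s > 0"
    and sg: "\<forall>x\<in>ball a s. (\<forall>j. ((\<lambda>\<alpha>. dmpow j \<alpha> (x - a) *\<^sub>R c \<alpha>) has_sum g j x) UNIV) \<and>
    (f has_derivative (\<lambda>v. \<Sum>j\<in>UNIV. v $ j *\<^sub>R g j x)) (at x)"
    by (elim exE conjE)
  have g: "((\<lambda>\<alpha>. dmpow j \<alpha> (x - a) *\<^sub>R c \<alpha>) has_sum g j x) UNIV"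
    and f: "(f has_derivative (\<lambda>v. \<Sum>j\<in>UNIV. v $ j *\<^sub>R g j x)) (at x)" if "x \<in> ball a s" for x j
    using sg that by simp_all
  show "\<exists>r>0. \<exists>c. \<forall>x\<in>ball a r.
      ((\<lambda>\<alpha>. mpow \<alpha> (x - a) *\<^sub>R c \<alpha>) has_sum frechet_derivative f (at x) v) UNIV"
  proof (intro exI conjI ballI)
    fix x assume x: "x \<in> ball a s"
    have "((\<lambda>\<alpha>. \<Sum>j\<in>UNIV. v $ j *\<^sub>R mpow \<alpha> (x - a) *\<^sub>R (real (Suc (\<alpha> j)) *\<^sub>R c (\<alpha>(j := Suc (\<alpha> j)))))
        has_sum (\<Sum>j\<in>UNIV. v $ j *\<^sub>R g j x)) UNIV"
      by (intro has_sum_sum has_sum_scaleR dmpow_reindex g x)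
    moreover have "frechet_derivative f (at x) v = (\<Sum>j\<in>UNIV. v $ j *\<^sub>R g j x)"
      by (simp only: frechet_derivative_at[OF f[OF x], symmetric])
    ultimately show "((\<lambda>\<alpha>. mpow \<alpha> (x - a) *\<^sub>R (\<Sum>j\<in>UNIV. v $ j *\<^sub>R real (Suc (\<alpha> j)) *\<^sub>R c (\<alpha>(j := Suc (\<alpha> j)))))
       has_sum frechet_derivative f (at x) v) UNIV"
      by (simp add: scaleR_sum_right mult_ac)
  qed (rule s)
qed

lemma real_analytic_Ck: "real_analytic f \<Longrightarrow> Ck k f"
proof (induction k arbitrary: f)
  case 0
  then show ?case
    by (auto intro!: continuous_at_imp_continuous_on differentiable_imp_continuous_within
        real_analytic_differentiable)
next
  case (Suc k)
  then show ?case
    by (auto intro: real_analytic_differentiable real_analytic_directional_derivative)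
qed

subsection \<open>Zero sets of analytic functions\<close>

text \<open>Analyticity of restrictions to lines, about every point of every line. Closure under
  products then needs only the Cauchy product in one variable, and the zero set argument needs no
  more than lines.\<close>

definition line_analytic :: "('a::real_vector \<Rightarrow> real) \<Rightarrow> bool" where
  "line_analytic h \<longleftrightarrow>
     (\<forall>a v. \<exists>r>0. \<exists>c. \<forall>t. \<bar>t\<bar> < r \<longrightarrow> (\<lambda>n. c n * t ^ n) sums h (a + t *\<^sub>R v))"

lemma line_analyticE:
  assumes "line_analytic h"
  obtains r c where "r > 0" "\<forall>t. \<bar>t\<bar> < r \<longrightarrow> (\<lambda>n. c n * t ^ n) sums h (a + t *\<^sub>R v)"
  using assms unfolding line_analytic_def by blast

lemma line_analytic_const: "line_analytic (\<lambda>x. k)"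
proof -
  have "(\<lambda>n. (if n = 0 then k else 0) * t ^ n) sums k" for t :: real
    using sums_single[of 0 "\<lambda>n. k * t ^ n"] by (simp add: if_distrib[of "\<lambda>z. z * _"] cong: if_cong)
  then show ?thesis
    unfolding line_analytic_def
    by (intro allI exI[of _ "1::real"] conjI exI[of _ "\<lambda>n. if n = 0 then k else 0"]) simp_all
qed

lemma line_analytic_add:
  assumes "line_analytic g" "line_analytic h"
  shows "line_analytic (\<lambda>x. g x + h x)"
  unfolding line_analytic_def
proof (intro allI)
  fix a v
  obtain r c where 1: "r > 0" "\<forall>t. \<bar>t\<bar> < r \<longrightarrow> (\<lambda>n. c n * t ^ n) sums g (a + t *\<^sub>R v)"
    by (rule line_analyticE[OF assms(1)])
  obtain s d where 2: "s > 0" "\<forall>t. \<bar>t\<bar> < s \<longrightarrow> (\<lambda>n. d n * t ^ n) sums h (a + t *\<^sub>R v)"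
    by (rule line_analyticE[OF assms(2)])
  show "\<exists>r>0. \<exists>c. \<forall>t. \<bar>t\<bar> < r \<longrightarrow> (\<lambda>n. c n * t ^ n) sums (g (a + t *\<^sub>R v) + h (a + t *\<^sub>R v))"
  proof (intro exI conjI allI impI)
    show "min r s > 0" using 1 2 by simp
    fix t assume "\<bar>t\<bar> < min r s"
    then have "(\<lambda>n. c n * t ^ n + d n * t ^ n) sums (g (a + t *\<^sub>R v) + h (a + t *\<^sub>R v))"
      using 1 2 by (intro sums_add) auto
    then show "(\<lambda>n. (c n + d n) * t ^ n) sums (g (a + t *\<^sub>R v) + h (a + t *\<^sub>R v))"
      by (simp add: algebra_simps)
  qed
qed

lemma line_analytic_mult:
  assumes "line_analytic g" "line_analytic h"
  shows "line_analytic (\<lambda>x. g x * h x)"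
  unfolding line_analytic_def
proof (intro allI)
  fix a v
  obtain r c where 1: "r > 0" "\<forall>t. \<bar>t\<bar> < r \<longrightarrow> (\<lambda>n. c n * t ^ n) sums g (a + t *\<^sub>R v)"
    by (rule line_analyticE[OF assms(1)])
  obtain s d where 2: "s > 0" "\<forall>t. \<bar>t\<bar> < s \<longrightarrow> (\<lambda>n. d n * t ^ n) sums h (a + t *\<^sub>R v)"
    by (rule line_analyticE[OF assms(2)])
  show "\<exists>r>0. \<exists>c. \<forall>t. \<bar>t\<bar> < r \<longrightarrow> (\<lambda>n. c n * t ^ n) sums (g (a + t *\<^sub>R v) * h (a + t *\<^sub>R v))"
  proof (intro exI conjI allI impI)
    show "min r s > 0" using 1 2 by simp
    fix t assume "\<bar>t\<bar> < min r s"
    \<comment> \<open>Convergence at a point strictly beyond \<open>t\<close> gives absolute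
      convergence at \<open>t\<close>, which the Cauchy product requires.\<close>
    then obtain u where u: "\<bar>t\<bar> < u" "u < min r s" using dense by blast
    then have "\<bar>u\<bar> < r" "\<bar>u\<bar> < s" "\<bar>t\<bar> < r" "\<bar>t\<bar> < s" by auto
    then have gs: "(\<lambda>n. c n * t ^ n) sums g (a + t *\<^sub>R v)" and hs: "(\<lambda>n. d n * t ^ n) sums h (a + t *\<^sub>R v)"
      and "summable (\<lambda>n. c n * u ^ n)" "summable (\<lambda>n. d n * u ^ n)"
      using 1 2 by (auto intro: sums_summable)
    then have "summable (\<lambda>n. norm (c n * t ^ n))" "summable (\<lambda>n. norm (d n * t ^ n))"
      using u by (auto intro!: powser_insidea[where x=u] simp del: real_norm_def) (auto simp: real_norm_def)
    from Cauchy_product_sums[OF this]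
    have "(\<lambda>k. \<Sum>i\<le>k. (c i * t ^ i) * (d (k - i) * t ^ (k - i))) sums (g (a + t *\<^sub>R v) * h (a + t *\<^sub>R v))"
      using gs hs by (simp only: sums_unique[symmetric])
    moreover have "(\<Sum>i\<le>k. (c i * t ^ i) * (d (k - i) * t ^ (k - i))) = (\<Sum>i\<le>k. c i * d (k - i)) * t ^ k" for k
      unfolding sum_distrib_right
    proof (rule sum.cong)
      fix i assume "i \<in> {..k}"
      then have "t ^ k = t ^ i * t ^ (k - i)" by (simp flip: power_add)
      then show "(c i * t ^ i) * (d (k - i) * t ^ (k - i)) = c i * d (k - i) * t ^ k" by simp
    qed simp
    ultimately show "(\<lambda>k. (\<Sum>i\<le>k. c i * d (k - i)) * t ^ k) sums (g (a + t *\<^sub>R v) * h (a + t *\<^sub>R v))"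
      by simp
  qed
qed

lemma line_analytic_diff:
  "line_analytic g \<Longrightarrow> line_analytic h \<Longrightarrow> line_analytic (\<lambda>x. g x - h x)"
  using line_analytic_add[OF _ line_analytic_mult[OF line_analytic_const[of "-1"]], of g h] by simp

lemma line_analytic_sum:
  "(\<And>i. i \<in> I \<Longrightarrow> line_analytic (f i)) \<Longrightarrow> line_analytic (\<lambda>x. \<Sum>i\<in>I. f i x)"
  by (induction I rule: infinite_finite_induct) (auto intro: line_analytic_add line_analytic_const)

lemma finite_multi_index_degree: "finite {\<alpha> :: 'n::finite \<Rightarrow> nat. sum \<alpha> UNIV = k}"
proof (rule finite_subset)
  show "{\<alpha> :: 'n \<Rightarrow> nat. sum \<alpha> UNIV = k} \<subseteq> PiE UNIV (\<lambda>_. {..k})"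
    by (auto intro: member_le_sum)
qed (auto intro: finite_PiE)

text \<open>The absolutely convergent series is regrouped by total degree: along a line, monomials
  of degree k contribute multiples of t^k, and there are finitely many of each degree.\<close>

lemma real_analytic_line_analytic:
  fixes f :: "real^'n \<Rightarrow> real^'k"
  assumes "real_analytic f"
  shows "line_analytic (\<lambda>x. f x $ i)"
  unfolding line_analytic_def
proof (intro allI)
  fix a v :: "real^'n"
  obtain r c where r: "r > 0"
    and f: "\<forall>x\<in>ball a r. ((\<lambda>\<alpha>. mpow \<alpha> (x - a) *\<^sub>R c \<alpha>) has_sum f x) UNIV"
    using assms[unfolded real_analytic_iff_mpow, rule_format] by blast
  define A where "A k = {\<alpha> :: 'n \<Rightarrow> nat. sum \<alpha> UNIV = k}" for k
  \<comment> \<open>The summand 1 covers the constant line \<open>v = 0\<close>.\<close>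
  define s where "s = r / (norm v + 1)"
  have s: "s > 0" using r by (simp add: s_def add_nonneg_pos)
  show "\<exists>r>0. \<exists>c. \<forall>t. \<bar>t\<bar> < r \<longrightarrow> (\<lambda>n. c n * t ^ n) sums (f (a + t *\<^sub>R v) $ i)"
  proof (intro exI conjI allI impI)
    fix t assume t: "\<bar>t\<bar> < s"
    have "\<bar>t\<bar> * norm v \<le> \<bar>t\<bar> * (norm v + 1)"
      by (intro mult_left_mono) auto
    also have "\<dots> < r" using t by (simp add: s_def pos_less_divide_eq add_nonneg_pos)
    finally have "a + t *\<^sub>R v \<in> ball a r" by (simp add: dist_norm)
    from has_sum_bounded_linear[OF bounded_linear_vec_nth bspec[OF f this]]
    have "((\<lambda>\<alpha>. mpow \<alpha> (t *\<^sub>R v) * c \<alpha> $ i) has_sum f (a + t *\<^sub>R v) $ i) UNIV"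
      by simp
    moreover have "mpow \<alpha> (t *\<^sub>R v) = t ^ sum \<alpha> UNIV * mpow \<alpha> v" for \<alpha>
      by (simp add: mpow_def power_mult_distrib prod.distrib power_sum)
    ultimately have "((\<lambda>\<alpha>. t ^ sum \<alpha> UNIV * mpow \<alpha> v * c \<alpha> $ i) has_sum f (a + t *\<^sub>R v) $ i) UNIV"
      by simp
    then have "((\<lambda>(k, \<alpha>). t ^ k * mpow \<alpha> v * c \<alpha> $ i) has_sum f (a + t *\<^sub>R v) $ i) (Sigma UNIV A)"
      by (subst has_sum_reindex_bij_witness[where T=UNIV and j=snd and i="\<lambda>\<alpha>. (sum \<alpha> UNIV, \<alpha>)"
            and h="\<lambda>\<alpha>. t ^ sum \<alpha> UNIV * mpow \<alpha> v * c \<alpha> $ i"]) (auto simp: A_def)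
    then have "((\<lambda>k. \<Sum>\<alpha>\<in>A k. t ^ k * mpow \<alpha> v * c \<alpha> $ i) has_sum f (a + t *\<^sub>R v) $ i) UNIV"
      by (rule has_sum_SigmaD) (simp add: has_sum_finite A_def finite_multi_index_degree)
    then have "(\<lambda>k. \<Sum>\<alpha>\<in>A k. t ^ k * mpow \<alpha> v * c \<alpha> $ i) sums (f (a + t *\<^sub>R v) $ i)"
      by (rule has_sum_imp_sums)
    then show "(\<lambda>k. (\<Sum>\<alpha>\<in>A k. mpow \<alpha> v * c \<alpha> $ i) * t ^ k) sums (f (a + t *\<^sub>R v) $ i)"
      by (simp add: sum_distrib_right mult.assoc mult.commute[of "t ^ _"])
  qed (rule s)
qed

text \<open>The identity theorem on a line: the set \<open>Z\<close> of points near which the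
  restriction vanishes identically is open and closed, and it misses 0 because
  \<open>h p \<noteq> 0\<close>. Hence \<open>Z\<close> is empty, all zeros are isolated, and there
  are only countably many.\<close>

lemma line_analytic_countable_zeros:
  fixes h :: "'a::real_normed_vector \<Rightarrow> real"
  assumes h: "line_analytic h" and cont: "continuous_on UNIV h" and "h p \<noteq> 0"
  shows "countable {t. h (p + t *\<^sub>R v) = 0}"
proof -
  define g where "g t = h (p + t *\<^sub>R v)" for t
  define Z where "Z = {t. \<exists>e>0. \<forall>s. \<bar>s - t\<bar> < e \<longrightarrow> g s = 0}"
  have contg: "continuous_on UNIV g"
    unfolding g_def[abs_def] by (intro continuous_on_compose2[OF cont] continuous_intros) auto
  have dich: "t \<in> Z \<or> (\<exists>e>0. \<forall>s. \<bar>s - t\<bar> < e \<and> s \<noteq> t \<longrightarrow> g s \<noteq> 0)" for t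
  proof (cases "g t = 0")
    case False
    have "\<forall>\<^sub>F s in at t. g s \<noteq> 0"
      using contg False by (intro tendsto_imp_eventually_ne) (auto simp: continuous_on_def)
    then show ?thesis by (auto simp: eventually_at dist_norm)
  next
    case True
    obtain r c where r: "r > 0" and c: "\<forall>s. \<bar>s\<bar> < r \<longrightarrow> (\<lambda>n. c n * s ^ n) sums h (p + t *\<^sub>R v + s *\<^sub>R v)"
      by (rule line_analyticE[OF h])
    have gs: "(\<lambda>n. c n * (s - t) ^ n) sums g s" if "norm (s - t) < r" for s
      using c[rule_format, of "s - t"] that by (simp add: g_def algebra_simps)
    have "(\<lambda>n. c n * 0 ^ n) sums g t" using gs[of t] r by simp
    then have c0: "c 0 = 0"
      using True powser_sums_zero_iff[of c "g t"] by simp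
    show ?thesis
    proof (cases "\<exists>m>0. c m \<noteq> 0")
      case True
      then obtain m where m: "c m \<noteq> 0" "m > 0" by blast
      obtain e where "e > 0" "\<And>s. s \<in> cball t e - {t} \<Longrightarrow> g s \<noteq> 0"
        by (rule powser_0_nonzero[where f=g and a=c and \<xi>=t, OF r _ \<open>g t = 0\<close> m]) (erule gs, rule that, assumption, blast)
      then show ?thesis by (intro disjI2 exI[of _ e]) (auto simp: dist_norm)
    next
      case False
      then have "c n = 0" for n using c0 by (cases n) auto
      then have "g s = 0" if "\<bar>s - t\<bar> < r" for s
        using gs[of s] that sums_unique2[OF sums_zero] by fastforce
      then show ?thesis using r by (auto simp: Z_def)
    qed
  qed
  have "open Z"
    unfolding open_dist
  proof
    fix t assume "t \<in> Z"
    then obtain e where e: "e > 0" "\<And>s. \<bar>s - t\<bar> < e \<Longrightarrow> g s = 0" by (auto simp: Z_def)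
    have "s \<in> Z" if "dist s t < e / 2" for s
    proof -
      have "g u = 0" if "\<bar>u - s\<bar> < e / 2" for u
        using \<open>dist s t < e / 2\<close> that by (intro e(2)) (simp add: dist_real_def abs_if split: if_splits)
      then show ?thesis unfolding Z_def using e(1) half_gt_zero by blast
    qed
    then show "\<exists>e>0. \<forall>y. dist y t < e \<longrightarrow> y \<in> Z" using e(1) half_gt_zero by blast
  qed
  moreover have "open (- Z)"
    unfolding open_dist
  proof
    fix t assume "t \<in> - Z"
    then obtain e where e: "e > 0" "\<And>s. \<bar>s - t\<bar> < e \<Longrightarrow> s \<noteq> t \<Longrightarrow> g s \<noteq> 0" using dich[of t] by auto
    have "s \<in> - Z" if "dist s t < e" for s
    proof
      assume "s \<in> Z"
      then have "s \<noteq> t" using \<open>t \<in> - Z\<close> by auto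
      then have "g s \<noteq> 0" using e(2)[of s] that by (simp add: dist_norm)
      then show False using \<open>s \<in> Z\<close> by (auto simp: Z_def)
    qed
    then show "\<exists>e>0. \<forall>y. dist y t < e \<longrightarrow> y \<in> - Z" using e(1) by blast
  qed
  moreover have "0 \<notin> Z"
  proof
    assume "0 \<in> Z"
    then have "g 0 = 0" by (auto simp: Z_def)
    then show False using assms(3) by (simp add: g_def)
  qed
  ultimately have "Z = {}"
    using connectedD[OF connected_UNIV, of Z "- Z"] by auto
  then have iso: "\<exists>e>0. \<forall>s. \<bar>s - t\<bar> < e \<and> s \<noteq> t \<longrightarrow> g s \<noteq> 0" for t
    using dich by blast
  have "\<not> t islimpt {t. g t = 0}" for t
    using iso[of t] by (auto simp: islimpt_approachable dist_norm)
  then have "countable (UNIV \<inter> {t. g t = 0})"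
    by (intro sparse_imp_countable) (auto simp: sparse_in_def)
  then show ?thesis by (simp add: g_def)
qed

text \<open>Fubini over points \<open>x\<close> and dilation factors \<open>c\<close> about
  \<open>p\<close>, in place of polar coordinates. For each \<open>x\<close> the bad
  \<open>c\<close> are countable, so some fixed \<open>c \<noteq> 0\<close> is good for almost every
  \<open>x\<close>; the dilation by this \<open>c\<close> preserves null sets.\<close>

lemma line_analytic_null_zeros:
  fixes h :: "'a::euclidean_space \<Rightarrow> real"
  assumes h: "line_analytic h" and cont: "continuous_on UNIV h" and p: "h p \<noteq> 0"
  shows "{x. h x = 0} \<in> null_sets lebesgue"
proof -
  have [measurable]: "h \<in> borel_measurable borel"
    using cont by (rule borel_measurable_continuous_onI)
  define P where "P x c \<longleftrightarrow> h (p + c *\<^sub>R (x - p)) \<noteq> 0" for x and c :: real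
  have "AE c in lborel. P x c" for x
    unfolding P_def
    by (rule AE_I'[OF countable_imp_null_set_lborel[OF line_analytic_countable_zeros[OF h cont p, of "x - p"]]])
      auto
  then have "AE x in lborel. AE c in lborel. P x c" by simp
  moreover have "{z \<in> space (lborel \<Otimes>\<^sub>M lborel). P (fst z) (snd z)} \<in> sets (lborel \<Otimes>\<^sub>M lborel)"
    unfolding P_def by measurable
  ultimately have "AE c in lborel. AE x in lborel. P x c"
    by (simp only: lborel_pair.AE_commute)
  moreover have "AE c in lborel. c \<noteq> (0::real)"
    by (rule AE_lborel_singleton)
  ultimately have ev: "AE c in lborel. c \<noteq> (0::real) \<and> (AE x in lborel. P x c)"
    by eventually_elim simp
  obtain c where c: "c \<noteq> 0" "AE x in lborel. P x c"
    using eventually_happens[OF ev]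
    by (auto simp: ae_filter_eq_bot_iff)
  have "AE x in lborel. h ((p - c *\<^sub>R p) + c *\<^sub>R x) \<noteq> 0"
    using c(2) by (simp add: P_def algebra_simps)
  then have "AE y in lborel. h y \<noteq> 0"
    by (subst lborel_affine[OF c(1), of "p - c *\<^sub>R p"]) (simp add: AE_density AE_distr_iff)
  then have "{y. h y = 0} \<in> null_sets lborel"
    by (subst AE_iff_null_sets) auto
  then show ?thesis by (rule null_sets_completionI)
qed

subsection \<open>Flows of small time-dependent vector fields\<close>

lemma derivative_bound_unit_interval:
  fixes y :: "real \<Rightarrow> 'a::real_normed_vector"
  assumes y: "\<And>s. s \<in> {0..1} \<Longrightarrow> (y has_vector_derivative y' s) (at s within {0..1})"
    and B: "\<And>s. s \<in> {0..1} \<Longrightarrow> norm (y' s) \<le> B" and s: "s \<in> {0..1}"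
  shows "norm (y s - y 0) \<le> B"
proof -
  have "0 \<le> B" by (rule order_trans[OF norm_ge_zero B[of 0]]) simp
  have "norm (y s - y 0) \<le> B * norm (s - 0)"
  proof (rule differentiable_bound[of "{0..1}" y "\<lambda>s h. h *\<^sub>R y' s"])
    show "(y has_derivative (\<lambda>h. h *\<^sub>R y' t)) (at t within {0..1})" if "t \<in> {0..1}" for t
      using y[OF that] by (simp add: has_vector_derivative_def)
    show "onorm (\<lambda>h. h *\<^sub>R y' t) \<le> B" if "t \<in> {0..1}" for t
    proof (rule onorm_le)
      show "norm (h *\<^sub>R y' t) \<le> B * norm h" for h
        using mult_right_mono[OF B[OF that], of "norm h"] by (simp add: mult.commute)
    qed
  qed (use s in auto)
  also have "\<dots> \<le> B * 1"
    using s \<open>0 \<le> B\<close> by (intro mult_left_mono) auto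
  finally show ?thesis by simp
qed

text \<open>Since the coefficient is at most 1/2 on a unit interval, this replaces Gronwall's inequality.\<close>

lemma small_growth_bound:
  fixes y :: "real \<Rightarrow> 'a::real_normed_vector"
  assumes y: "\<And>s. s \<in> {0..1} \<Longrightarrow> (y has_vector_derivative y' s) (at s within {0..1})"
    and bd: "\<And>s. s \<in> {0..1} \<Longrightarrow> norm (y' s) \<le> c + \<epsilon> * norm (y s)"
    and \<epsilon>: "0 \<le> \<epsilon>" "\<epsilon> \<le> 1/2" and s: "s \<in> {0..1}"
  shows "norm (y s) \<le> 2 * (norm (y 0) + c)"
proof -
  have "continuous_on {0..1} (\<lambda>s. norm (y s))"
    by (rule continuous_on_norm[OF continuous_on_vector_derivative[OF y]])
  then obtain m where m: "m \<in> {0..1}" "\<And>s. s \<in> {0..1} \<Longrightarrow> norm (y s) \<le> norm (y m)"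
    using continuous_attains_sup[of "{0..1::real}" "\<lambda>s. norm (y s)"] by auto
  have "norm (y' t) \<le> c + \<epsilon> * norm (y m)" if "t \<in> {0..1}" for t
    using bd[OF that] mult_left_mono[OF m(2)[OF that] \<epsilon>(1)] by linarith
  then have "norm (y m - y 0) \<le> c + \<epsilon> * norm (y m)"
    using m(1) by (intro derivative_bound_unit_interval[OF y])
  moreover have "\<epsilon> * norm (y m) \<le> 1/2 * norm (y m)"
    using \<epsilon> by (intro mult_right_mono) auto
  moreover have "norm (y m) \<le> norm (y 0) + norm (y m - y 0)"
    using norm_triangle_ineq[of "y 0" "y m - y 0"] by simp
  ultimately have "norm (y m) \<le> 2 * (norm (y 0) + c)" by (simp add: field_simps)
  then show ?thesis using m(2)[OF s] by linarith
qed

text \<open>Picard iteration: on the unit interval a Lipschitz constant 1/2 already makes the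
  integral operator a contraction in the supremum norm.\<close>

lemma ode_solution_exists:
  fixes G :: "real \<Rightarrow> 'a::euclidean_space \<Rightarrow> 'a"
  assumes cont: "continuous_on ({0..1} \<times> UNIV) (\<lambda>(s, x). G s x)"
    and lip: "\<And>s x y. s \<in> {0..1} \<Longrightarrow> norm (G s x - G s y) \<le> 1/2 * norm (x - y)"
  shows "\<exists>y. y 0 = p \<and> (\<forall>s\<in>{0..1}. (y has_vector_derivative G s (y s)) (at s within {0..1}))"
proof -
  \<comment> \<open>The Banach space consists of bounded continuous functions on the whole line;
    clamping time to the unit interval lets the operator act on it.\<close>
  define cl :: "real \<Rightarrow> real" where "cl s = max 0 (min 1 s)" for s
  have cl: "cl s \<in> {0..1}" "s \<in> {0..1} \<Longrightarrow> cl s = s" for s by (auto simp: cl_def)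
  have contcl: "continuous_on UNIV cl" unfolding cl_def[abs_def] by (intro continuous_intros)
  define T where "T \<phi> s = p + integral {0..cl s} (\<lambda>\<sigma>. G \<sigma> (\<phi> \<sigma>))" for \<phi> s
  have contG: "continuous_on {0..1} (\<lambda>\<sigma>. G \<sigma> (\<phi> \<sigma>))" if "continuous_on {0..1} \<phi>" for \<phi>
  proof -
    have "continuous_on {0..1} (\<lambda>\<sigma>. case (\<sigma>, \<phi> \<sigma>) of (s, x) \<Rightarrow> G s x)"
      by (rule continuous_on_compose2[OF cont]) (auto intro!: continuous_intros that)
    then show ?thesis by simp
  qed
  have T_bcont: "T \<phi> \<in> bcontfun" if "continuous_on {0..1} \<phi>" for \<phi>
  proof -
    have c: "continuous_on {0..1} (\<lambda>s. p + integral {0..s} (\<lambda>\<sigma>. G \<sigma> (\<phi> \<sigma>)))"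
      by (intro continuous_intros indefinite_integral_continuous_1 integrable_continuous_real contG that)
    have "continuous_on UNIV (T \<phi>)"
      unfolding T_def[abs_def]
      by (rule continuous_on_compose2[OF c contcl]) (use cl(1) in blast)
    moreover have "range (T \<phi>) \<subseteq> (\<lambda>s. p + integral {0..s} (\<lambda>\<sigma>. G \<sigma> (\<phi> \<sigma>))) ` {0..1}"
      using cl(1) unfolding T_def by (intro image_subsetI imageI)
    then have "bounded (range (T \<phi>))"
      using compact_imp_bounded[OF compact_continuous_image[OF c compact_Icc]] bounded_subset by blast
    ultimately show ?thesis by (simp add: bcontfun_def)
  qed
  have ct: "continuous_on {0..1} (apply_bcontfun \<phi>)" for \<phi> :: "real \<Rightarrow>\<^sub>C 'a"
    by (rule continuous_on_apply_bcontfun)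
  have T_app: "apply_bcontfun (Bcontfun (T (apply_bcontfun \<phi>))) = T (apply_bcontfun \<phi>)" for \<phi>
    by (rule Bcontfun_inverse[OF T_bcont[OF ct]])
  have "dist (Bcontfun (T (apply_bcontfun \<phi>))) (Bcontfun (T (apply_bcontfun \<psi>))) \<le> 1/2 * dist \<phi> \<psi>" for \<phi> \<psi>
  proof (rule dist_bound)
    fix s
    have "norm (integral {0..cl s} (\<lambda>\<sigma>. G \<sigma> (\<phi> \<sigma>) - G \<sigma> (\<psi> \<sigma>))) \<le> (1/2 * dist \<phi> \<psi>) * (cl s - 0)"
    proof (rule integral_bound)
      show "0 \<le> cl s" using cl(1) by auto
      show "continuous_on {0..cl s} (\<lambda>\<sigma>. G \<sigma> (\<phi> \<sigma>) - G \<sigma> (\<psi> \<sigma>))"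
        using cl(1)[of s] by (intro continuous_on_diff continuous_on_subset[OF contG[OF ct]]) auto
      fix \<sigma> assume "\<sigma> \<in> {0..cl s}"
      then have "\<sigma> \<in> {0..1}" using cl(1)[of s] by auto
      from lip[OF this, of "\<phi> \<sigma>" "\<psi> \<sigma>"] show "norm (G \<sigma> (\<phi> \<sigma>) - G \<sigma> (\<psi> \<sigma>)) \<le> 1/2 * dist \<phi> \<psi>"
        using dist_bounded[of \<phi> \<sigma> \<psi>] unfolding dist_norm by simp
    qed
    also have "\<dots> \<le> (1/2 * dist \<phi> \<psi>) * 1"
      using cl(1)[of s] by (intro mult_left_mono) auto
    moreover have "integral {0..cl s} (\<lambda>\<sigma>. G \<sigma> (\<phi> \<sigma>) - G \<sigma> (\<psi> \<sigma>)) = T \<phi> s - T \<psi> s"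
      unfolding T_def using cl(1)[of s]
      by (subst integral_diff) (auto intro!: integrable_continuous_real continuous_on_subset[OF contG[OF ct]])
    ultimately show "dist (Bcontfun (T \<phi>) s) (Bcontfun (T \<psi>) s) \<le> 1/2 * dist \<phi> \<psi>"
      unfolding T_app by (simp add: dist_norm)
  qed
  then have "\<exists>!\<phi>. Bcontfun (T (apply_bcontfun \<phi>)) = \<phi>"
    by (intro banach_fix_type[of "1/2"]) auto
  then obtain \<phi> where "Bcontfun (T (apply_bcontfun \<phi>)) = \<phi>" by blast
  then have \<phi>: "apply_bcontfun \<phi> = T (apply_bcontfun \<phi>)" using T_app by metis
  show ?thesis
  proof (intro exI conjI ballI)
    show "apply_bcontfun \<phi> 0 = p" by (subst \<phi>) (simp add: T_def cl_def)
    fix s :: real assume s: "s \<in> {0..1}"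
    have "((\<lambda>s. p + integral {0..s} (\<lambda>\<sigma>. G \<sigma> (\<phi> \<sigma>))) has_vector_derivative 0 + G s (\<phi> s)) (at s within {0..1})"
      by (intro has_vector_derivative_add has_vector_derivative_const integral_has_vector_derivative contG ct s)
    then show "(apply_bcontfun \<phi> has_vector_derivative G s (\<phi> s)) (at s within {0..1})"
    proof (rule has_vector_derivative_transform[OF s, rotated, THEN has_vector_derivative_eq_rhs])
      show "\<phi> t = p + integral {0..t} (\<lambda>\<sigma>. G \<sigma> (\<phi> \<sigma>))" if "t \<in> {0..1}" for t
        by (subst \<phi>) (simp only: T_def cl(2)[OF that])
    qed simp
  qed
qed

text \<open>\<open>V\<close> solves the equation of variations along \<open>\<phi> p\<close>; a
  quadratic remainder identifies it as the derivative of the time-one map. The last clause is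
  uniqueness in the form used later: a known integral curve shows where the flow takes its initial
  point.\<close>

lemma flow_exists:
  fixes G :: "real \<Rightarrow> 'a::euclidean_space \<Rightarrow> 'a"
  assumes cont: "continuous_on ({0..1} \<times> UNIV) (\<lambda>(s, x). G s x)"
    and contD: "continuous_on ({0..1} \<times> UNIV) (\<lambda>(s, z). DG s (fst z) (snd z))"
    and deriv: "\<And>s x. s \<in> {0..1} \<Longrightarrow> (G s has_derivative DG s x) (at x)"
    and bd: "\<And>s x. s \<in> {0..1} \<Longrightarrow> norm (G s x) \<le> \<epsilon>"
    and bdD: "\<And>s x v. s \<in> {0..1} \<Longrightarrow> norm (DG s x v) \<le> \<epsilon> * norm v"
    and lipD: "\<And>s x y v. s \<in> {0..1} \<Longrightarrow> norm (DG s x v - DG s y v) \<le> M * norm (x - y) * norm v"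
    and \<epsilon>: "0 \<le> \<epsilon>" "\<epsilon> \<le> 1/2" and "M \<ge> 0"
  shows "\<exists>\<phi> V. (\<forall>p. \<phi> p 0 = p) \<and>
    (\<forall>p. \<forall>s\<in>{0..1}. (\<phi> p has_vector_derivative G s (\<phi> p s)) (at s within {0..1})) \<and>
    (\<forall>p v. V p v 0 = v) \<and>
    (\<forall>p v. \<forall>s\<in>{0..1}. (V p v has_vector_derivative DG s (\<phi> p s) (V p v s)) (at s within {0..1})) \<and>
    (\<forall>p. ((\<lambda>p. \<phi> p 1) has_derivative (\<lambda>v. V p v 1)) (at p)) \<and>
    (\<forall>p. norm (\<phi> p 1 - p) \<le> \<epsilon>) \<and>
    (\<forall>p v. norm (V p v 1 - v) \<le> 2 * \<epsilon> * norm v) \<and>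
    (\<forall>\<gamma>. (\<forall>s\<in>{0..1}. (\<gamma> has_vector_derivative G s (\<gamma> s)) (at s within {0..1})) \<longrightarrow> \<gamma> 1 = \<phi> (\<gamma> 0) 1)"
proof -
  have linD: "bounded_linear (DG s x)" if "s \<in> {0..1}" for s x
    using deriv[OF that] by (rule has_derivative_bounded_linear)
  have lip: "norm (G s x - G s y) \<le> \<epsilon> * norm (x - y)" if s: "s \<in> {0..1}" for s x y
    by (rule differentiable_bound[of UNIV "G s" "DG s"]) (use s in \<open>auto intro!: deriv onorm_le bdD\<close>)
  have lip2: "norm (G s x - G s y) \<le> 1/2 * norm (x - y)" if s: "s \<in> {0..1}" for s x y
    using lip[OF s, of x y] mult_right_mono[OF \<epsilon>(2), of "norm (x - y)"] by simp
  have taylor: "norm (G s y - G s x - DG s x (y - x)) \<le> M * (norm (y - x))\<^sup>2" if s: "s \<in> {0..1}" for s x y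
  proof -
    have "norm (G s y - G s x - DG s x (y - x)) \<le> norm (y - x) * (M * norm (y - x))"
    proof (rule differentiable_bound_linearization[where S="closed_segment x y" and f'="DG s"])
      show "x + t *\<^sub>R (y - x) \<in> closed_segment x y" if "t \<in> {0..1}" for t
        using that by (auto simp: closed_segment_def algebra_simps intro!: exI[of _ t])
      show "(G s has_derivative DG s z) (at z within closed_segment x y)" for z
        using deriv[OF s] by (rule has_derivative_at_withinI)
      show "onorm (DG s z - DG s x) \<le> M * norm (y - x)" if "z \<in> closed_segment x y" for z
      proof (rule onorm_le)
        fix v :: 'a
        have "norm (z - x) \<le> norm (y - x)"
          using segment_bound(1)[OF that] by (simp add: norm_minus_commute)
        then have "M * norm (z - x) * norm v \<le> M * norm (y - x) * norm v"
          using \<open>M \<ge> 0\<close> by (intro mult_right_mono mult_left_mono) auto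
        then show "norm ((DG s z - DG s x) v) \<le> M * norm (y - x) * norm v"
          using lipD[OF s, of z v x] by simp
      qed
    qed auto
    then show ?thesis by (simp add: power2_eq_square mult_ac)
  qed
  have "\<exists>y. y 0 = p \<and> (\<forall>s\<in>{0..1}. (y has_vector_derivative G s (y s)) (at s within {0..1}))" for p
    by (rule ode_solution_exists[OF cont lip2])
  note ex\<phi> = someI_ex[OF this]
  define \<phi> where "\<phi> p = (SOME y. y 0 = p \<and>
      (\<forall>s\<in>{0..1}. (y has_vector_derivative G s (y s)) (at s within {0..1})))" for p
  have \<phi>0: "\<phi> p 0 = p" for p
    using ex\<phi>[of p] unfolding \<phi>_def by (rule conjunct1)
  have \<phi>: "(\<phi> p has_vector_derivative G s (\<phi> p s)) (at s within {0..1})" if "s \<in> {0..1}" for p s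
    using ex\<phi>[of p] that unfolding \<phi>_def by (elim conjE bspec)
  have cont\<phi>: "continuous_on {0..1} (\<phi> p)" for p
    by (rule continuous_on_vector_derivative[OF \<phi>])
  have "\<exists>y. y 0 = v \<and> (\<forall>s\<in>{0..1}. (y has_vector_derivative DG s (\<phi> p s) (y s)) (at s within {0..1}))" for p v
  proof (rule ode_solution_exists)
    have "continuous_on ({0..1} \<times> UNIV) (\<lambda>q. case (fst q, (\<phi> p (fst q), snd q)) of (s, z) \<Rightarrow> DG s (fst z) (snd z))"
      by (rule continuous_on_compose2[OF contD])
        (auto intro!: continuous_intros continuous_on_compose2[OF cont\<phi>])
    then show "continuous_on ({0..1} \<times> UNIV) (\<lambda>(s, v). DG s (\<phi> p s) v)"
      by (simp add: case_prod_beta')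
    fix s :: real and x y :: 'a assume s: "s \<in> {0..1}"
    interpret bounded_linear "DG s (\<phi> p s)" by (rule linD[OF s])
    show "norm (DG s (\<phi> p s) x - DG s (\<phi> p s) y) \<le> 1/2 * norm (x - y)"
      using bdD[OF s, of "\<phi> p s" "x - y"] mult_right_mono[OF \<epsilon>(2), of "norm (x - y)"] by (simp add: diff)
  qed
  note exV = someI_ex[OF this]
  define V where "V p v = (SOME y. y 0 = v \<and>
      (\<forall>s\<in>{0..1}. (y has_vector_derivative DG s (\<phi> p s) (y s)) (at s within {0..1})))" for p v
  have V0: "V p v 0 = v" for p v
    using exV[of v p] unfolding V_def by (rule conjunct1)
  have V: "(V p v has_vector_derivative DG s (\<phi> p s) (V p v s)) (at s within {0..1})"
    if "s \<in> {0..1}" for p v s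
    using exV[of v p] that unfolding V_def by (elim conjE bspec)
  have uniq: "norm (y s - z s) \<le> 2 * norm (y 0 - z 0)"
    if "\<And>s. s \<in> {0..1} \<Longrightarrow> (y has_vector_derivative G s (y s)) (at s within {0..1})"
      "\<And>s. s \<in> {0..1} \<Longrightarrow> (z has_vector_derivative G s (z s)) (at s within {0..1})" "s \<in> {0..1}" for y z s
  proof -
    have "norm (y s - z s) \<le> 2 * (norm (y 0 - z 0) + 0)"
      by (rule small_growth_bound[OF has_vector_derivative_diff[OF that(1,2)] _ \<epsilon> that(3)])
        (simp_all add: lip)
    then show ?thesis by simp
  qed
  have Vbd: "norm (V p v s) \<le> 2 * norm v" if "s \<in> {0..1}" for p v s
  proof -
    have "norm (V p v s) \<le> 2 * (norm (V p v 0) + 0)"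
      by (rule small_growth_bound[OF V _ \<epsilon> that]) (simp_all add: bdD)
    then show ?thesis by (simp add: V0)
  qed
  have Vuniq: "y 1 = V p (y 0) 1"
    if y: "\<And>s. s \<in> {0..1} \<Longrightarrow> (y has_vector_derivative DG s (\<phi> p s) (y s)) (at s within {0..1})" for y p
  proof -
    have "norm (y 1 - V p (y 0) 1) \<le> 2 * (norm (y 0 - V p (y 0) 0) + 0)"
    proof (rule small_growth_bound[OF has_vector_derivative_diff[OF y V] _ \<epsilon>])
      fix s :: real assume s: "s \<in> {0..1}"
      interpret bounded_linear "DG s (\<phi> p s)" by (rule linD[OF s])
      show "norm (DG s (\<phi> p s) (y s) - DG s (\<phi> p s) (V p (y 0) s)) \<le> 0 + \<epsilon> * norm (y s - V p (y 0) s)"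
        using bdD[OF s, of "\<phi> p s" "y s - V p (y 0) s"] by (simp add: diff)
    qed auto
    then show ?thesis by (simp add: V0)
  qed
  have Vlin: "bounded_linear (\<lambda>v. V p v 1)" for p
  proof (rule bounded_linear_intro[where K=2])
    fix v w :: 'a and c :: real
    show "V p (v + w) 1 = V p v 1 + V p w 1"
    proof -
      have "(\<lambda>s. V p v s + V p w s) 1 = V p ((\<lambda>s. V p v s + V p w s) 0) 1"
      proof (rule Vuniq)
        fix s :: real assume s: "s \<in> {0..1}"
        interpret bounded_linear "DG s (\<phi> p s)" by (rule linD[OF s])
        show "((\<lambda>s. V p v s + V p w s) has_vector_derivative DG s (\<phi> p s) (V p v s + V p w s)) (at s within {0..1})"
          unfolding add by (intro has_vector_derivative_add V s)
      qed
      then show ?thesis by (simp add: V0)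
    qed
    show "V p (c *\<^sub>R v) 1 = c *\<^sub>R V p v 1"
    proof -
      have "(\<lambda>s. c *\<^sub>R V p v s) 1 = V p ((\<lambda>s. c *\<^sub>R V p v s) 0) 1"
      proof (rule Vuniq)
        fix s :: real assume s: "s \<in> {0..1}"
        interpret bounded_linear "DG s (\<phi> p s)" by (rule linD[OF s])
        show "((\<lambda>s. c *\<^sub>R V p v s) has_vector_derivative DG s (\<phi> p s) (c *\<^sub>R V p v s)) (at s within {0..1})"
          unfolding scaleR
          by (rule bounded_linear.has_vector_derivative[OF bounded_linear_scaleR_right V[OF s]])
      qed
      then show ?thesis by (simp add: V0)
    qed
    show "norm (V p v 1) \<le> norm v * 2"
      using Vbd[of 1 p v] by simp
  qed
  \<comment> \<open>Trajectories separate by at most the factor 2, so the Taylor remainder is at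
    most 4 M |q - p|^2; \<open>small_growth_bound\<close> doubles this.\<close>
  have rem: "norm (\<phi> q 1 - \<phi> p 1 - V p (q - p) 1) \<le> 8 * M * (norm (q - p))\<^sup>2" for p q
  proof -
    have "norm (\<phi> q 1 - \<phi> p 1 - V p (q - p) 1) \<le>
        2 * (norm (\<phi> q 0 - \<phi> p 0 - V p (q - p) 0) + 4 * M * (norm (q - p))\<^sup>2)"
    proof (rule small_growth_bound[OF has_vector_derivative_diff[OF has_vector_derivative_diff[OF \<phi> \<phi>] V] _ \<epsilon>])
      fix s :: real assume s: "s \<in> {0..1}"
      interpret bounded_linear "DG s (\<phi> p s)" by (rule linD[OF s])
      let ?d = "\<phi> q s - \<phi> p s"
      have "norm ?d \<le> 2 * norm (q - p)"
        using uniq[OF \<phi> \<phi> s, of q p] by (simp add: \<phi>0)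
      then have "(norm ?d)\<^sup>2 \<le> (2 * norm (q - p))\<^sup>2"
        by (intro power_mono) auto
      then have "M * (norm ?d)\<^sup>2 \<le> M * (2 * norm (q - p))\<^sup>2"
        using \<open>M \<ge> 0\<close> by (rule mult_left_mono)
      then have 1: "norm (G s (\<phi> q s) - G s (\<phi> p s) - DG s (\<phi> p s) ?d) \<le> 4 * M * (norm (q - p))\<^sup>2"
        using taylor[OF s, of "\<phi> q s" "\<phi> p s"] by (simp add: power_mult_distrib)
      have 2: "norm (DG s (\<phi> p s) (?d - V p (q - p) s)) \<le> \<epsilon> * norm (?d - V p (q - p) s)"
        by (rule bdD[OF s])
      have eq: "G s (\<phi> q s) - G s (\<phi> p s) - DG s (\<phi> p s) (V p (q - p) s) =
          (G s (\<phi> q s) - G s (\<phi> p s) - DG s (\<phi> p s) ?d) + DG s (\<phi> p s) (?d - V p (q - p) s)"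
        by (simp add: diff)
      show "norm (G s (\<phi> q s) - G s (\<phi> p s) - DG s (\<phi> p s) (V p (q - p) s))
          \<le> 4 * M * (norm (q - p))\<^sup>2 + \<epsilon> * norm (?d - V p (q - p) s)"
        unfolding eq by (rule norm_triangle_mono[OF 1 2])
    qed auto
    then show ?thesis by (simp add: V0 \<phi>0)
  qed
  have der: "((\<lambda>p. \<phi> p 1) has_derivative (\<lambda>v. V p v 1)) (at p)" for p
  proof (rule has_derivativeI_sandwich[where e=1 and H="\<lambda>q. 8 * M * norm (q - p)"])
    show "norm (\<phi> q 1 - \<phi> p 1 - V p (q - p) 1) / norm (q - p) \<le> 8 * M * norm (q - p)" if "q \<noteq> p" for q
      using rem[of q p] that by (simp add: field_simps power2_eq_square)
    have "((\<lambda>q. 8 * M * norm (q - p)) \<longlongrightarrow> 8 * M * norm (p - p)) (at p)"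
      by (intro tendsto_intros)
    then show "((\<lambda>q. 8 * M * norm (q - p)) \<longlongrightarrow> 0) (at p)" by simp
  qed (auto intro: Vlin)
  have near: "norm (\<phi> p 1 - p) \<le> \<epsilon>" for p
  proof -
    have "norm (\<phi> p 1 - \<phi> p 0) \<le> \<epsilon>"
      by (rule derivative_bound_unit_interval[OF \<phi>]) (simp_all add: bd)
    then show ?thesis by (simp add: \<phi>0)
  qed
  have Vnear: "norm (V p v 1 - v) \<le> 2 * \<epsilon> * norm v" for p v
  proof -
    have "norm (DG s (\<phi> p s) (V p v s)) \<le> 2 * \<epsilon> * norm v" if s: "s \<in> {0..1}" for s
      using bdD[OF s, of "\<phi> p s" "V p v s"] mult_left_mono[OF Vbd[OF s] \<epsilon>(1), of p v] by simp
    then have "norm (V p v 1 - V p v 0) \<le> 2 * \<epsilon> * norm v"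
      by (intro derivative_bound_unit_interval[OF V]) simp_all
    then show ?thesis by (simp add: V0)
  qed
  have curve: "\<gamma> 1 = \<phi> (\<gamma> 0) 1"
    if "\<forall>s\<in>{0..1}. (\<gamma> has_vector_derivative G s (\<gamma> s)) (at s within {0..1})" for \<gamma>
    using uniq[of \<gamma> "\<phi> (\<gamma> 0)" 1] that \<phi> by (simp add: \<phi>0)
  show ?thesis
    using \<phi>0 \<phi> V0 V der near Vnear curve by (intro exI[of _ \<phi>] exI[of _ V]) blast
qed

section \<open>Uniform C^2 bounds for compactly supported maps\<close>

lemma compact_support_bounded:
  fixes g :: "'a::euclidean_space \<Rightarrow> 'b::real_normed_vector"
  assumes "continuous_on UNIV g" "\<forall>p. p \<notin> cball x0 r \<longrightarrow> g p = 0"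
  shows "\<exists>B>0. \<forall>p. norm (g p) \<le> B"
proof -
  have "bounded (g ` cball x0 r)"
    using assms(1) by (intro compact_imp_bounded compact_continuous_image) (auto intro: continuous_on_subset)
  then obtain B where "B > 0" "\<forall>y\<in>g ` cball x0 r. norm y \<le> B"
    unfolding bounded_pos by blast
  then show ?thesis
    using assms(2) by (intro exI[of _ B]) (metis image_eqI less_imp_le norm_zero)
qed

lemma compact_support_derivative:
  fixes g :: "'a::euclidean_space \<Rightarrow> 'b::real_normed_vector"
  assumes "\<forall>p. p \<notin> cball x0 r \<longrightarrow> g p = 0" "p \<notin> cball x0 r"
  shows "frechet_derivative g (at p) = (\<lambda>v. 0)"
proof -
  have "(g has_derivative (\<lambda>v. 0)) (at p)"
    by (rule has_derivative_transform_within_open[where f="\<lambda>x. 0" and s="- cball x0 r"])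
      (use assms in auto)
  then show ?thesis by (rule frechet_derivative_at[symmetric])
qed

lemma Ck_1_derivative_bounded_on_compact:
  fixes g :: "'a::euclidean_space \<Rightarrow> 'b::real_normed_vector"
  assumes g: "Ck (Suc 0) g" and S: "compact S"
  shows "\<exists>B>0. \<forall>p\<in>S. \<forall>v. norm (frechet_derivative g (at p) v) \<le> B * norm v"
proof -
  have "\<exists>B>0. \<forall>p\<in>S. norm (frechet_derivative g (at p) b) \<le> B" for b
  proof -
    have "continuous_on UNIV (\<lambda>p. frechet_derivative g (at p) b)" using g by simp
    then have "bounded ((\<lambda>p. frechet_derivative g (at p) b) ` S)"
      using S by (intro compact_imp_bounded compact_continuous_image) (auto intro: continuous_on_subset)
    then show ?thesis unfolding bounded_pos by auto
  qed
  then obtain B where B: "\<And>b. B b > 0" "\<And>b p. p \<in> S \<Longrightarrow> norm (frechet_derivative g (at p) b) \<le> B b"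
    by metis
  have "norm (frechet_derivative g (at p) v) \<le> (\<Sum>b\<in>Basis. B b) * norm v" if "p \<in> S" for p v
  proof -
    have "g differentiable at p" using g by simp
    then have "norm (frechet_derivative g (at p) v) = norm (\<Sum>b\<in>Basis. (v \<bullet> b) *\<^sub>R frechet_derivative g (at p) b)"
      by (subst frechet_derivative_euclidean) simp_all
    also have "\<dots> \<le> (\<Sum>b\<in>Basis. B b * norm v)"
    proof (rule sum_norm_le)
      fix b :: 'a assume b: "b \<in> Basis"
      have "\<bar>v \<bullet> b\<bar> * norm (frechet_derivative g (at p) b) \<le> norm v * B b"
        using B(2)[OF that] Basis_le_norm[OF b] by (intro mult_mono) auto
      then show "norm ((v \<bullet> b) *\<^sub>R frechet_derivative g (at p) b) \<le> B b * norm v"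
        by (simp add: mult.commute)
    qed
    finally show ?thesis by (simp add: sum_distrib_right)
  qed
  moreover have "(\<Sum>b\<in>Basis. B b) > 0"
    using B(1) by (intro sum_pos) auto
  ultimately show ?thesis by blast
qed

lemma compact_support_derivative_bounded:
  fixes g :: "'a::euclidean_space \<Rightarrow> 'b::real_normed_vector"
  assumes g: "Ck (Suc 0) g" and supp: "\<forall>p. p \<notin> cball x0 r \<longrightarrow> g p = 0"
  shows "\<exists>B>0. \<forall>p v. norm (frechet_derivative g (at p) v) \<le> B * norm v"
proof -
  obtain B where B: "B > 0"
    "\<And>p v. p \<in> cball x0 r \<Longrightarrow> norm (frechet_derivative g (at p) v) \<le> B * norm v"
    using Ck_1_derivative_bounded_on_compact[OF g compact_cball] by blast
  have "norm (frechet_derivative g (at p) v) \<le> B * norm v" for p v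
  proof (cases "p \<in> cball x0 r")
    case False
    then show ?thesis using compact_support_derivative[OF supp False] B(1) by simp
  qed (rule B(2))
  then show ?thesis using B(1) by blast
qed

lemma Ck_1_bounded_derivative_lipschitz:
  fixes g :: "'a::euclidean_space \<Rightarrow> 'b::real_normed_vector"
  assumes g: "Ck (Suc 0) g" and B: "\<And>p v. norm (frechet_derivative g (at p) v) \<le> B * norm v"
  shows "norm (g p - g q) \<le> B * norm (p - q)"
  by (rule differentiable_bound[of UNIV g "\<lambda>p. frechet_derivative g (at p)"])
    (use Ck_has_derivative[OF g] B in \<open>auto intro!: onorm_le\<close>)

lemma compact_support_second_derivative_bounded:
  fixes g :: "'a::euclidean_space \<Rightarrow> 'b::real_normed_vector"
  assumes g: "Ck (Suc (Suc 0)) g" and supp: "\<forall>p. p \<notin> cball x0 r \<longrightarrow> g p = 0"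
  shows "\<exists>B>0. \<forall>p q v. norm (frechet_derivative g (at p) v - frechet_derivative g (at q) v)
    \<le> B * norm (p - q) * norm v"
proof -
  let ?D = "\<lambda>b p. frechet_derivative g (at p) b"
  have C1: "Ck (Suc 0) (?D b)" for b using g by (metis Ck.simps(2))
  have "\<exists>B>0. \<forall>p v. norm (frechet_derivative (?D b) (at p) v) \<le> B * norm v" for b
    by (rule compact_support_derivative_bounded[of _ x0 r, OF C1])
      (simp add: compact_support_derivative[OF supp])
  then obtain B where B: "\<And>b. B b > 0" "\<And>b p v. norm (frechet_derivative (?D b) (at p) v) \<le> B b * norm v"
    by metis
  have "norm (?D v p - ?D v q) \<le> (\<Sum>b\<in>Basis. B b) * norm (p - q) * norm v" for p q v
  proof -
    have d: "g differentiable at x" for x using g by simp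
    have "?D v p - ?D v q = (\<Sum>b\<in>Basis. (v \<bullet> b) *\<^sub>R (?D b p - ?D b q))"
      unfolding frechet_derivative_euclidean[OF d, of _ v] by (simp add: sum_subtractf scaleR_diff_right)
    also have "norm \<dots> \<le> (\<Sum>b\<in>Basis. B b * norm (p - q) * norm v)"
    proof (rule sum_norm_le)
      fix b :: 'a assume b: "b \<in> Basis"
      have "\<bar>v \<bullet> b\<bar> * norm (?D b p - ?D b q) \<le> norm v * (B b * norm (p - q))"
        using Ck_1_bounded_derivative_lipschitz[OF C1 B(2)] Basis_le_norm[OF b] by (intro mult_mono) auto
      then show "norm ((v \<bullet> b) *\<^sub>R (?D b p - ?D b q)) \<le> B b * norm (p - q) * norm v"
        by (simp add: mult.commute)
    qed
    finally show ?thesis by (simp add: sum_distrib_right)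
  qed
  moreover have "(\<Sum>b\<in>Basis. B b) > 0"
    using B(1) by (intro sum_pos) auto
  ultimately show ?thesis by blast
qed

text \<open>One constant for the size, the derivative and the Lipschitz constant of the derivative:
  the data that \<open>flow_exists\<close> asks of a vector field.\<close>

lemma compact_support_C2_bounds:
  fixes g :: "'a::euclidean_space \<Rightarrow> 'b::real_normed_vector"
  assumes g: "Ck (Suc (Suc 0)) g" and supp: "\<forall>p. p \<notin> cball x0 r \<longrightarrow> g p = 0"
  shows "\<exists>B>0. \<forall>p q v. norm (g p) \<le> B \<and> norm (frechet_derivative g (at p) v) \<le> B * norm v \<and>
    norm (frechet_derivative g (at p) v - frechet_derivative g (at q) v) \<le> B * norm (p - q) * norm v"
proof -
  obtain B1 where 1: "B1 > 0" "\<And>p. norm (g p) \<le> B1"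
    using compact_support_bounded[OF Ck_continuous[OF g] supp] by blast
  obtain B2 where 2: "B2 > 0" "\<And>p v. norm (frechet_derivative g (at p) v) \<le> B2 * norm v"
    using compact_support_derivative_bounded[OF Ck_SucD[OF g] supp] by blast
  obtain B3 where 3: "B3 > 0" "\<And>p q v. norm (frechet_derivative g (at p) v - frechet_derivative g (at q) v)
    \<le> B3 * norm (p - q) * norm v"
    using compact_support_second_derivative_bounded[OF g supp] by blast
  show ?thesis
  proof (intro exI[of _ "B1 + B2 + B3"] conjI allI)
    show "B1 + B2 + B3 > 0" using 1 2 3 by simp
    fix p q v :: 'a
    show "norm (g p) \<le> B1 + B2 + B3" using 1(2)[of p] 2(1) 3(1) by simp
    have "B2 * norm v \<le> (B1 + B2 + B3) * norm v"
      using 1 2 3 by (intro mult_right_mono) auto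
    then show "norm (frechet_derivative g (at p) v) \<le> (B1 + B2 + B3) * norm v"
      using 2(2)[of p v] by linarith
    have "B3 * norm (p - q) * norm v \<le> (B1 + B2 + B3) * norm (p - q) * norm v"
      using 1 2 3 by (intro mult_right_mono) auto
    then show "norm (frechet_derivative g (at p) v - frechet_derivative g (at q) v)
        \<le> (B1 + B2 + B3) * norm (p - q) * norm v"
      using 3(2)[of p v q] by linarith
  qed
qed

lemma has_vector_derivative_compose_has_derivative:
  assumes "(y has_vector_derivative y') (at s within S)" "(g has_derivative g') (at (y s))"
  shows "((\<lambda>s. g (y s)) has_vector_derivative g' y') (at s within S)"
proof -
  interpret bounded_linear g' using assms(2) by (rule has_derivative_bounded_linear)
  show ?thesis
    using has_derivative_compose[OF assms(1)[unfolded has_vector_derivative_def] assms(2)]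
    by (simp add: has_vector_derivative_def scaleR)
qed

text \<open>Cramer's rule: the cross products divided by the determinant form the dual basis of a,
  b, c.\<close>

lemma cross_dual_basis:
  fixes a b c w :: "real^3"
  assumes "a \<bullet> cross3 b c \<noteq> 0"
  shows "(((1 / (a \<bullet> cross3 b c)) *\<^sub>R cross3 b c) \<bullet> w) *\<^sub>R a +
    (((1 / (a \<bullet> cross3 b c)) *\<^sub>R cross3 c a) \<bullet> w) *\<^sub>R b +
    (((1 / (a \<bullet> cross3 b c)) *\<^sub>R cross3 a b) \<bullet> w) *\<^sub>R c = w"
proof -
  let ?d = "a \<bullet> cross3 b c"
  have "(cross3 b c \<bullet> w) *\<^sub>R a + (cross3 c a \<bullet> w) *\<^sub>R b + (cross3 a b \<bullet> w) *\<^sub>R c = ?d *\<^sub>R w"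
    by (simp add: vec_eq_iff forall_3 inner_vec_def sum_3 cross_components algebra_simps)
  then have "(1 / ?d) *\<^sub>R ((cross3 b c \<bullet> w) *\<^sub>R a + (cross3 c a \<bullet> w) *\<^sub>R b + (cross3 a b \<bullet> w) *\<^sub>R c) = w"
    using assms by simp
  then show ?thesis by (simp add: scaleR_add_right)
qed

text \<open>The vector field is prescribed along the segment from \<open>z\<close> to \<open>x\<close>, which is thus an integral curve.\<close>

lemma local_diffeomorphisms:
  fixes X :: "3 \<Rightarrow> real^3 \<Rightarrow> real^3" and N :: "real^3 \<Rightarrow> real^3"
  assumes X: "\<And>i. Ck (Suc (Suc 0)) (X i)" and supp: "\<And>i. \<forall>p. p \<notin> cball x0 r \<longrightarrow> X i p = 0"
    and indep: "X 1 x0 \<bullet> cross3 (X 2 x0) (X 3 x0) \<noteq> 0"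
    and N: "\<And>p. N differentiable at p"
    and pres: "\<And>i p v. \<bar>frechet_derivative N (at p) (X i p) \<bullet> v + N p \<bullet> frechet_derivative (X i) (at p) v\<bar>
      \<le> \<Lambda> * \<bar>N p \<bullet> v\<bar>"
    and "\<Lambda> \<ge> 0"
  shows "\<exists>\<delta>>0. \<exists>C>0. \<forall>x\<in>ball x0 \<delta>. \<forall>z\<in>ball x0 \<delta>. \<exists>\<phi> D.
    \<phi> z = x \<and> (\<forall>p. (\<phi> has_derivative D p) (at p)) \<and>
    (\<forall>p. norm (\<phi> p - p) \<le> C * norm (x - z)) \<and>
    (\<forall>p v. norm (D p v - v) \<le> C * norm (x - z) * norm v) \<and>
    (\<forall>p. p \<notin> cball x0 r \<longrightarrow> \<phi> p = p) \<and>
    (\<forall>p v. N p \<bullet> v = 0 \<longrightarrow> N (\<phi> p) \<bullet> D p v = 0)"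
proof -
  define DX where "DX i p = frechet_derivative (X i) (at p)" for i p
  have DX: "(X i has_derivative DX i p) (at p)" for i p
    unfolding DX_def by (rule Ck_has_derivative[OF X])
  have contX: "continuous_on S (X i)" for i S by (rule Ck_continuous[OF X])
  have "\<exists>B>0. \<forall>p q v. norm (X i p) \<le> B \<and> norm (DX i p v) \<le> B * norm v \<and>
    norm (DX i p v - DX i q v) \<le> B * norm (p - q) * norm v" for i
    unfolding DX_def by (rule compact_support_C2_bounds[OF X supp])
  then obtain B where B: "\<And>i. B i > 0" "\<And>i p. norm (X i p) \<le> B i"
      "\<And>i p v. norm (DX i p v) \<le> B i * norm v"
      "\<And>i p q v. norm (DX i p v - DX i q v) \<le> B i * norm (p - q) * norm v"
    by metis
  \<comment> \<open>\<Lambda> is included so that the same small number \<epsilon> later controls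
    the invariance equation as well as the flow.\<close>
  define M where "M = (\<Sum>i\<in>UNIV. B i) + \<Lambda>"
  have BM: "B i \<le> M" for i
    using member_le_sum[of i UNIV B] B(1) \<open>\<Lambda> \<ge> 0\<close> unfolding M_def by (simp add: less_imp_le add_increasing2)
  have M: "M > 0" using BM[of 1] B(1)[of 1] by linarith
  have "\<Lambda> \<le> M" unfolding M_def using B(1) by (simp add: sum_nonneg less_imp_le)
  define \<Delta> where "\<Delta> p = X 1 p \<bullet> cross3 (X 2 p) (X 3 p)" for p
  have cont_cross: "continuous_on S (\<lambda>p. cross3 (X i p) (X j p))" for S i j
    by (intro continuous_on_cross contX)
  have cont\<Delta>: "continuous_on S \<Delta>" for S
    unfolding \<Delta>_def[abs_def] by (intro continuous_intros contX cont_cross)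
  have "open {p. \<Delta> p \<noteq> 0}"
    using cont\<Delta> by (intro open_Collect_neq continuous_on_const)
  then obtain \<delta>1 where \<delta>1: "\<delta>1 > 0" "\<And>p. p \<in> cball x0 \<delta>1 \<Longrightarrow> \<Delta> p \<noteq> 0"
    using indep unfolding open_contains_cball \<Delta>_def by blast
  \<comment> \<open>The dual frame. Arithmetic in the index type 3 is cyclic, so
    \<open>i + 1\<close> and \<open>i + 2\<close> select the factors of Cramer's rule.\<close>
  define \<xi> where "\<xi> i p = (1 / \<Delta> p) *\<^sub>R cross3 (X (i + 1) p) (X (i + 2) p)" for i p
  have \<xi>: "(\<Sum>i\<in>UNIV. (\<xi> i p \<bullet> w) *\<^sub>R X i p) = w" if "p \<in> cball x0 \<delta>1" for p w
  proof -
    have "(1::3) + 1 = 2" "(1::3) + 2 = 3" "(2::3) + 1 = 3" "(2::3) + 2 = 1" "(3::3) + 1 = 1" "(3::3) + 2 = 2"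
      by simp_all
    then show ?thesis
      using cross_dual_basis[of "X 1 p" "X 2 p" "X 3 p" w] \<delta>1(2)[OF that]
      unfolding \<xi>_def \<Delta>_def sum_3 by presburger
  qed
  have cont\<xi>: "continuous_on (cball x0 \<delta>1) (\<xi> i)" for i
    unfolding \<xi>_def[abs_def] by (intro continuous_intros cont\<Delta> cont_cross) (use \<delta>1(2) in auto)
  have "\<exists>c>0. \<forall>p\<in>cball x0 \<delta>1. norm (\<xi> i p) \<le> c" for i
    using compact_imp_bounded[OF compact_continuous_image[OF cont\<xi> compact_cball]]
    unfolding bounded_pos by blast
  then obtain c where c: "\<And>i. c i > 0" "\<And>i p. p \<in> cball x0 \<delta>1 \<Longrightarrow> norm (\<xi> i p) \<le> c i"
    by metis
  define C1 where "C1 = (\<Sum>i\<in>UNIV. c i)"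
  have C1: "C1 > 0" unfolding C1_def using c(1) by (intro sum_pos) auto
  \<comment> \<open>Two points of the ball are at most 2 \<delta> apart, which makes \<epsilon> = C1
    M |w| at most 1/2. The factor 2 in the final constant comes from the derivative bound of
    \<open>flow_exists\<close>.\<close>
  define \<delta> where "\<delta> = min \<delta>1 (1 / (4 * C1 * M))"
  have \<delta>: "\<delta> > 0" using \<delta>1 C1 M by (simp add: \<delta>_def)
  show ?thesis
  proof (rule exI[of _ \<delta>], intro exI[of _ "2 * (C1 * M)"] conjI ballI)
    show "\<delta> > 0" "2 * (C1 * M) > 0" using \<delta> C1 M by simp_all
    fix x z assume x: "x \<in> ball x0 \<delta>" and z: "z \<in> ball x0 \<delta>"
    define w where "w = x - z"
    define \<epsilon> where "\<epsilon> = C1 * M * norm w"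
    have "norm w \<le> 2 * \<delta>"
      using x z norm_triangle_ineq4[of "x - x0" "z - x0"]
      by (simp add: w_def dist_norm norm_minus_commute)
    then have "\<epsilon> \<le> C1 * M * (2 * (1 / (4 * C1 * M)))"
      unfolding \<epsilon>_def \<delta>_def using C1 M by (intro mult_left_mono) auto
    also have "\<dots> = 1/2" using C1 M by simp
    finally have \<epsilon>: "0 \<le> \<epsilon>" "\<epsilon> \<le> 1/2" using C1 M by (auto simp: \<epsilon>_def)
    have seg: "z + s *\<^sub>R w \<in> cball x0 \<delta>1" if "s \<in> {0..1}" for s
    proof -
      have "z + s *\<^sub>R w = (1 - s) *\<^sub>R z + s *\<^sub>R x" by (simp add: w_def algebra_simps)
      moreover have "(1 - s) *\<^sub>R z + s *\<^sub>R x \<in> cball x0 \<delta>1"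
        using that x z by (intro convexD[OF convex_cball]) (auto simp: \<delta>_def)
      ultimately show ?thesis by simp
    qed
    \<comment> \<open>The coordinates of \<open>w\<close> in the frame at the point of the segment
      reached at time \<open>s\<close>. They do not vary with the space point, so each
      \<open>G s\<close> is a combination of the \<open>X i\<close> with constant coefficients and
      inherits their invariance \<open>pres\<close>.\<close>
    define a where "a i s = \<xi> i (z + s *\<^sub>R w) \<bullet> w" for i s
    have a_bd: "\<bar>a i s\<bar> \<le> c i * norm w" if "s \<in> {0..1}" for i s
      using Cauchy_Schwarz_ineq2[of "\<xi> i (z + s *\<^sub>R w)" w] mult_right_mono[OF c(2)[OF seg[OF that], of i], of "norm w"]
      unfolding a_def by simp
    have conta: "continuous_on {0..1} (a i)" for i
      unfolding a_def[abs_def]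
      by (intro continuous_intros continuous_on_compose2[OF cont\<xi>]) (use seg in blast)
    have sum_bd: "norm (\<Sum>i\<in>UNIV. a i s *\<^sub>R Y i) \<le> C1 * norm w * b"
      if "s \<in> {0..1}" "\<And>i. norm (Y i) \<le> b" for s b and Y :: "3 \<Rightarrow> 'q::real_normed_vector"
    proof -
      have "norm (\<Sum>i\<in>UNIV. a i s *\<^sub>R Y i) \<le> (\<Sum>i\<in>UNIV. c i * norm w * b)"
      proof (rule sum_norm_le)
        fix i
        show "norm (a i s *\<^sub>R Y i) \<le> c i * norm w * b"
          unfolding norm_scaleR real_norm_def using a_bd[OF that(1)] that(2) c(1)[of i]
          by (intro mult_mono) auto
      qed
      then show ?thesis by (simp add: C1_def sum_distrib_right)
    qed
    define G where "G s p = (\<Sum>i\<in>UNIV. a i s *\<^sub>R X i p)" for s p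
    define DG where "DG s p v = (\<Sum>i\<in>UNIV. a i s *\<^sub>R DX i p v)" for s p v
    have a2: "continuous_on ({0..1} \<times> UNIV) (\<lambda>q. a i (fst q))" for i
      by (rule continuous_on_compose2[OF conta continuous_on_fst[OF continuous_on_id]]) auto
    have "\<exists>\<phi> V. (\<forall>p. \<phi> p 0 = p) \<and>
      (\<forall>p. \<forall>s\<in>{0..1}. (\<phi> p has_vector_derivative G s (\<phi> p s)) (at s within {0..1})) \<and>
      (\<forall>p v. V p v 0 = v) \<and>
      (\<forall>p v. \<forall>s\<in>{0..1}. (V p v has_vector_derivative DG s (\<phi> p s) (V p v s)) (at s within {0..1})) \<and>
      (\<forall>p. ((\<lambda>p. \<phi> p 1) has_derivative (\<lambda>v. V p v 1)) (at p)) \<and>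
      (\<forall>p. norm (\<phi> p 1 - p) \<le> \<epsilon>) \<and>
      (\<forall>p v. norm (V p v 1 - v) \<le> 2 * \<epsilon> * norm v) \<and>
      (\<forall>\<gamma>. (\<forall>s\<in>{0..1}. (\<gamma> has_vector_derivative G s (\<gamma> s)) (at s within {0..1})) \<longrightarrow> \<gamma> 1 = \<phi> (\<gamma> 0) 1)"
    proof (rule flow_exists[OF _ _ _ _ _ _ \<epsilon> \<epsilon>(1)])
      show "continuous_on ({0..1} \<times> UNIV) (\<lambda>(s, p). G s p)"
        unfolding G_def case_prod_beta'
        by (intro continuous_on_sum continuous_on_scaleR a2 continuous_on_compose2[OF contX[of UNIV]] continuous_on_snd continuous_on_id) auto
      have cDX: "continuous_on UNIV (\<lambda>q. DX i (fst q) (snd q))" for i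
      proof -
        have eq: "DX i (fst q) (snd q) = (\<Sum>b\<in>Basis. (snd q \<bullet> b) *\<^sub>R DX i (fst q) b)" for q
          unfolding DX_def using X by (intro frechet_derivative_euclidean) simp
        have "Ck (Suc 0) (\<lambda>p. DX i p b)" for b
          using X[of i] unfolding DX_def by (metis Ck.simps(2))
        then have cb: "continuous_on UNIV (\<lambda>p. DX i p b)" for b
          by (rule Ck_continuous)
        have "continuous_on UNIV (\<lambda>q::(real^3) \<times> (real^3). DX i (fst q) b)" for b
          by (rule continuous_on_compose2[OF cb continuous_on_fst[OF continuous_on_id]]) simp
        then show ?thesis
          unfolding eq
          by (intro continuous_on_sum continuous_on_scaleR continuous_on_inner continuous_on_snd
              continuous_on_id continuous_on_const)
      qed
      have "continuous_on ({0..1} \<times> UNIV) (\<lambda>q::real \<times> (real^3) \<times> (real^3). DX i (fst (snd q)) (snd (snd q)))" for i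
        by (rule continuous_on_compose2[OF cDX continuous_on_snd[OF continuous_on_id]]) simp
      then show "continuous_on ({0..1} \<times> UNIV) (\<lambda>(s, q). DG s (fst q) (snd q))"
        unfolding DG_def case_prod_beta'
        by (intro continuous_on_sum continuous_on_scaleR a2)
      fix s :: real assume s: "s \<in> {0..1}"
      show "(G s has_derivative DG s p) (at p)" for p
        unfolding G_def[abs_def] DG_def[abs_def]
        by (intro has_derivative_sum has_derivative_scaleR_right DX)
      show "norm (G s p) \<le> \<epsilon>" for p
        using sum_bd[OF s, of "\<lambda>i. X i p" M] order_trans[OF B(2) BM]
        by (simp add: G_def \<epsilon>_def mult_ac)
      show "norm (DG s p v) \<le> \<epsilon> * norm v" for p v
        using sum_bd[OF s, of "\<lambda>i. DX i p v" "M * norm v"] order_trans[OF B(3) mult_right_mono[OF BM]]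
        by (simp add: DG_def \<epsilon>_def mult_ac)
      show "norm (DG s p v - DG s q v) \<le> \<epsilon> * norm (p - q) * norm v" for p q v
        using sum_bd[OF s, of "\<lambda>i. DX i p v - DX i q v" "M * norm (p - q) * norm v"]
          order_trans[OF B(4) mult_right_mono[OF mult_right_mono[OF BM]]]
        by (simp add: DG_def \<epsilon>_def mult_ac scaleR_diff_right sum_subtractf)
    qed
    then obtain \<phi> V where \<phi>0: "\<forall>p. \<phi> p 0 = p"
      and \<phi>: "\<forall>p. \<forall>s\<in>{0..1}. (\<phi> p has_vector_derivative G s (\<phi> p s)) (at s within {0..1})"
      and V0: "\<forall>p v. V p v 0 = v"
      and V: "\<forall>p v. \<forall>s\<in>{0..1}. (V p v has_vector_derivative DG s (\<phi> p s) (V p v s)) (at s within {0..1})"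
      and der: "\<forall>p. ((\<lambda>p. \<phi> p 1) has_derivative (\<lambda>v. V p v 1)) (at p)"
      and near: "\<forall>p. norm (\<phi> p 1 - p) \<le> \<epsilon>"
      and Vnear: "\<forall>p v. norm (V p v 1 - v) \<le> 2 * \<epsilon> * norm v"
      and uniq: "\<forall>\<gamma>. (\<forall>s\<in>{0..1}. (\<gamma> has_vector_derivative G s (\<gamma> s)) (at s within {0..1})) \<longrightarrow> \<gamma> 1 = \<phi> (\<gamma> 0) 1"
      by (elim exE conjE)
    have "\<forall>s\<in>{0..1}. ((\<lambda>s. z + s *\<^sub>R w) has_vector_derivative G s (z + s *\<^sub>R w)) (at s within {0..1})"
    proof
      fix s :: real assume "s \<in> {0..1}"
      then have "G s (z + s *\<^sub>R w) = w" unfolding G_def a_def by (intro \<xi> seg)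
      then show "((\<lambda>s. z + s *\<^sub>R w) has_vector_derivative G s (z + s *\<^sub>R w)) (at s within {0..1})"
        by (auto intro!: derivative_eq_intros)
    qed
    from uniq[rule_format, of "\<lambda>s. z + s *\<^sub>R w", OF bspec[OF this]]
    have "\<phi> z 1 = x" by (simp add: w_def)
    moreover have "\<phi> p 1 = p" if "p \<notin> cball x0 r" for p
    proof -
      have "\<forall>s\<in>{0..1}. ((\<lambda>s. p) has_vector_derivative G s p) (at s within {0..1})"
        by (simp add: G_def supp[rule_format, OF that])
      from uniq[rule_format, of "\<lambda>s. p", OF bspec[OF this]] show ?thesis by simp
    qed
    \<comment> \<open>The scalar q(s) = N (\<phi> p s) . V p v s starts at 0 and satisfies |q'|
      \<le> \<epsilon> |q| by \<open>pres\<close>, so the growth bound keeps it at 0.\<close>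
    moreover have "N (\<phi> p 1) \<bullet> V p v 1 = 0" if "N p \<bullet> v = 0" for p v
    proof -
      let ?DN = "\<lambda>q. frechet_derivative N (at q)"
      have DN: "(N has_derivative ?DN q) (at q)" for q
        using N by (simp add: frechet_derivative_works[symmetric])
      have "norm (N (\<phi> p 1) \<bullet> V p v 1) \<le> 2 * (norm (N (\<phi> p 0) \<bullet> V p v 0) + 0)"
      proof (rule small_growth_bound[OF _ _ \<epsilon>])
        fix s :: real assume s: "s \<in> {0..1}"
        show "((\<lambda>s. N (\<phi> p s) \<bullet> V p v s) has_vector_derivative
          N (\<phi> p s) \<bullet> DG s (\<phi> p s) (V p v s) + ?DN (\<phi> p s) (G s (\<phi> p s)) \<bullet> V p v s) (at s within {0..1})"
          using \<phi> V s
          by (intro bounded_bilinear.has_vector_derivative[OF bounded_bilinear_inner]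
              has_vector_derivative_compose_has_derivative[OF _ DN]) auto
        interpret bounded_linear "?DN (\<phi> p s)" using DN by (rule has_derivative_bounded_linear)
        have "N (\<phi> p s) \<bullet> DG s (\<phi> p s) (V p v s) + ?DN (\<phi> p s) (G s (\<phi> p s)) \<bullet> V p v s =
          (\<Sum>i\<in>UNIV. a i s *\<^sub>R (?DN (\<phi> p s) (X i (\<phi> p s)) \<bullet> V p v s + N (\<phi> p s) \<bullet> DX i (\<phi> p s) (V p v s)))"
          by (simp add: DG_def G_def sum scaleR inner_sum_right inner_sum_left sum.distrib algebra_simps)
        also have "norm \<dots> \<le> C1 * norm w * (\<Lambda> * \<bar>N (\<phi> p s) \<bullet> V p v s\<bar>)"
          by (rule sum_bd[OF s]) (simp add: pres DX_def)
        also have "\<dots> \<le> C1 * norm w * (M * \<bar>N (\<phi> p s) \<bullet> V p v s\<bar>)"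
          using C1 \<open>\<Lambda> \<le> M\<close> by (intro mult_left_mono mult_right_mono) auto
        finally show "norm (N (\<phi> p s) \<bullet> DG s (\<phi> p s) (V p v s) + ?DN (\<phi> p s) (G s (\<phi> p s)) \<bullet> V p v s)
            \<le> 0 + \<epsilon> * norm (N (\<phi> p s) \<bullet> V p v s)"
          by (simp add: \<epsilon>_def mult_ac)
      qed auto
      then show ?thesis using that \<phi>0 V0 by simp
    qed
    moreover have "\<epsilon> \<le> 2 * (C1 * M) * norm (x - z)"
      using C1 M by (simp add: \<epsilon>_def w_def)
    then have "norm (\<phi> p 1 - p) \<le> 2 * (C1 * M) * norm (x - z)" for p
      using near order_trans by blast
    moreover have "norm (V p v 1 - v) \<le> 2 * (C1 * M) * norm (x - z) * norm v" for p v
      using Vnear by (simp add: \<epsilon>_def w_def mult_ac)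
    ultimately show "\<exists>\<phi> D. \<phi> z = x \<and> (\<forall>p. (\<phi> has_derivative D p) (at p)) \<and>
      (\<forall>p. norm (\<phi> p - p) \<le> 2 * (C1 * M) * norm (x - z)) \<and>
      (\<forall>p v. norm (D p v - v) \<le> 2 * (C1 * M) * norm (x - z) * norm v) \<and>
      (\<forall>p. p \<notin> cball x0 r \<longrightarrow> \<phi> p = p) \<and>
      (\<forall>p v. N p \<bullet> v = 0 \<longrightarrow> N (\<phi> p) \<bullet> D p v = 0)"
      using der by (intro exI[of _ "\<lambda>p. \<phi> p 1"] exI[of _ "\<lambda>p v. V p v 1"]) blast
  qed
qed

subsection \<open>Transport of trajectories\<close>

lemma abs_cont_on_continuous:
  assumes "abs_cont_on a b y"
  shows "continuous_on {a..b} y"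
  unfolding continuous_on_iff
proof (intro ballI allI impI)
  fix x e :: real assume x: "x \<in> {a..b}" and "e > 0"
  then obtain d where d: "d > 0" and
    ac: "\<And>(k::nat) s t. \<lbrakk>\<forall>i<k. a \<le> s i \<and> s i \<le> t i \<and> t i \<le> b;
      disjoint_family_on (\<lambda>i. {s i<..<t i}) {..<k}; (\<Sum>i<k. t i - s i) < d\<rbrakk>
      \<Longrightarrow> (\<Sum>i<k. dist (y (s i)) (y (t i))) < e"
    using assms unfolding abs_cont_on_def by meson
  have "dist (y x') (y x) < e" if x': "x' \<in> {a..b}" "dist x' x < d" for x'
  proof -
    have "(\<Sum>i<Suc 0. dist (y ((\<lambda>i::nat. min x x') i)) (y ((\<lambda>i::nat. max x x') i))) < e"
      by (rule ac) (use x x' in \<open>auto simp: disjoint_family_on_def dist_real_def\<close>)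
    then show ?thesis
      by (cases "x \<le> x'") (simp_all add: min_def max_def dist_commute split: if_splits)
  qed
  then show "\<exists>d>0. \<forall>x'\<in>{a..b}. dist x' x < d \<longrightarrow> dist (y x') (y x) < e"
    using d by blast
qed

text \<open>Slowing down by \<open>\<kappa> \<ge> 1\<close> does not increase the total length of
  the pulled-back intervals, and the Lipschitz map is paid for by asking for
  \<open>e / L\<close>.\<close>

lemma abs_cont_on_rescale:
  assumes y: "abs_cont_on 0 t y" and "\<kappa> \<ge> 1" and "L > 0"
    and lip: "\<And>p q. dist (\<phi> p) (\<phi> q) \<le> L * dist p q"
  shows "abs_cont_on 0 (\<kappa> * t) (\<lambda>s. \<phi> (y (s / \<kappa>)))"
  unfolding abs_cont_on_def
proof (intro allI impI)
  fix e :: real assume "e > 0"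
  then have "e / L > 0" using \<open>L > 0\<close> by simp
  with y obtain d where d: "d > 0" and
    ac: "\<And>(k::nat) s u. \<lbrakk>\<forall>i<k. 0 \<le> s i \<and> s i \<le> u i \<and> u i \<le> t;
      disjoint_family_on (\<lambda>i. {s i<..<u i}) {..<k}; (\<Sum>i<k. u i - s i) < d\<rbrakk>
      \<Longrightarrow> (\<Sum>i<k. dist (y (s i)) (y (u i))) < e / L"
    unfolding abs_cont_on_def by meson
  have "(\<Sum>i<k. dist (\<phi> (y (s i / \<kappa>))) (\<phi> (y (u i / \<kappa>)))) < e"
    if su: "\<forall>i<k. 0 \<le> s i \<and> s i \<le> u i \<and> u i \<le> \<kappa> * t"
      and dj: "disjoint_family_on (\<lambda>i. {s i<..<u i}) {..<k}" and sm: "(\<Sum>i<k. u i - s i) < d"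
    for k :: nat and s u :: "nat \<Rightarrow> real"
  proof -
    have "(\<Sum>i<k. dist (y (s i / \<kappa>)) (y (u i / \<kappa>))) < e / L"
    proof (rule ac)
      show "\<forall>i<k. 0 \<le> s i / \<kappa> \<and> s i / \<kappa> \<le> u i / \<kappa> \<and> u i / \<kappa> \<le> t"
        using su \<open>\<kappa> \<ge> 1\<close> by (auto simp: field_simps)
      show "disjoint_family_on (\<lambda>i. {s i / \<kappa><..<u i / \<kappa>}) {..<k}"
        unfolding disjoint_family_on_def
      proof (intro ballI impI)
        fix i j assume ij: "i \<in> {..<k}" "j \<in> {..<k}" "i \<noteq> j"
        have "\<kappa> * x \<in> {s l<..<u l}" if "x \<in> {s l / \<kappa><..<u l / \<kappa>}" for x l
          using that \<open>\<kappa> \<ge> 1\<close> by (auto simp: field_simps)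
        then show "{s i / \<kappa><..<u i / \<kappa>} \<inter> {s j / \<kappa><..<u j / \<kappa>} = {}"
          using dj ij unfolding disjoint_family_on_def by blast
      qed
      have "(\<Sum>i<k. u i / \<kappa> - s i / \<kappa>) \<le> (\<Sum>i<k. u i - s i)"
      proof (rule sum_mono)
        fix i assume "i \<in> {..<k}"
        then have "(u i - s i) / \<kappa> \<le> (u i - s i) / 1"
          using su \<open>\<kappa> \<ge> 1\<close> by (intro divide_left_mono) auto
        then show "u i / \<kappa> - s i / \<kappa> \<le> u i - s i" by (simp add: diff_divide_distrib)
      qed
      then show "(\<Sum>i<k. u i / \<kappa> - s i / \<kappa>) < d" using sm by linarith
    qed
    then have "L * (\<Sum>i<k. dist (y (s i / \<kappa>)) (y (u i / \<kappa>))) < e"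
      using \<open>L > 0\<close> by (simp add: field_simps)
    moreover have "(\<Sum>i<k. dist (\<phi> (y (s i / \<kappa>))) (\<phi> (y (u i / \<kappa>)))) \<le>
        L * (\<Sum>i<k. dist (y (s i / \<kappa>)) (y (u i / \<kappa>)))"
      unfolding sum_distrib_left by (intro sum_mono lip)
    ultimately show ?thesis by linarith
  qed
  then show "\<exists>d>0. \<forall>(k::nat) s u. (\<forall>i<k. 0 \<le> s i \<and> s i \<le> u i \<and> u i \<le> \<kappa> * t) \<longrightarrow>
      disjoint_family_on (\<lambda>i. {s i<..<u i}) {..<k} \<longrightarrow> (\<Sum>i<k. u i - s i) < d \<longrightarrow>
      (\<Sum>i<k. dist (\<phi> (y (s i / \<kappa>))) (\<phi> (y (u i / \<kappa>)))) < e"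
    using d by blast
qed

lemma AE_lebesgue_on_rescale:
  fixes t \<kappa> :: real
  assumes "AE s in lebesgue_on {0..t}. P s" and "\<kappa> > 0"
  shows "AE s in lebesgue_on {0..\<kappa> * t}. P (s / \<kappa>)"
proof -
  have "AE s in lebesgue. s \<in> {0..t} \<longrightarrow> P s"
    using assms(1) by (simp add: AE_restrict_space_iff)
  then obtain A where A: "A \<in> null_sets lebesgue" "{s. \<not> (s \<in> {0..t} \<longrightarrow> P s)} \<subseteq> A"
    unfolding eventually_ae_filter by auto
  have "(*\<^sub>R) (1 / \<kappa>) -` A \<inter> space lebesgue \<in> sets lebesgue"
    using lebesgue_measurable_scaling A(1) by (rule measurable_sets[OF _ null_setsD2])
  moreover have "(*\<^sub>R) (1 / \<kappa>) -` A = (\<lambda>x. \<kappa> *\<^sub>R x + 0) ` A"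
  proof (intro equalityI subsetI)
    fix x assume "x \<in> (*\<^sub>R) (1 / \<kappa>) -` A"
    then show "x \<in> (\<lambda>x. \<kappa> *\<^sub>R x + 0) ` A"
      using \<open>\<kappa> > 0\<close> by (intro image_eqI[of _ _ "(1 / \<kappa>) *\<^sub>R x"]) auto
  qed (use \<open>\<kappa> > 0\<close> in auto)
  moreover have "emeasure lebesgue ((\<lambda>x. \<kappa> *\<^sub>R x + 0) ` A) = 0"
    using emeasure_lebesgue_affine[of \<kappa> 0 A] A(1) by (simp add: null_sets_def)
  ultimately have "(*\<^sub>R) (1 / \<kappa>) -` A \<in> null_sets lebesgue"
    by (simp add: null_sets_def)
  then have "AE s in lebesgue. s \<in> {0..\<kappa> * t} \<longrightarrow> P (s / \<kappa>)"
  proof (rule AE_I')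
    show "{s \<in> space lebesgue. \<not> (s \<in> {0..\<kappa> * t} \<longrightarrow> P (s / \<kappa>))} \<subseteq> (*\<^sub>R) (1 / \<kappa>) -` A"
    proof
      fix s assume s: "s \<in> {s \<in> space lebesgue. \<not> (s \<in> {0..\<kappa> * t} \<longrightarrow> P (s / \<kappa>))}"
      then have "s / \<kappa> \<in> {0..t}" using \<open>\<kappa> > 0\<close> by (auto simp: field_simps)
      then have "s / \<kappa> \<in> A" using A(2) s by blast
      then show "s \<in> (*\<^sub>R) (1 / \<kappa>) -` A" by simp
    qed
  qed
  then show ?thesis by (simp add: AE_restrict_space_iff)
qed

lemma has_vector_derivative_rescale:
  fixes t \<kappa> :: real
  assumes "(y has_vector_derivative v) (at (s / \<kappa>) within {0..t})" "\<kappa> > 0"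
  shows "((\<lambda>s. y (s / \<kappa>)) has_vector_derivative (1 / \<kappa>) *\<^sub>R v) (at s within {0..\<kappa> * t})"
proof -
  have "(\<lambda>s. s / \<kappa>) ` {0..\<kappa> * t} \<subseteq> {0..t}"
    using \<open>\<kappa> > 0\<close> by (auto simp: field_simps)
  then have "(y has_vector_derivative v) (at (s / \<kappa>) within (\<lambda>s. s / \<kappa>) ` {0..\<kappa> * t})"
    using assms(1) has_vector_derivative_within_subset by blast
  moreover have "((\<lambda>s. s / \<kappa>) has_vector_derivative 1 / \<kappa>) (at s within {0..\<kappa> * t})"
    using \<open>\<kappa> > 0\<close>
    by (auto intro!: derivative_eq_intros simp: has_real_derivative_iff_has_vector_derivative[symmetric])
  ultimately show ?thesis
    using vector_diff_chain_within by (fastforce simp: o_def)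
qed

text \<open>The image under \<open>\<phi>\<close> of a trajectory with control \<open>u\<close> has
  control \<open>W (y) u\<close>, of norm up to \<open>\<kappa>\<close>. Running it
  \<open>\<kappa>\<close> times slower brings the control back into the unit ball, and the end point
  is kept because \<open>\<phi>\<close> fixes \<open>K\<close> pointwise.\<close>

lemma transport_trajectory:
  fixes f :: "'m::finite \<Rightarrow> real^'n \<Rightarrow> real^'n" and W :: "real^'n \<Rightarrow> real^'m^'m"
  assumes u: "u \<in> controls" and y: "trajectory_on f u z t y" and "t \<ge> 0" and yK: "y t \<in> K"
    and \<phi>: "\<And>p. (\<phi> has_derivative D p) (at p)" and "\<kappa> \<ge> 1"
    and lip: "\<And>p q. dist (\<phi> p) (\<phi> q) \<le> L * dist p q" and "L > 0"
    and fixK: "\<And>p. p \<in> K \<Longrightarrow> \<phi> p = p"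
    and Wm: "\<And>i j. (\<lambda>p. W p $ i $ j) \<in> borel_measurable borel"
    and Wb: "\<And>p v. norm (W p *v v) \<le> \<kappa> * norm v"
    and Wf: "\<And>p v. (\<Sum>i\<in>UNIV. (W p *v v) $ i *\<^sub>R f i (\<phi> p)) = D p (\<Sum>i\<in>UNIV. v $ i *\<^sub>R f i p)"
  shows "\<exists>u'\<in>controls. \<exists>y'. trajectory_on f u' (\<phi> z) (\<kappa> * t) y' \<and> y' (\<kappa> * t) \<in> K"
proof (intro bexI exI conjI)
  have \<kappa>: "\<kappa> > 0" using \<open>\<kappa> \<ge> 1\<close> by simp
  have y0: "y 0 = z" and ac: "abs_cont_on 0 t y"
    and ode: "AE s in lebesgue_on {0..t}. (y has_vector_derivative (\<Sum>i\<in>UNIV. (u s $ i) *\<^sub>R f i (y s))) (at s within {0..t})"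
    using y by (auto simp: trajectory_on_def)
  \<comment> \<open>A control must be defined and measurable for all times; it is set to zero after
    the arrival time.\<close>
  define u' where "u' s = (if s \<in> {0..\<kappa> * t} then (1 / \<kappa>) *\<^sub>R (W (y (s / \<kappa>)) *v u (s / \<kappa>)) else 0)" for s
  show "\<phi> (y (\<kappa> * t / \<kappa>)) \<in> K" using yK fixK \<kappa> by simp
  show "trajectory_on f u' (\<phi> z) (\<kappa> * t) (\<lambda>s. \<phi> (y (s / \<kappa>)))"
    unfolding trajectory_on_def
  proof (intro conjI)
    show "\<phi> (y (0 / \<kappa>)) = \<phi> z" using y0 by simp
    show "abs_cont_on 0 (\<kappa> * t) (\<lambda>s. \<phi> (y (s / \<kappa>)))"
      by (rule abs_cont_on_rescale[OF ac \<open>\<kappa> \<ge> 1\<close> \<open>L > 0\<close> lip])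
    have "AE s in lebesgue_on {0..\<kappa> * t}. s \<in> space (lebesgue_on {0..\<kappa> * t})"
      by (rule AE_space)
    with AE_lebesgue_on_rescale[OF ode \<kappa>]
    show "AE s in lebesgue_on {0..\<kappa> * t}. ((\<lambda>s. \<phi> (y (s / \<kappa>))) has_vector_derivative
      (\<Sum>i\<in>UNIV. (u' s $ i) *\<^sub>R f i (\<phi> (y (s / \<kappa>))))) (at s within {0..\<kappa> * t})"
    proof eventually_elim
      case (elim s)
      let ?v = "\<Sum>i\<in>UNIV. (u (s / \<kappa>) $ i) *\<^sub>R f i (y (s / \<kappa>))"
      interpret bounded_linear "D (y (s / \<kappa>))" using \<phi> by (rule has_derivative_bounded_linear)
      have "((\<lambda>s. \<phi> (y (s / \<kappa>))) has_vector_derivative D (y (s / \<kappa>)) ((1 / \<kappa>) *\<^sub>R ?v)) (at s within {0..\<kappa> * t})"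
        by (rule has_vector_derivative_compose_has_derivative[OF has_vector_derivative_rescale[OF elim(1) \<kappa>] \<phi>])
      moreover have "D (y (s / \<kappa>)) ((1 / \<kappa>) *\<^sub>R ?v) = (\<Sum>i\<in>UNIV. (u' s $ i) *\<^sub>R f i (\<phi> (y (s / \<kappa>))))"
      proof -
        have "s \<in> {0..\<kappa> * t}" using elim(2) by simp
        then have "u' s = (1 / \<kappa>) *\<^sub>R (W (y (s / \<kappa>)) *v u (s / \<kappa>))"
          unfolding u'_def by (rule if_P)
        then have "(\<Sum>i\<in>UNIV. (u' s $ i) *\<^sub>R f i (\<phi> (y (s / \<kappa>)))) = (1 / \<kappa>) *\<^sub>R D (y (s / \<kappa>)) ?v"
          unfolding Wf[symmetric] scaleR_sum_right by simp
        then show ?thesis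
          unfolding scaleR by (rule sym)
      qed
      ultimately show ?case by simp
    qed
  qed
  have "norm (u' s) \<le> 1" for s
  proof (cases "s \<in> {0..\<kappa> * t}")
    case True
    then have "norm (u (s / \<kappa>)) \<le> 1" using u \<kappa> by (auto simp: controls_def)
    then have "norm (W (y (s / \<kappa>)) *v u (s / \<kappa>)) \<le> \<kappa> * 1"
      using Wb[of "y (s / \<kappa>)" "u (s / \<kappa>)"] \<kappa> by (meson mult_left_mono less_imp_le order_trans)
    then show ?thesis using \<kappa> unfolding u'_def if_P[OF True] by (simp add: field_simps)
  next
    case False
    then show ?thesis unfolding u'_def if_not_P[OF False] by simp
  qed
  moreover have "u' \<in> borel_measurable lebesgue"
  proof -
    \<comment> \<open>Outside its time interval \<open>y\<close> is arbitrary, and \<open>u\<close>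
      is measurable for nonnegative times only. Clamping time in \<open>y\<close> and extending
      \<open>u\<close> by zero give measurable functions on the whole line that agree with them
      where \<open>u'\<close> uses them.\<close>
    define yy where "yy s = y (max 0 (min t s))" for s
    have "continuous_on UNIV yy"
      unfolding yy_def[abs_def]
      by (rule continuous_on_compose2[OF abs_cont_on_continuous[OF ac]])
        (use \<open>t \<ge> 0\<close> in \<open>auto intro!: continuous_intros\<close>)
    then have [measurable]: "yy \<in> borel_measurable borel" by (rule borel_measurable_continuous_onI)
    define uu where "uu s = (if s \<in> {0..} then u s else 0)" for s
    have "uu \<in> borel_measurable lebesgue"
      unfolding uu_def[abs_def] using u by (intro borel_measurable_if_I) (auto simp: controls_def)
    from measurable_compose[OF lebesgue_measurable_scaling[of "1 / \<kappa>"] this]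
    have um: "(\<lambda>s. uu (s / \<kappa>)) \<in> borel_measurable lebesgue" by simp
    have um': "(\<lambda>s. uu (s / \<kappa>) $ j) \<in> borel_measurable lebesgue" for j
      by (rule measurable_compose[OF um]) (intro borel_measurable_continuous_onI continuous_intros)
    have "(\<lambda>s. W (yy (s / \<kappa>)) $ i $ j) \<in> borel_measurable borel" for i j
      by (rule measurable_compose[OF _ Wm]) measurable
    then have Wm': "(\<lambda>s. W (yy (s / \<kappa>)) $ i $ j) \<in> borel_measurable lebesgue" for i j
      by (intro measurable_completion) simp
    have "u' s $ i = indicator {0..\<kappa> * t} s * ((1 / \<kappa>) * (\<Sum>j\<in>UNIV. W (yy (s / \<kappa>)) $ i $ j * uu (s / \<kappa>) $ j))" for s i
    proof (cases "s \<in> {0..\<kappa> * t}")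
      case True
      then have "s / \<kappa> \<in> {0..t}" using \<kappa> by (auto simp: field_simps)
      then have "yy (s / \<kappa>) = y (s / \<kappa>)" "uu (s / \<kappa>) = u (s / \<kappa>)"
        by (simp_all add: yy_def uu_def)
      then show ?thesis using True unfolding u'_def if_P[OF True] by (simp add: matrix_vector_mult_def)
    next
      case False
      then have "indicator {0..\<kappa> * t} s = (0::real)" by (rule indicator_simps(2))
      then show ?thesis unfolding u'_def if_not_P[OF False] by simp
    qed
    moreover have "(\<lambda>s. indicator {0..\<kappa> * t} s * ((1 / \<kappa>) * (\<Sum>j\<in>UNIV. W (yy (s / \<kappa>)) $ i $ j * uu (s / \<kappa>) $ j)))
        \<in> borel_measurable lebesgue" for i
      by (intro borel_measurable_times borel_measurable_indicator borel_measurable_sum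
          borel_measurable_const um' Wm') simp
    ultimately have "(\<lambda>s. u' s $ i) \<in> borel_measurable lebesgue" for i
      by simp
    then show ?thesis
      by (subst borel_measurable_euclidean_space) (auto simp: Basis_vec_def inner_axis)
  qed
  ultimately show "u' \<in> controls"
    by (simp add: controls_def measurable_restrict_space1)
qed

text \<open>The diffeomorphisms come with pointwise differentiability only, so measurability is
  obtained by writing the derivative as a limit of continuous difference quotients.\<close>

lemma derivative_borel_measurable:
  fixes \<phi> :: "'a::euclidean_space \<Rightarrow> real^'n"
  assumes \<phi>: "\<And>p. (\<phi> has_derivative D p) (at p)"
  shows "(\<lambda>p. D p v) \<in> borel_measurable borel"
proof -
  have "continuous_on UNIV \<phi>"
    using has_derivative_continuous[OF \<phi>] by (intro continuous_at_imp_continuous_on) blast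
  then have [measurable]: "\<phi> \<in> borel_measurable borel" by (rule borel_measurable_continuous_onI)
  have "(\<lambda>p. D p v $ k) \<in> borel_measurable borel" for k
  proof (rule borel_measurable_LIMSEQ_metric)
    show "(\<lambda>p. (\<phi> (p + inverse (real (Suc n)) *\<^sub>R v) $ k - \<phi> p $ k) / inverse (real (Suc n)))
        \<in> borel_measurable borel" for n
    proof -
      have "(\<lambda>p. \<phi> (p + inverse (real (Suc n)) *\<^sub>R v)) \<in> borel_measurable borel" by measurable
      note m = measurable_compose[OF this, of "\<lambda>x. x $ k" borel] measurable_compose[of \<phi> borel borel "\<lambda>x. x $ k" borel]
      have "(\<lambda>x::real^'n. x $ k) \<in> borel_measurable borel"
        by (intro borel_measurable_continuous_onI continuous_intros)
      from m(1)[OF this] m(2)[OF _ this] show ?thesis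
        by (intro borel_measurable_divide borel_measurable_diff borel_measurable_const) auto
    qed
    fix p
    have "((\<lambda>t. p + t *\<^sub>R v) has_vector_derivative v) (at 0)"
      by (auto intro!: derivative_eq_intros)
    from has_vector_derivative_compose_has_derivative[OF this, of \<phi> "D p"]
    have "((\<lambda>t. \<phi> (p + t *\<^sub>R v)) has_vector_derivative D p v) (at 0)"
      using \<phi>[of p] by simp
    from bounded_linear.has_vector_derivative[OF bounded_linear_vec_nth this, of k]
    have "((\<lambda>t. \<phi> (p + t *\<^sub>R v) $ k) has_real_derivative D p v $ k) (at 0)"
      by (simp add: has_real_derivative_iff_has_vector_derivative)
    then have "((\<lambda>t. (\<phi> (p + t *\<^sub>R v) $ k - \<phi> p $ k) / t) \<longlongrightarrow> D p v $ k) (at 0)"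
      by (simp add: has_field_derivative_iff)
    moreover have "filterlim (\<lambda>n. inverse (real (Suc n))) (at 0) sequentially"
      using LIMSEQ_inverse_real_of_nat by (auto simp: filterlim_at)
    ultimately show "(\<lambda>n. (\<phi> (p + inverse (real (Suc n)) *\<^sub>R v) $ k - \<phi> p $ k) / inverse (real (Suc n)))
        \<longlonglongrightarrow> D p v $ k"
      by (rule filterlim_compose)
  qed
  then show ?thesis
    by (subst borel_measurable_euclidean_space) (auto simp: Basis_vec_def inner_axis)
qed

text \<open>If \<open>S\<close> is empty at one point of the ball it is empty at all of them, and
  the infimum is constant there. Otherwise one nonempty value bounds the infimum on the whole ball,
  which turns the multiplicative estimate into a Lipschitz one.\<close>

lemma Inf_lipschitz_of_scaling:
  fixes S :: "'a::metric_space \<Rightarrow> real set"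
  assumes S: "\<And>x. S x \<subseteq> {0..}" and "C \<ge> 0"
    and scale: "\<And>x z \<tau>. \<lbrakk>x \<in> ball x0 \<delta>; z \<in> ball x0 \<delta>; \<tau> \<in> S z\<rbrakk> \<Longrightarrow> (1 + C * dist x z) * \<tau> \<in> S x"
  shows "\<exists>L. L-lipschitz_on (ball x0 \<delta>) (\<lambda>x. Inf (S x))"
proof (cases "\<exists>x\<in>ball x0 \<delta>. S x \<noteq> {}")
  case False
  then have "0-lipschitz_on (ball x0 \<delta>) (\<lambda>x. Inf (S x))"
    by (intro lipschitz_onI) auto
  then show ?thesis by blast
next
  case True
  then obtain a where a: "a \<in> ball x0 \<delta>" "S a \<noteq> {}" by blast
  then have ne: "S x \<noteq> {}" if "x \<in> ball x0 \<delta>" for x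
    using scale[OF that a(1)] by blast
  have bdd: "bdd_below (S x)" for x
    using S[of x] by (intro bdd_belowI[of _ 0]) auto
  have nonneg: "Inf (S x) \<ge> 0" if "x \<in> ball x0 \<delta>" for x
    using S[of x] ne[OF that] by (intro cInf_greatest) auto
  have le: "Inf (S x) \<le> (1 + C * dist x z) * Inf (S z)" if x: "x \<in> ball x0 \<delta>" and z: "z \<in> ball x0 \<delta>" for x z
  proof -
    have pos: "1 + C * dist x z > 0" using \<open>C \<ge> 0\<close> by (simp add: add_pos_nonneg)
    have "Inf (S x) / (1 + C * dist x z) \<le> Inf (S z)"
    proof (rule cInf_greatest[OF ne[OF z]])
      fix \<tau> assume "\<tau> \<in> S z"
      then have "Inf (S x) \<le> (1 + C * dist x z) * \<tau>"
        using scale[OF x z] bdd by (intro cInf_lower)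
      then show "Inf (S x) / (1 + C * dist x z) \<le> \<tau>"
        using pos by (simp add: pos_divide_le_eq mult.commute)
    qed
    then show ?thesis using pos by (simp add: pos_divide_le_eq mult.commute)
  qed
  define m where "m = (1 + C * (2 * \<delta>)) * Inf (S a)"
  have m: "Inf (S x) \<le> m" if x: "x \<in> ball x0 \<delta>" for x
  proof -
    have "dist x a \<le> 2 * \<delta>"
      using x a(1) dist_triangle2[of x a x0] by (simp add: dist_commute)
    then have "(1 + C * dist x a) * Inf (S a) \<le> m"
      unfolding m_def using \<open>C \<ge> 0\<close> nonneg[OF a(1)] by (intro mult_right_mono add_left_mono mult_left_mono) auto
    then show ?thesis using le[OF x a(1)] by linarith
  qed
  have "m \<ge> 0" using m[OF a(1)] nonneg[OF a(1)] by linarith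
  have one: "Inf (S x) - Inf (S z) \<le> C * m * dist x z" if x: "x \<in> ball x0 \<delta>" and z: "z \<in> ball x0 \<delta>" for x z
  proof -
    have "Inf (S x) - Inf (S z) \<le> C * dist x z * Inf (S z)"
      using le[OF x z] by (simp add: algebra_simps)
    also have "\<dots> \<le> C * dist x z * m"
      using m[OF z] \<open>C \<ge> 0\<close> by (intro mult_left_mono) auto
    finally show ?thesis by (simp add: mult_ac)
  qed
  have "(C * m)-lipschitz_on (ball x0 \<delta>) (\<lambda>x. Inf (S x))"
  proof (rule lipschitz_onI)
    show "dist (Inf (S x)) (Inf (S z)) \<le> C * m * dist x z"
      if "x \<in> ball x0 \<delta>" "z \<in> ball x0 \<delta>" for x z
      using one[OF that] one[OF that(2,1)] by (simp add: dist_real_def abs_le_iff dist_commute)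
  qed (use \<open>C \<ge> 0\<close> \<open>m \<ge> 0\<close> in simp)
  then show ?thesis by blast
qed

text \<open>The common core of both regular cases. \<open>N\<close> annihilates all the fields, and
  \<open>\<rho>\<close> is a bounded right inverse that recovers a control from any velocity in the
  kernel of \<open>N\<close>. An image \<open>\<phi> p\<close> is located through its displacement
  alone, which is at most \<open>r\<close>; hence the ball of radius \<open>2 * r\<close>.\<close>

lemma min_time_locally_lipschitz:
  fixes f :: "'m::finite \<Rightarrow> real^3 \<Rightarrow> real^3" and X :: "3 \<Rightarrow> real^3 \<Rightarrow> real^3"
    and N :: "real^3 \<Rightarrow> real^3" and \<rho> :: "'m \<Rightarrow> real^3 \<Rightarrow> real^3"
  assumes f: "\<And>i. Ck (Suc 0) (f i)"
    and r: "r > 0" "cball x0 r \<inter> K = {}"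
    and X: "\<And>i. Ck (Suc (Suc 0)) (X i)" and supp: "\<And>i. \<forall>p. p \<notin> cball x0 r \<longrightarrow> X i p = 0"
    and indep: "X 1 x0 \<bullet> cross3 (X 2 x0) (X 3 x0) \<noteq> 0"
    and N: "\<And>p. N differentiable at p"
    and pres: "\<And>i p v. \<bar>frechet_derivative N (at p) (X i p) \<bullet> v + N p \<bullet> frechet_derivative (X i) (at p) v\<bar>
      \<le> \<Lambda> * \<bar>N p \<bullet> v\<bar>"
    and "\<Lambda> \<ge> 0"
    and Nf: "\<And>i p. N p \<bullet> f i p = 0"
    and \<rho>m: "\<And>i. \<rho> i \<in> borel_measurable borel"
    and \<rho>b: "\<And>i q. q \<in> cball x0 (2 * r) \<Longrightarrow> norm (\<rho> i q) \<le> R"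
    and \<rho>: "\<And>q d. \<lbrakk>q \<in> cball x0 (2 * r); N q \<bullet> d = 0\<rbrakk> \<Longrightarrow> (\<Sum>i\<in>UNIV. (\<rho> i q \<bullet> d) *\<^sub>R f i q) = d"
  shows "\<exists>U. open U \<and> x0 \<in> U \<and> U \<subseteq> - K \<and> (\<exists>L. L-lipschitz_on U (min_time f K))"
proof -
  have contf: "continuous_on S (f i)" for S i by (rule Ck_continuous[OF f])
  have "\<exists>F>0. (\<forall>p\<in>cball x0 (2 * r). norm (f i p) \<le> F) \<and>
      (\<forall>p\<in>cball x0 (2 * r). \<forall>q\<in>cball x0 (2 * r). norm (f i p - f i q) \<le> F * norm (p - q))" for i
  proof -
    obtain B1 where B1: "B1 > 0" "\<forall>p\<in>cball x0 (2 * r). norm (f i p) \<le> B1"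
      using compact_imp_bounded[OF compact_continuous_image[OF contf compact_cball]]
      unfolding bounded_pos by blast
    obtain B2 where B2: "B2 > 0"
      "\<forall>p\<in>cball x0 (2 * r). \<forall>v. norm (frechet_derivative (f i) (at p) v) \<le> B2 * norm v"
      using Ck_1_derivative_bounded_on_compact[OF f compact_cball] by blast
    have "norm (f i p - f i q) \<le> B2 * norm (p - q)" if "p \<in> cball x0 (2 * r)" "q \<in> cball x0 (2 * r)" for p q
      by (rule differentiable_bound[OF convex_cball, of x0 "2 * r" "f i" "\<lambda>p. frechet_derivative (f i) (at p)"])
        (use that B2 Ck_has_derivative[OF f] in \<open>auto intro!: onorm_le intro: has_derivative_at_withinI\<close>)
    note lip = this
    have le: "B2 * norm (p - q) \<le> (B1 + B2) * norm (p - q)" for p q :: "real^3"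
      using B1(1) by (intro mult_right_mono) auto
    show ?thesis
    proof (intro exI[of _ "B1 + B2"] conjI ballI)
      show "B1 + B2 > 0" using B1(1) B2(1) by simp
      show "norm (f i p) \<le> B1 + B2" if "p \<in> cball x0 (2 * r)" for p
        using bspec[OF B1(2) that] B2(1) by linarith
      show "norm (f i p - f i q) \<le> (B1 + B2) * norm (p - q)"
        if "p \<in> cball x0 (2 * r)" "q \<in> cball x0 (2 * r)" for p q
        by (rule order_trans[OF lip[OF that] le])
    qed
  qed
  then obtain Fi where "\<forall>i. Fi i > 0 \<and> (\<forall>p\<in>cball x0 (2 * r). norm (f i p) \<le> Fi i) \<and>
      (\<forall>p\<in>cball x0 (2 * r). \<forall>q\<in>cball x0 (2 * r). norm (f i p - f i q) \<le> Fi i * norm (p - q))"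
    using choice[of "\<lambda>i F. F > 0 \<and> (\<forall>p\<in>cball x0 (2 * r). norm (f i p) \<le> F) \<and>
      (\<forall>p\<in>cball x0 (2 * r). \<forall>q\<in>cball x0 (2 * r). norm (f i p - f i q) \<le> F * norm (p - q))"] by blast
  then have Fi: "\<And>i. Fi i > 0" "\<And>i p. p \<in> cball x0 (2 * r) \<Longrightarrow> norm (f i p) \<le> Fi i"
    "\<And>i p q. \<lbrakk>p \<in> cball x0 (2 * r); q \<in> cball x0 (2 * r)\<rbrakk> \<Longrightarrow> norm (f i p - f i q) \<le> Fi i * norm (p - q)"
    by blast+
  define F where "F = (\<Sum>i\<in>UNIV. Fi i)"
  have FiF: "Fi i \<le> F" for i
    using member_le_sum[of i UNIV Fi] Fi(1) unfolding F_def by (simp add: less_imp_le)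
  have "F \<ge> 0" using FiF[of undefined] Fi(1)[of undefined] by linarith
  have Fb: "norm (f i p) \<le> F" if "p \<in> cball x0 (2 * r)" for i p
    by (rule order_trans[OF Fi(2)[OF that] FiF])
  have FL: "norm (f i p - f i q) \<le> F * norm (p - q)" if "p \<in> cball x0 (2 * r)" "q \<in> cball x0 (2 * r)" for i p q
    by (rule order_trans[OF Fi(3)[OF that] mult_right_mono[OF FiF norm_ge_zero]])
  have "R \<ge> 0" by (rule order_trans[OF norm_ge_zero \<rho>b[of x0 undefined]]) (use r(1) in simp)
  from local_diffeomorphisms[OF X supp indep N pres \<open>\<Lambda> \<ge> 0\<close>] obtain \<delta>1 C where \<delta>1: "\<delta>1 > 0" and C: "C > 0"
    and diffeo: "\<forall>x\<in>ball x0 \<delta>1. \<forall>z\<in>ball x0 \<delta>1. \<exists>\<phi> D.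
      \<phi> z = x \<and> (\<forall>p. (\<phi> has_derivative D p) (at p)) \<and>
      (\<forall>p. norm (\<phi> p - p) \<le> C * norm (x - z)) \<and>
      (\<forall>p v. norm (D p v - v) \<le> C * norm (x - z) * norm v) \<and>
      (\<forall>p. p \<notin> cball x0 r \<longrightarrow> \<phi> p = p) \<and>
      (\<forall>p v. N p \<bullet> v = 0 \<longrightarrow> N (\<phi> p) \<bullet> D p v = 0)"
    by (elim exE conjE)
  \<comment> \<open>Then |x - z| \<le> 2 \<delta> \<le> r / C, which bounds the displacement C |x -
    z| by r.\<close>
  define \<delta> where "\<delta> = min \<delta>1 (min r (r / (2 * C)))"
  have \<delta>: "\<delta> > 0" using \<delta>1 r(1) C by (simp add: \<delta>_def)
  \<comment> \<open>Each of the CARD('m) terms of the defect is at most 2 C F |x - z| |v|: one C F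
    from the derivative of \<phi>, one from the change of base point of the field. Applying \<rho>
    costs R in each of the CARD('m) components.\<close>
  define C' where "C' = real CARD('m) * (R * (real CARD('m) * (2 * C * F)))"
  have "C' \<ge> 0" using C \<open>F \<ge> 0\<close> \<open>R \<ge> 0\<close> by (simp add: C'_def)
  define S where "S x = {t. t \<ge> 0 \<and> (\<exists>u\<in>controls. \<exists>y. trajectory_on f u x t y \<and> y t \<in> K)}" for x
  have "(1 + C' * dist x z) * \<tau> \<in> S x" if x: "x \<in> ball x0 \<delta>" and z: "z \<in> ball x0 \<delta>" and "\<tau> \<in> S z" for x z \<tau>
  proof -
    from \<open>\<tau> \<in> S z\<close> obtain u y where \<tau>: "\<tau> \<ge> 0" and u: "u \<in> controls" and y: "trajectory_on f u z \<tau> y" "y \<tau> \<in> K"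
      by (auto simp: S_def)
    have "x \<in> ball x0 \<delta>1" "z \<in> ball x0 \<delta>1" using x z by (auto simp: \<delta>_def)
    from bspec[OF bspec[OF diffeo this(1)] this(2)] obtain \<phi> D where \<phi>z: "\<phi> z = x"
      and \<phi>: "\<And>p. (\<phi> has_derivative D p) (at p)"
      and near: "\<And>p. norm (\<phi> p - p) \<le> C * norm (x - z)"
      and Dnear: "\<And>p v. norm (D p v - v) \<le> C * norm (x - z) * norm v"
      and \<phi>id: "\<And>p. p \<notin> cball x0 r \<Longrightarrow> \<phi> p = p"
      and inv: "\<And>p v. N p \<bullet> v = 0 \<Longrightarrow> N (\<phi> p) \<bullet> D p v = 0"
      by blast
    have linD: "bounded_linear (D p)" for p using \<phi> by (rule has_derivative_bounded_linear)
    have "dist x z \<le> 2 * \<delta>"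
      using x z dist_triangle2[of x z x0] by (simp add: dist_commute)
    also have "\<dots> \<le> 2 * (r / (2 * C))" by (simp add: \<delta>_def)
    finally have Cr: "C * norm (x - z) \<le> r"
      using C by (simp add: dist_norm field_simps)
    have Did: "D p v = v" if p: "p \<notin> cball x0 r" for p v
    proof -
      have "(\<phi> has_derivative (\<lambda>v. v)) (at p)"
        by (rule has_derivative_transform_within_open[OF has_derivative_ident, of "- cball x0 r"])
          (use p \<phi>id in auto)
      then show ?thesis using has_derivative_unique[OF \<phi>] by metis
    qed
    have ball: "\<phi> p \<in> cball x0 (2 * r)" "p \<in> cball x0 (2 * r)" if p: "p \<in> cball x0 r" for p
    proof -
      have "dist x0 (\<phi> p) \<le> dist x0 p + dist p (\<phi> p)" by (rule dist_triangle)
      also have "\<dots> \<le> r + r"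
        using p near[of p] Cr by (intro add_mono) (auto simp: dist_norm norm_minus_commute)
      finally show "\<phi> p \<in> cball x0 (2 * r)" by simp
      show "p \<in> cball x0 (2 * r)" using p r(1) by simp
    qed
    \<comment> \<open>The defect: the velocity transported by \<open>D p\<close>, minus the velocity
      that the same control produces at the image point. Adding its coordinates to the identity
      gives \<open>W\<close>, so \<open>W\<close> corrects exactly this error.\<close>
    define d where "d p v = (\<Sum>j\<in>UNIV. v $ j *\<^sub>R (D p (f j p) - f j (\<phi> p)))" for p and v :: "real^'m"
    define W :: "real^3 \<Rightarrow> real^'m^'m" where
      "W p = (\<chi> i j. (if i = j then 1 else 0) + \<rho> i (\<phi> p) \<bullet> (D p (f j p) - f j (\<phi> p)))" for p
    have Wv: "(W p *v v) $ i = v $ i + \<rho> i (\<phi> p) \<bullet> d p v" for p v i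
    proof -
      have "(W p *v v) $ i = (\<Sum>j\<in>UNIV. (if i = j then v $ j else 0) +
          \<rho> i (\<phi> p) \<bullet> (v $ j *\<^sub>R (D p (f j p) - f j (\<phi> p))))"
        unfolding W_def matrix_vector_mult_def by (auto intro!: sum.cong simp: algebra_simps)
      then show ?thesis by (simp add: sum.distrib d_def inner_sum_right)
    qed
    have d_eq: "D p (\<Sum>j\<in>UNIV. v $ j *\<^sub>R f j p) = d p v + (\<Sum>j\<in>UNIV. v $ j *\<^sub>R f j (\<phi> p))" for p v
    proof -
      interpret bounded_linear "D p" by (rule linD)
      show ?thesis by (simp add: d_def sum scaleR scaleR_diff_right sum_subtractf)
    qed
    have d0: "d p v = 0" if "p \<notin> cball x0 r" for p v
      by (simp add: d_def Did[OF that] \<phi>id[OF that])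
    have d_bd: "norm (d p v) \<le> real CARD('m) * (2 * C * F) * norm (x - z) * norm v" for p v
    proof (cases "p \<in> cball x0 r")
      case True
      have "norm (d p v) \<le> (\<Sum>j\<in>(UNIV::'m set). (2 * C * F) * norm (x - z) * norm v)"
        unfolding d_def
      proof (rule sum_norm_le)
        fix j
        have "norm (D p (f j p) - f j p) \<le> C * norm (x - z) * F"
          by (rule order_trans[OF Dnear mult_left_mono[OF Fb[OF ball(2)[OF True]]]]) (use C in simp)
        moreover have "norm (f j p - f j (\<phi> p)) \<le> F * (C * norm (x - z))"
          using FL[OF ball(2)[OF True] ball(1)[OF True], of j] mult_left_mono[OF near[of p] \<open>F \<ge> 0\<close>]
          by (simp add: norm_minus_commute)
        ultimately have "norm (D p (f j p) - f j (\<phi> p)) \<le> 2 * C * F * norm (x - z)"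
          using norm_triangle_ineq[of "D p (f j p) - f j p" "f j p - f j (\<phi> p)"] by (simp add: mult_ac)
        then have "\<bar>v $ j\<bar> * norm (D p (f j p) - f j (\<phi> p)) \<le> norm v * (2 * C * F * norm (x - z))"
          by (intro mult_mono component_le_norm_cart) auto
        then show "norm (v $ j *\<^sub>R (D p (f j p) - f j (\<phi> p))) \<le> 2 * C * F * norm (x - z) * norm v"
          by (simp add: mult_ac)
      qed
      then show ?thesis by (simp add: mult_ac)
    next
      case False
      then show ?thesis using C \<open>F \<ge> 0\<close> by (simp add: d0)
    qed
    have "\<exists>u'\<in>controls. \<exists>y'. trajectory_on f u' (\<phi> z) ((1 + C' * dist x z) * \<tau>) y' \<and>
        y' ((1 + C' * dist x z) * \<tau>) \<in> K"
    proof (rule transport_trajectory[OF u y(1) \<tau> y(2) \<phi>, where L="1 + C * norm (x - z)" and W=W])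
      show "1 + C' * dist x z \<ge> 1" using \<open>C' \<ge> 0\<close> by simp
      show "1 + C * norm (x - z) > 0" using C by (simp add: add_pos_nonneg)
      show "dist (\<phi> p) (\<phi> q) \<le> (1 + C * norm (x - z)) * dist p q" for p q
        unfolding dist_norm
      proof (rule differentiable_bound[of UNIV \<phi> D])
        show "onorm (D p) \<le> 1 + C * norm (x - z)" for p
        proof (rule onorm_le)
          fix v
          show "norm (D p v) \<le> (1 + C * norm (x - z)) * norm v"
            using Dnear[of p v] norm_triangle_ineq[of "D p v - v" v] by (simp add: algebra_simps)
        qed
      qed (auto intro: \<phi>)
      show "\<phi> p = p" if "p \<in> K" for p using \<phi>id that r(2) by blast
      show "(\<lambda>p. W p $ i $ j) \<in> borel_measurable borel" for i j
      proof -
        have "continuous_on UNIV \<phi>"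
          using has_derivative_continuous[OF \<phi>] by (intro continuous_at_imp_continuous_on) blast
        then have m\<phi>: "\<phi> \<in> borel_measurable borel" by (rule borel_measurable_continuous_onI)
        have mf: "f j \<in> borel_measurable borel" by (rule borel_measurable_continuous_onI[OF contf])
        have "D p (f j p) = (\<Sum>b\<in>Basis. (f j p \<bullet> b) *\<^sub>R D p b)" for p
        proof -
          interpret bounded_linear "D p" by (rule linD)
          show ?thesis
            by (subst euclidean_representation[of "f j p", symmetric], subst sum) (simp add: scaleR)
        qed
        moreover have "(\<lambda>p. \<Sum>b\<in>Basis. (f j p \<bullet> b) *\<^sub>R D p b) \<in> borel_measurable borel"
          by (intro borel_measurable_sum borel_measurable_scaleR borel_measurable_inner
              borel_measurable_const mf derivative_borel_measurable[OF \<phi>])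
        ultimately have "(\<lambda>p. D p (f j p)) \<in> borel_measurable borel" by simp
        moreover have "(\<lambda>p. f j (\<phi> p)) \<in> borel_measurable borel" "(\<lambda>p. \<rho> i (\<phi> p)) \<in> borel_measurable borel"
          using measurable_compose[OF m\<phi> mf] measurable_compose[OF m\<phi> \<rho>m] by auto
        ultimately show ?thesis
          unfolding W_def by simp
      qed
      show "norm (W p *v v) \<le> (1 + C' * dist x z) * norm v" for p v
      proof (cases "p \<in> cball x0 r")
        case True
        have "W p *v v = v + (\<chi> i. \<rho> i (\<phi> p) \<bullet> d p v)"
          by (simp add: vec_eq_iff Wv)
        then have "norm (W p *v v) \<le> norm v + norm ((\<chi> i. \<rho> i (\<phi> p) \<bullet> d p v) :: real^'m)"
          by (simp add: norm_triangle_ineq)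
        also have "norm ((\<chi> i. \<rho> i (\<phi> p) \<bullet> d p v) :: real^'m) \<le> (\<Sum>i\<in>UNIV. \<bar>\<rho> i (\<phi> p) \<bullet> d p v\<bar>)"
          using norm_le_l1_cart[of "(\<chi> i. \<rho> i (\<phi> p) \<bullet> d p v) :: real^'m"] by simp
        also have "\<dots> \<le> (\<Sum>i\<in>(UNIV::'m set). R * (real CARD('m) * (2 * C * F) * norm (x - z) * norm v))"
        proof (rule sum_mono)
          fix i
          have "\<bar>\<rho> i (\<phi> p) \<bullet> d p v\<bar> \<le> norm (\<rho> i (\<phi> p)) * norm (d p v)" by (rule Cauchy_Schwarz_ineq2)
          also have "\<dots> \<le> R * (real CARD('m) * (2 * C * F) * norm (x - z) * norm v)"
            using \<rho>b[OF ball(1)[OF True]] d_bd \<open>R \<ge> 0\<close> by (intro mult_mono) auto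
          finally show "\<bar>\<rho> i (\<phi> p) \<bullet> d p v\<bar> \<le> \<dots>" .
        qed
        also have "\<dots> = C' * dist x z * norm v"
          by (simp add: C'_def dist_norm mult_ac)
        finally show ?thesis by (simp add: algebra_simps)
      next
        case False
        then have "W p *v v = v" by (simp add: vec_eq_iff Wv d0)
        then show ?thesis using \<open>C' \<ge> 0\<close> by (simp add: algebra_simps)
      qed
      show "(\<Sum>i\<in>UNIV. (W p *v v) $ i *\<^sub>R f i (\<phi> p)) = D p (\<Sum>i\<in>UNIV. v $ i *\<^sub>R f i p)" for p v
      proof -
        have "(\<Sum>i\<in>UNIV. (\<rho> i (\<phi> p) \<bullet> d p v) *\<^sub>R f i (\<phi> p)) = d p v"
        proof (cases "p \<in> cball x0 r")
          case True
          \<comment> \<open>The transported velocity is annihilated by \<open>N (\<phi> p)\<close>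
            by invariance, the velocities of the fields at \<open>\<phi> p\<close> by
            \<open>Nf\<close>; hence the defect is too, and \<open>\<rho>\<close> can resolve
            it.\<close>
          have "N p \<bullet> (\<Sum>j\<in>UNIV. v $ j *\<^sub>R f j p) = 0"
            by (simp add: inner_sum_right Nf)
          from inv[OF this] have "N (\<phi> p) \<bullet> d p v = 0"
            by (simp add: d_eq inner_add_right inner_sum_right Nf)
          then show ?thesis by (rule \<rho>[OF ball(1)[OF True]])
        qed (simp add: d0)
        then show ?thesis by (simp add: Wv d_eq scaleR_add_left sum.distrib)
      qed
    qed
    then show ?thesis using \<tau> \<open>C' \<ge> 0\<close> by (simp add: S_def \<phi>z)
  qed
  then have "\<exists>L. L-lipschitz_on (ball x0 \<delta>) (\<lambda>x. Inf (S x))"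
    using \<open>C' \<ge> 0\<close> by (intro Inf_lipschitz_of_scaling[where C=C']) (auto simp: S_def)
  moreover have "min_time f K = (\<lambda>x. Inf (S x))"
    by (simp add: fun_eq_iff min_time_def S_def)
  moreover have "ball x0 \<delta> \<subseteq> cball x0 r"
    by (auto simp: \<delta>_def)
  then have "ball x0 \<delta> \<subseteq> - K"
    using r(2) by blast
  ultimately show ?thesis
    using \<delta> by (intro exI[of _ "ball x0 \<delta>"]) simp
qed

subsection \<open>Local Lipschitz regularity\<close>

lemma Ck_cross: "Ck k f \<Longrightarrow> Ck k g \<Longrightarrow> Ck k (\<lambda>x. cross3 (f x) (g x))"
  by (rule bounded_bilinear.Ck[OF bilinear_conv_bounded_bilinear[THEN iffD1, OF bilinear_cross]])

lemma finite_family_bounded_on_compact: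
  fixes \<rho> :: "'m::finite \<Rightarrow> 'a::topological_space \<Rightarrow> 'b::real_normed_vector"
  assumes "compact S" "\<And>i. continuous_on S (\<rho> i)"
  shows "\<exists>R. \<forall>i. \<forall>q\<in>S. norm (\<rho> i q) \<le> R"
proof -
  have "bounded (\<Union>i. \<rho> i ` S)"
    using assms by (auto intro!: compact_imp_bounded compact_continuous_image)
  then show ?thesis unfolding bounded_iff by blast
qed

text \<open>With \<open>N = 0\<close> the invariance condition is vacuous, so cut-off constant
  fields can serve as \<open>X\<close>. The right inverse is the dual basis of the three independent
  fields, extended by zero to the other indices.\<close>

lemma min_time_locally_lipschitz_rank3:
  fixes f :: "'m::finite \<Rightarrow> real^3 \<Rightarrow> real^3"
  assumes f: "\<And>i. Ck (Suc 0) (f i)" and K: "closed K" "x0 \<notin> K"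
    and det: "f i x0 \<bullet> cross3 (f j x0) (f k x0) \<noteq> 0"
  shows "\<exists>U. open U \<and> x0 \<in> U \<and> U \<subseteq> - K \<and> (\<exists>L. L-lipschitz_on U (min_time f K))"
proof -
  define \<Delta> where "\<Delta> p = f i p \<bullet> cross3 (f j p) (f k p)" for p
  have contf: "continuous_on S (f i)" for S i by (rule Ck_continuous[OF f])
  have cont\<Delta>: "continuous_on S \<Delta>" for S
    unfolding \<Delta>_def[abs_def] by (intro continuous_intros continuous_on_cross contf)
  have "open ({p. \<Delta> p \<noteq> 0} \<inter> - K)"
    using K(1) by (intro open_Int open_Collect_neq cont\<Delta> continuous_on_const) auto
  then obtain r' where r': "r' > 0" "cball x0 r' \<subseteq> {p. \<Delta> p \<noteq> 0} \<inter> - K"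
    using K(2) det unfolding open_contains_cball \<Delta>_def by blast
  define r where "r = r' / 2"
  have r: "r > 0" "cball x0 r \<inter> K = {}" and \<Delta>: "\<And>p. p \<in> cball x0 (2 * r) \<Longrightarrow> \<Delta> p \<noteq> 0"
  proof -
    have "cball x0 r \<subseteq> cball x0 r'" "2 * r = r'" using r'(1) by (auto simp: r_def)
    then show "cball x0 r \<inter> K = {}" "\<And>p. p \<in> cball x0 (2 * r) \<Longrightarrow> \<Delta> p \<noteq> 0"
      using r'(2) by auto
  qed (use r'(1) in \<open>simp add: r_def\<close>)
  define \<rho> where "\<rho> l p = (if l = i then (1 / \<Delta> p) *\<^sub>R cross3 (f j p) (f k p)
    else if l = j then (1 / \<Delta> p) *\<^sub>R cross3 (f k p) (f i p)
    else if l = k then (1 / \<Delta> p) *\<^sub>R cross3 (f i p) (f j p) else 0)" for l p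
  \<comment> \<open>A repeated index would make the determinant vanish. Distinctness lets the nested
    case distinction in \<open>\<rho>\<close> pick the intended dual vector.\<close>
  have ne: "i \<noteq> j" "i \<noteq> k" "j \<noteq> k"
    using det by (auto simp: dot_cross_self)
  have "continuous_on (cball x0 (2 * r)) (\<rho> l)" for l
    unfolding \<rho>_def[abs_def]
    by (cases "l = i"; cases "l = j"; cases "l = k")
      (use \<Delta> ne in \<open>auto intro!: continuous_intros continuous_on_cross contf cont\<Delta>\<close>)
  then obtain R where R: "\<And>l q. q \<in> cball x0 (2 * r) \<Longrightarrow> norm (\<rho> l q) \<le> R"
    using finite_family_bounded_on_compact[OF compact_cball, of x0 "2 * r" \<rho>] by blast
  define X where "X l p = bump 2 x0 r p *\<^sub>R axis l (1::real)" for l :: 3 and p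
  show ?thesis
  proof (rule min_time_locally_lipschitz[OF f r, where X=X and N="\<lambda>p. 0" and \<Lambda>=0 and \<rho>=\<rho> and R=R])
    show "Ck (Suc (Suc 0)) (X l)" for l
      unfolding X_def[abs_def] by (intro Ck_scaleR Ck_const Ck_bump) simp
    show "\<forall>p. p \<notin> cball x0 r \<longrightarrow> X l p = 0" for l
      by (intro allI impI) (simp add: X_def bump_eq_0[OF _ less_imp_le[OF r(1)]])
    have "bump 2 x0 r x0 \<noteq> 0" using r(1) by (simp add: bump_def)
    then show "X 1 x0 \<bullet> cross3 (X 2 x0) (X 3 x0) \<noteq> 0"
      by (simp add: X_def cross_mult_left cross_mult_right cross_basis inner_axis_axis)
    show "\<rho> l \<in> borel_measurable borel" for l
    proof -
      have [measurable]: "f l \<in> borel_measurable borel" "\<Delta> \<in> borel_measurable borel"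
          "(\<lambda>p. cross3 (f l p) (f l' p)) \<in> borel_measurable borel" for l l'
        by (intro borel_measurable_continuous_onI contf cont\<Delta> continuous_on_cross)+
      show ?thesis
        unfolding \<rho>_def[abs_def] by (cases "l = i"; cases "l = j"; cases "l = k") (use ne in simp_all)
    qed
    show "norm (\<rho> l q) \<le> R" if "q \<in> cball x0 (2 * r)" for l q by (rule R[OF that])
    show "(\<Sum>l\<in>UNIV. (\<rho> l q \<bullet> d) *\<^sub>R f l q) = d" if q: "q \<in> cball x0 (2 * r)" for q d
    proof -
      have "(\<Sum>l\<in>UNIV. (\<rho> l q \<bullet> d) *\<^sub>R f l q) = (\<Sum>l\<in>{i, j, k}. (\<rho> l q \<bullet> d) *\<^sub>R f l q)"
        by (rule sum.mono_neutral_right) (auto simp: \<rho>_def)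
      also have "\<dots> = (\<rho> i q \<bullet> d) *\<^sub>R f i q + (\<rho> j q \<bullet> d) *\<^sub>R f j q + (\<rho> k q \<bullet> d) *\<^sub>R f k q"
        using ne by (simp add: add.assoc)
      also have "\<dots> = d"
        using cross_dual_basis[of "f i q" "f j q" "f k q" d] \<Delta>[OF q] ne by (simp add: \<rho>_def \<Delta>_def)
      finally show ?thesis .
    qed
  qed (simp_all add: frechet_derivative_const)
qed

section \<open>Contact fields generated by functions\<close>

locale contact_frame =
  fixes F G :: "real^3 \<Rightarrow> real^3"
  assumes smooth: "\<And>k. Ck k F" "\<And>k. Ck k G"
begin

definition N :: "real^3 \<Rightarrow> real^3" where "N p = cross3 (F p) (G p)"

definition Z :: "real^3 \<Rightarrow> real^3" where "Z = lie_bracket F G"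

definition \<mu> :: "real^3 \<Rightarrow> real" where "\<mu> p = N p \<bullet> Z p"

text \<open>The \<open>Z\<close>-component of the field. Its factor \<mu> clears denominators:
  solving for the other coefficients would divide by \<mu>, and \<open>H / \<mu>\<close> is just
  \<open>h\<close>. So the field is smooth also where \<mu> vanishes.\<close>

definition H :: "(real^3 \<Rightarrow> real) \<Rightarrow> real^3 \<Rightarrow> real" where "H h p = \<mu> p * h p"

text \<open>For X = H Z + a F + b G, invariance requires [X, F] and [X, G] to have no normal
  component. Modulo the plane these are H [Z, F] - F(H) Z - b Z and H [Z, G] - G(H) Z + a Z. Pairing
  with \<open>N\<close> and dividing by \<mu> gives a = \<open>coefF\<close> and b =
  \<open>coefG\<close>.\<close>

definition coefF :: "(real^3 \<Rightarrow> real) \<Rightarrow> real^3 \<Rightarrow> real" where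
  "coefF h p = frechet_derivative (H h) (at p) (G p) - h p * (N p \<bullet> lie_bracket Z G p)"

definition coefG :: "(real^3 \<Rightarrow> real) \<Rightarrow> real^3 \<Rightarrow> real" where
  "coefG h p = h p * (N p \<bullet> lie_bracket Z F p) - frechet_derivative (H h) (at p) (F p)"

definition field :: "(real^3 \<Rightarrow> real) \<Rightarrow> real^3 \<Rightarrow> real^3" where
  "field h p = H h p *\<^sub>R Z p + coefF h p *\<^sub>R F p + coefG h p *\<^sub>R G p"

lemma N_smooth: "Ck k N"
  unfolding N_def[abs_def] by (intro Ck_cross smooth)

lemma Z_smooth: "Ck k Z"
  unfolding Z_def by (intro Ck_lie_bracket smooth)

lemma \<mu>_smooth: "Ck k \<mu>"
  unfolding \<mu>_def[abs_def] by (intro Ck_inner N_smooth Z_smooth)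

lemma H_Ck: "Ck k h \<Longrightarrow> Ck k (H h)"
  unfolding H_def[abs_def] by (intro Ck_mult \<mu>_smooth)

lemma coef_Ck:
  assumes "Ck (Suc k) h"
  shows "Ck k (coefF h)" "Ck k (coefG h)"
  unfolding coefF_def[abs_def] coefG_def[abs_def]
  by (intro Ck_diff Ck_frechet_derivative H_Ck assms smooth Ck_mult Ck_SucD[OF assms] Ck_inner
      N_smooth Ck_lie_bracket Z_smooth)+

lemma field_Ck: "Ck (Suc k) h \<Longrightarrow> Ck k (field h)"
  unfolding field_def[abs_def]
  by (intro Ck_add Ck_scaleR coef_Ck smooth Z_smooth H_Ck Ck_SucD[of k h])

lemma field_support:
  assumes "\<forall>p. p \<notin> cball x0 r \<longrightarrow> h p = 0"
  shows "\<forall>p. p \<notin> cball x0 r \<longrightarrow> field h p = 0"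
proof (intro allI impI)
  fix p assume p: "p \<notin> cball x0 r"
  have "\<forall>p. p \<notin> cball x0 r \<longrightarrow> H h p = 0" using assms by (simp add: H_def)
  from compact_support_derivative[OF this p] this show "field h p = 0"
    using assms p by (simp add: field_def coefF_def coefG_def)
qed

lemma derivative: "(F has_derivative frechet_derivative F (at p)) (at p)"
    "(G has_derivative frechet_derivative G (at p)) (at p)"
    "(N has_derivative frechet_derivative N (at p)) (at p)"
    "(Z has_derivative frechet_derivative Z (at p)) (at p)"
  by (rule Ck_has_derivative[of 0], intro smooth N_smooth Z_smooth)+

lemma N_orthogonal: "N p \<bullet> F p = 0" "N p \<bullet> G p = 0"
  by (simp_all add: N_def inner_commute dot_cross_self)

lemma orthogonal_derivative:
  assumes "\<And>q. N q \<bullet> g q = 0" "g differentiable at p"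
  shows "frechet_derivative N (at p) w \<bullet> g p = - (N p \<bullet> frechet_derivative g (at p) w)"
proof -
  have "((\<lambda>q. N q \<bullet> g q) has_derivative
      (\<lambda>w. N p \<bullet> frechet_derivative g (at p) w + frechet_derivative N (at p) w \<bullet> g p)) (at p)"
    using assms(2) by (intro has_derivative_inner derivative) (simp add: frechet_derivative_works[symmetric])
  then have "((\<lambda>q. 0) has_derivative
      (\<lambda>w. N p \<bullet> frechet_derivative g (at p) w + frechet_derivative N (at p) w \<bullet> g p)) (at p)"
    by (simp only: assms(1))
  from has_derivative_unique[OF this has_derivative_const]
  have "N p \<bullet> frechet_derivative g (at p) w + frechet_derivative N (at p) w \<bullet> g p = 0"
    by (rule fun_cong)
  then show ?thesis by simp
qed

text \<open>The Lie derivative along \<open>field h\<close> of the 1-form v \<mapsto> N . v,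
  evaluated at \<open>v\<close>. The kernel of the form is invariant under the flow once this is a
  bounded multiple of the form itself.\<close>

definition \<beta> :: "(real^3 \<Rightarrow> real) \<Rightarrow> real^3 \<Rightarrow> real^3 \<Rightarrow> real" where
  "\<beta> h p v = frechet_derivative N (at p) (field h p) \<bullet> v + N p \<bullet> frechet_derivative (field h) (at p) v"

lemma inner_field_derivative:
  assumes h: "Ck (Suc (Suc 0)) h"
  shows "N p \<bullet> frechet_derivative (field h) (at p) v =
    frechet_derivative (H h) (at p) v * \<mu> p + H h p * (N p \<bullet> frechet_derivative Z (at p) v)
    + coefF h p * (N p \<bullet> frechet_derivative F (at p) v) + coefG h p * (N p \<bullet> frechet_derivative G (at p) v)"
proof -
  have h1: "Ck (Suc 0) h" using h by (rule Ck_SucD)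
  have "(field h has_derivative (\<lambda>v.
      (H h p *\<^sub>R frechet_derivative Z (at p) v + frechet_derivative (H h) (at p) v *\<^sub>R Z p) +
      (coefF h p *\<^sub>R frechet_derivative F (at p) v + frechet_derivative (coefF h) (at p) v *\<^sub>R F p) +
      (coefG h p *\<^sub>R frechet_derivative G (at p) v + frechet_derivative (coefG h) (at p) v *\<^sub>R G p))) (at p)"
    unfolding field_def[abs_def]
    by (intro has_derivative_add has_derivative_scaleR derivative
        Ck_has_derivative[OF H_Ck[OF h1]] Ck_has_derivative[OF coef_Ck(1)[OF h]] Ck_has_derivative[OF coef_Ck(2)[OF h]])
  from frechet_derivative_at[OF this, symmetric] show ?thesis
    by (simp add: inner_add_right N_orthogonal \<mu>_def mult.commute)
qed

text \<open>Since N . F is identically zero, \<beta> on \<open>F\<close> is minus the normal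
  component of [field h, F], which \<open>coefG\<close> cancels; on \<open>G\<close> the same is
  done by \<open>coefF\<close>.\<close>

lemma \<beta>_frame:
  assumes h: "Ck (Suc (Suc 0)) h"
  shows "\<beta> h p (F p) = 0" "\<beta> h p (G p) = 0"
proof -
  interpret DF: bounded_linear "frechet_derivative F (at p)" using derivative(1) by (rule has_derivative_bounded_linear)
  interpret DG: bounded_linear "frechet_derivative G (at p)" using derivative(2) by (rule has_derivative_bounded_linear)
  have dF: "F differentiable at p" and dG: "G differentiable at p" using derivative differentiableI by blast+
  have Zp: "Z p = frechet_derivative G (at p) (F p) - frechet_derivative F (at p) (G p)"
    by (simp add: Z_def lie_bracket_def)
  show "\<beta> h p (F p) = 0"
    unfolding \<beta>_def orthogonal_derivative[OF N_orthogonal(1) dF] inner_field_derivative[OF h]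
    by (simp add: field_def DF.add DF.scaleR inner_add_right coefG_def lie_bracket_def[of Z] H_def
        inner_diff_right \<mu>_def) (simp add: Zp inner_diff_right algebra_simps)
  show "\<beta> h p (G p) = 0"
    unfolding \<beta>_def orthogonal_derivative[OF N_orthogonal(2) dG] inner_field_derivative[OF h]
    by (simp add: field_def DG.add DG.scaleR inner_add_right coefF_def lie_bracket_def[of Z] H_def
        inner_diff_right \<mu>_def) (simp add: Zp inner_diff_right algebra_simps)
qed

lemma frame_expansion:
  assumes "N p \<noteq> 0"
  shows "v = (((1 / (N p \<bullet> N p)) *\<^sub>R cross3 (G p) (N p)) \<bullet> v) *\<^sub>R F p +
    (((1 / (N p \<bullet> N p)) *\<^sub>R cross3 (N p) (F p)) \<bullet> v) *\<^sub>R G p + ((N p \<bullet> v) / (N p \<bullet> N p)) *\<^sub>R N p"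
proof -
  have "F p \<bullet> cross3 (G p) (N p) = N p \<bullet> N p"
    by (metis N_def cross_triple inner_commute)
  then show ?thesis
    using cross_dual_basis[of "F p" "G p" "N p" v] assms by (simp add: N_def[of p, symmetric])
qed

text \<open>A linear form that vanishes on \<open>F\<close> and \<open>G\<close> is a multiple of v
  \<mapsto> N . v, here with the factor \<beta>(N) / (N . N), which is continuous on the compact
  ball because \<open>N\<close> has no zero there. Off the ball the field and its derivative
  vanish.\<close>

lemma \<beta>_bound:
  assumes h: "Ck (Suc (Suc 0)) h" and supp: "\<forall>p. p \<notin> cball x0 r \<longrightarrow> h p = 0"
    and N: "\<And>p. p \<in> cball x0 r \<Longrightarrow> N p \<noteq> 0"
  shows "\<exists>\<Lambda>\<ge>0. \<forall>p v. \<bar>\<beta> h p v\<bar> \<le> \<Lambda> * \<bar>N p \<bullet> v\<bar>"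
proof -
  have fh: "Ck (Suc 0) (field h)" by (rule field_Ck[OF h])
  have lin: "linear (\<beta> h p)" for p
  proof -
    interpret bounded_linear "frechet_derivative (field h) (at p)"
      using Ck_has_derivative[OF fh] by (rule has_derivative_bounded_linear)
    show ?thesis
      by (rule linearI) (simp_all add: \<beta>_def inner_add_right add scaleR algebra_simps)
  qed
  have cont: "continuous_on (cball x0 r) (\<lambda>p. \<beta> h p (N p) / (N p \<bullet> N p))"
    unfolding \<beta>_def
    by (intro continuous_on_divide continuous_on_add continuous_on_inner Ck_continuous[OF N_smooth[of 0]]
        Ck_continuous[OF Ck_frechet_derivative[OF N_smooth Ck_SucD[OF fh]]]
        Ck_continuous[OF Ck_frechet_derivative[OF fh N_smooth]]) (use N in auto)
  obtain \<Lambda> where \<Lambda>: "\<Lambda> > 0" "\<And>p. p \<in> cball x0 r \<Longrightarrow> \<bar>\<beta> h p (N p) / (N p \<bullet> N p)\<bar> \<le> \<Lambda>"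
    using compact_imp_bounded[OF compact_continuous_image[OF cont compact_cball]]
    unfolding bounded_pos by (auto simp del: abs_divide)
  have "\<bar>\<beta> h p v\<bar> \<le> \<Lambda> * \<bar>N p \<bullet> v\<bar>" for p v
  proof (cases "p \<in> cball x0 r")
    case True
    interpret linear "\<beta> h p" by (rule lin)
    have "\<beta> h p v = (N p \<bullet> v) / (N p \<bullet> N p) * \<beta> h p (N p)"
      by (subst frame_expansion[OF N[OF True], of v]) (simp add: add scale \<beta>_frame[OF h])
    then have "\<bar>\<beta> h p v\<bar> = \<bar>\<beta> h p (N p) / (N p \<bullet> N p)\<bar> * \<bar>N p \<bullet> v\<bar>"
      by (simp add: abs_mult)
    also have "\<dots> \<le> \<Lambda> * \<bar>N p \<bullet> v\<bar>"
      using \<Lambda>(2)[OF True] by (intro mult_right_mono) auto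
    finally show ?thesis .
  next
    case False
    interpret bounded_linear "frechet_derivative N (at p)" using derivative(3) by (rule has_derivative_bounded_linear)
    show ?thesis
      using field_support[OF supp, rule_format, OF False] compact_support_derivative[OF field_support[OF supp] False]
        \<Lambda>(1) by (simp add: \<beta>_def zero)
  qed
  then show ?thesis using \<Lambda>(1) by (intro exI[of _ \<Lambda>]) simp
qed

text \<open>At a zero of \<open>h\<close> the field lies in the plane and is read off from the
  differential of \<open>h\<close>: prescribing the differential prescribes a tangent
  direction.\<close>

lemma field_at_zero:
  assumes "Ck (Suc 0) h" "h p = 0"
  shows "field h p = (\<mu> p * frechet_derivative h (at p) (G p)) *\<^sub>R F p - (\<mu> p * frechet_derivative h (at p) (F p)) *\<^sub>R G p"
proof -
  have "(H h has_derivative (\<lambda>v. \<mu> p * frechet_derivative h (at p) v + frechet_derivative \<mu> (at p) v * h p)) (at p)"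
    unfolding H_def[abs_def]
    by (intro has_derivative_mult Ck_has_derivative[OF assms(1)] Ck_has_derivative[OF \<mu>_smooth[of "Suc 0"]])
  from frechet_derivative_at[OF this, symmetric] show ?thesis
    using assms(2) by (simp add: field_def coefF_def coefG_def H_def)
qed

text \<open>Two functions vanish at \<open>x0\<close>. The differential of the first annihilates
  \<open>F\<close> there and produces a multiple of \<open>F\<close>; that of the second annihilates
  \<open>G\<close> and produces a multiple of \<open>G\<close>. The third is nonzero at
  \<open>x0\<close> and produces a normal component.\<close>

lemma contact_fields:
  assumes "r > 0" and N0: "\<And>p. p \<in> cball x0 r \<Longrightarrow> N p \<noteq> 0" and "\<mu> x0 \<noteq> 0"
  shows "\<exists>X :: 3 \<Rightarrow> real^3 \<Rightarrow> real^3. \<exists>\<Lambda>\<ge>0. (\<forall>i. Ck (Suc (Suc 0)) (X i)) \<and>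
    (\<forall>i p. p \<notin> cball x0 r \<longrightarrow> X i p = 0) \<and> X 1 x0 \<bullet> cross3 (X 2 x0) (X 3 x0) \<noteq> 0 \<and>
    (\<forall>i p v. \<bar>frechet_derivative N (at p) (X i p) \<bullet> v + N p \<bullet> frechet_derivative (X i) (at p) v\<bar> \<le> \<Lambda> * \<bar>N p \<bullet> v\<bar>)"
proof -
  \<comment> \<open>One derivative is lost in passing from a function to its field, so fields of
    class C^2 need a cutoff of class C^3.\<close>
  let ?b = "bump 3 x0 r"
  define h :: "3 \<Rightarrow> real^3 \<Rightarrow> real" where
    "h i p = ?b p * (if i = 1 then cross3 (N x0) (F x0) \<bullet> (p - x0)
       else if i = 2 then cross3 (G x0) (N x0) \<bullet> (p - x0) else 1)" for i p
  have h: "Ck (Suc (Suc (Suc 0))) (h i)" for i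
    unfolding h_def[abs_def]
    by (intro Ck_mult Ck_bump) (cases "i = 1"; cases "i = 2"; auto intro!: Ck_inner Ck_const Ck_diff Ck_ident simp del: Ck.simps)+
  have supp: "\<forall>p. p \<notin> cball x0 r \<longrightarrow> h i p = 0" for i
    by (intro allI impI) (simp add: h_def bump_eq_0[OF _ less_imp_le[OF \<open>r > 0\<close>]])
  have "\<exists>\<Lambda>\<ge>0. \<forall>p v. \<bar>\<beta> (h i) p v\<bar> \<le> \<Lambda> * \<bar>N p \<bullet> v\<bar>" for i
    by (rule \<beta>_bound[OF Ck_SucD[OF h] supp N0])
  then obtain l where l: "\<And>i. l i \<ge> 0" "\<And>i p v. \<bar>\<beta> (h i) p v\<bar> \<le> l i * \<bar>N p \<bullet> v\<bar>"
    by metis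
  define B where "B = ?b x0"
  have B: "B \<noteq> 0" using \<open>r > 0\<close> by (simp add: B_def bump_def)
  have b: "(?b has_derivative frechet_derivative ?b (at x0)) (at x0)"
    by (rule Ck_has_derivative[of 0]) (simp add: Ck_bump del: Ck.simps)
  have lin: "frechet_derivative (\<lambda>p. ?b p * (c \<bullet> (p - x0))) (at x0) v = B * (c \<bullet> v)" for c v
  proof -
    have "((\<lambda>p. ?b p * (c \<bullet> (p - x0))) has_derivative
        (\<lambda>v. ?b x0 * (c \<bullet> v) + frechet_derivative ?b (at x0) v * (c \<bullet> (x0 - x0)))) (at x0)"
      by (intro has_derivative_mult b) (auto intro!: derivative_eq_intros)
    from frechet_derivative_at[OF this, symmetric] show ?thesis by (simp add: B_def)
  qed
  have FGN: "cross3 (G x0) (N x0) \<bullet> F x0 = N x0 \<bullet> N x0" "cross3 (N x0) (F x0) \<bullet> G x0 = N x0 \<bullet> N x0"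
    by (metis N_def cross_triple)+
  have h12: "h 1 = (\<lambda>p. ?b p * (cross3 (N x0) (F x0) \<bullet> (p - x0)))"
      "h 2 = (\<lambda>p. ?b p * (cross3 (G x0) (N x0) \<bullet> (p - x0)))"
    by (simp_all add: h_def fun_eq_iff)
  have X1: "field (h 1) x0 = (\<mu> x0 * B * (N x0 \<bullet> N x0)) *\<^sub>R F x0"
    using field_at_zero[OF Ck_SucD[OF Ck_SucD[OF h]], of 1 x0] unfolding h12
    by (simp add: lin FGN dot_cross_self)
  have X2: "field (h 2) x0 = - (\<mu> x0 * B * (N x0 \<bullet> N x0)) *\<^sub>R G x0"
    using field_at_zero[OF Ck_SucD[OF Ck_SucD[OF h]], of 2 x0] unfolding h12
    by (simp add: lin FGN dot_cross_self)
  have X3: "field (h 3) x0 \<bullet> N x0 = \<mu> x0 * B * \<mu> x0"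
    unfolding inner_commute[of _ "N x0"]
    by (simp add: field_def inner_add_right N_orthogonal H_def h_def B_def \<mu>_def)
  have "field (h 1) x0 \<bullet> cross3 (field (h 2) x0) (field (h 3) x0) =
      - (\<mu> x0 * B * (N x0 \<bullet> N x0))\<^sup>2 * (F x0 \<bullet> cross3 (G x0) (field (h 3) x0))"
    unfolding X1 X2 by (simp add: cross_mult_left power2_eq_square)
  also have "F x0 \<bullet> cross3 (G x0) (field (h 3) x0) = field (h 3) x0 \<bullet> N x0"
    by (metis N_def cross_triple inner_commute)
  finally have det: "field (h 1) x0 \<bullet> cross3 (field (h 2) x0) (field (h 3) x0) \<noteq> 0"
    using X3 B \<open>\<mu> x0 \<noteq> 0\<close> N0[of x0] \<open>r > 0\<close> by simp
  have "\<bar>\<beta> (h i) p v\<bar> \<le> (\<Sum>i\<in>UNIV. l i) * \<bar>N p \<bullet> v\<bar>" for i p v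
  proof -
    have "l i \<le> (\<Sum>i\<in>UNIV. l i)" by (rule member_le_sum) (use l(1) in auto)
    then show ?thesis by (rule order_trans[OF l(2) mult_right_mono]) simp
  qed
  then show ?thesis
    using field_Ck[OF h] field_support[OF supp] det l(1)
    by (intro exI[of _ "\<lambda>i. field (h i)"] exI[of _ "\<Sum>i\<in>UNIV. l i"]) (auto simp: \<beta>_def sum_nonneg simp del: Ck.simps)
qed

end

text \<open>By \<open>det\<close> all fields are everywhere orthogonal to \<open>N\<close>, so
  preserving the kernel of \<open>N\<close> respects the whole system, and near \<open>x0\<close>
  the fields \<open>f i\<close> and \<open>f j\<close> alone realise every velocity in that
  kernel.\<close>

lemma min_time_locally_lipschitz_contact:
  fixes f :: "'m::finite \<Rightarrow> real^3 \<Rightarrow> real^3"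
  assumes f: "\<And>i k. Ck k (f i)" and K: "closed K" "x0 \<notin> K"
    and det: "\<And>l p. cross3 (f i p) (f j p) \<bullet> f l p = 0"
    and bracket: "cross3 (f i x0) (f j x0) \<bullet> lie_bracket (f i) (f j) x0 \<noteq> 0"
  shows "\<exists>U. open U \<and> x0 \<in> U \<and> U \<subseteq> - K \<and> (\<exists>L. L-lipschitz_on U (min_time f K))"
proof -
  interpret contact_frame "f i" "f j" by standard (rule f)+
  have Nf: "N p \<bullet> f l p = 0" for p l using det by (simp add: N_def)
  have contf: "continuous_on S (f i)" for S i by (rule Ck_continuous[OF f[of 0]])
  have contN: "continuous_on S N" for S by (rule Ck_continuous[OF N_smooth[of 0]])
  have "open ({p. N p \<noteq> 0} \<inter> - K)"
    using K(1) by (intro open_Int open_Collect_neq contN continuous_on_const) auto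
  moreover have "N x0 \<noteq> 0" using bracket by (auto simp: N_def)
  ultimately obtain r' where r': "r' > 0" "cball x0 r' \<subseteq> {p. N p \<noteq> 0} \<inter> - K"
    using K(2) unfolding open_contains_cball by blast
  define r where "r = r' / 2"
  have r: "r > 0" "cball x0 r \<inter> K = {}" and N0: "\<And>p. p \<in> cball x0 (2 * r) \<Longrightarrow> N p \<noteq> 0"
  proof -
    have "cball x0 r \<subseteq> cball x0 r'" "2 * r = r'" using r'(1) by (auto simp: r_def)
    then show "cball x0 r \<inter> K = {}" "\<And>p. p \<in> cball x0 (2 * r) \<Longrightarrow> N p \<noteq> 0"
      using r'(2) by auto
  qed (use r'(1) in \<open>simp add: r_def\<close>)
  have N0': "N p \<noteq> 0" if "p \<in> cball x0 r" for p
    using that r(1) by (intro N0) simp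
  have "\<mu> x0 \<noteq> 0" using bracket by (simp add: \<mu>_def N_def Z_def)
  from contact_fields[OF r(1) N0' this] obtain X :: "3 \<Rightarrow> real^3 \<Rightarrow> real^3" and \<Lambda> where "\<Lambda> \<ge> 0"
    and X: "\<And>i. Ck (Suc (Suc 0)) (X i)" "\<And>i. \<forall>p. p \<notin> cball x0 r \<longrightarrow> X i p = 0"
      "X 1 x0 \<bullet> cross3 (X 2 x0) (X 3 x0) \<noteq> 0"
    and pres: "\<And>i p v. \<bar>frechet_derivative N (at p) (X i p) \<bullet> v + N p \<bullet> frechet_derivative (X i) (at p) v\<bar> \<le> \<Lambda> * \<bar>N p \<bullet> v\<bar>"
    by blast
  have ne: "i \<noteq> j" using \<open>N x0 \<noteq> 0\<close> by (auto simp: N_def)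
  define \<rho> where "\<rho> l p = (if l = i then (1 / (N p \<bullet> N p)) *\<^sub>R cross3 (f j p) (N p)
    else if l = j then (1 / (N p \<bullet> N p)) *\<^sub>R cross3 (N p) (f i p) else 0)" for l p
  have "continuous_on (cball x0 (2 * r)) (\<rho> l)" for l
    unfolding \<rho>_def[abs_def]
    by (cases "l = i"; cases "l = j")
      (use N0 ne in \<open>auto intro!: continuous_intros continuous_on_cross contf contN\<close>)
  then obtain R where R: "\<And>l q. q \<in> cball x0 (2 * r) \<Longrightarrow> norm (\<rho> l q) \<le> R"
    using finite_family_bounded_on_compact[OF compact_cball, of x0 "2 * r" \<rho>] by blast
  show ?thesis
  proof (rule min_time_locally_lipschitz[OF f r X _ pres \<open>\<Lambda> \<ge> 0\<close> Nf _ R])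
    show "N differentiable at p" for p using N_smooth[of "Suc 0"] by simp
    show "\<rho> l \<in> borel_measurable borel" for l
    proof -
      have [measurable]: "(\<lambda>p. N p \<bullet> N p) \<in> borel_measurable borel"
          "(\<lambda>p. cross3 (f j p) (N p)) \<in> borel_measurable borel"
          "(\<lambda>p. cross3 (N p) (f i p)) \<in> borel_measurable borel"
        by (intro borel_measurable_continuous_onI contf contN continuous_on_inner continuous_on_cross)+
      show ?thesis
        unfolding \<rho>_def[abs_def] by (cases "l = i"; cases "l = j") (use ne in simp_all)
    qed
    show "(\<Sum>l\<in>UNIV. (\<rho> l q \<bullet> d) *\<^sub>R f l q) = d" if q: "q \<in> cball x0 (2 * r)" and d: "N q \<bullet> d = 0" for q d
    proof -
      have "(\<Sum>l\<in>UNIV. (\<rho> l q \<bullet> d) *\<^sub>R f l q) = (\<Sum>l\<in>{i, j}. (\<rho> l q \<bullet> d) *\<^sub>R f l q)"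
        by (rule sum.mono_neutral_right) (auto simp: \<rho>_def)
      also have "\<dots> = (\<rho> i q \<bullet> d) *\<^sub>R f i q + (\<rho> j q \<bullet> d) *\<^sub>R f j q"
        using ne by simp
      also have "\<dots> = d"
        using frame_expansion[OF N0[OF q], of d] d ne by (simp add: \<rho>_def)
      finally show ?thesis .
    qed
  qed
qed

subsection \<open>The bracket generating condition\<close>

lemma lie_algebra_smooth:
  assumes "g \<in> lie_algebra F" "\<forall>f\<in>F. \<forall>k. Ck k f"
  shows "Ck k g"
  using assms(1)
proof (induction arbitrary: k)
  case (bracket f g)
  show ?case by (intro Ck_lie_bracket bracket.IH)
qed (auto intro: Ck_const Ck_add Ck_scaleR_const simp: assms(2))

context contact_frame
begin

text \<open>The right-hand side is minus the exterior derivative of the 1-form given by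
  \<open>N\<close>, applied to g and h. It depends on g and h only through their values at
  \<open>p\<close>.\<close>

lemma inner_lie_bracket:
  assumes "\<And>q. N q \<bullet> g q = 0" "\<And>q. N q \<bullet> h q = 0" "g differentiable at p" "h differentiable at p"
  shows "N p \<bullet> lie_bracket g h p =
    frechet_derivative N (at p) (h p) \<bullet> g p - frechet_derivative N (at p) (g p) \<bullet> h p"
  using orthogonal_derivative[OF assms(1,3), of "h p"] orthogonal_derivative[OF assms(2,4), of "g p"]
  by (simp add: lie_bracket_def inner_diff_right)

text \<open>The expression in \<open>inner_lie_bracket\<close> is bilinear and alternating in the
  two values, so on the plane of \<open>F\<close> and \<open>G\<close> it is a multiple of its value
  on that pair, which is \<mu>.\<close>

lemma lie_bracket_in_plane:
  assumes g: "\<And>q. N q \<bullet> g q = 0" and h: "\<And>q. N q \<bullet> h q = 0"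
    and gh: "g differentiable at p" "h differentiable at p" and "\<mu> p = 0"
  shows "N p \<bullet> lie_bracket g h p = 0"
proof (cases "N p = 0")
  case False
  let ?D = "frechet_derivative N (at p)"
  interpret bounded_linear ?D using derivative(3) by (rule has_derivative_bounded_linear)
  obtain a b where ab: "g p = a *\<^sub>R F p + b *\<^sub>R G p"
    using frame_expansion[OF False, of "g p"] g by simp
  obtain a' b' where ab': "h p = a' *\<^sub>R F p + b' *\<^sub>R G p"
    using frame_expansion[OF False, of "h p"] h by simp
  have "F differentiable at p" "G differentiable at p" using derivative differentiableI by blast+
  from inner_lie_bracket[OF N_orthogonal this] \<open>\<mu> p = 0\<close>
  have FG: "?D (G p) \<bullet> F p = ?D (F p) \<bullet> G p" by (simp add: \<mu>_def Z_def)
  show ?thesis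
    unfolding inner_lie_bracket[OF g h gh] ab ab'
    by (simp add: add scaleR inner_add_left inner_add_right FG algebra_simps)
qed simp

end

text \<open>Orthogonality to \<open>N\<close> at every point passes to brackets, trivially where
  \<open>N\<close> vanishes. The Lie algebra therefore never takes the value \<open>N x\<close> at
  \<open>x\<close>.\<close>

lemma not_hoermander_of_involutive:
  fixes f :: "'m::finite \<Rightarrow> real^3 \<Rightarrow> real^3"
  assumes smooth: "\<And>i k. Ck k (f i)"
    and det: "\<And>l p. cross3 (f i p) (f j p) \<bullet> f l p = 0"
    and bracket: "\<And>p. cross3 (f i p) (f j p) \<bullet> lie_bracket (f i) (f j) p = 0"
    and indep: "cross3 (f i x) (f j x) \<noteq> 0"
  shows "\<not> hoermander f"
proof
  assume "hoermander f"
  interpret contact_frame "f i" "f j" by standard (rule smooth)+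
  have "N x \<in> {g x | g. g \<in> lie_algebra (range f)}"
    using \<open>hoermander f\<close> by (simp add: hoermander_def)
  then obtain g where g: "g \<in> lie_algebra (range f)" "g x = N x" by force
  from g(1) have "\<forall>p. N p \<bullet> g p = 0"
  proof induction
    case (bracket g h)
    have "Ck (Suc 0) g" "Ck (Suc 0) h"
      using lie_algebra_smooth[OF bracket.hyps(1)] lie_algebra_smooth[OF bracket.hyps(2)] assms(1) by blast+
    then show ?case
      using bracket.IH assms(3) by (intro allI lie_bracket_in_plane) (simp_all add: \<mu>_def N_def Z_def)
  qed (auto simp: N_def det inner_add_right)
  then show False using g(2) indep by (metis N_def inner_eq_zero_iff)
qed

text \<open>Being parallel to \<open>f i\<close> everywhere passes to brackets; expressed by cross
  products, it holds trivially at zeros of \<open>f i\<close>. A vector not parallel to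
  \<open>f i x\<close> then stays out of reach.\<close>

lemma not_hoermander_of_parallel:
  fixes f :: "'m::finite \<Rightarrow> real^3 \<Rightarrow> real^3"
  assumes smooth: "\<And>i k. Ck k (f i)"
    and par: "\<And>j p. cross3 (f j p) (f i p) = 0" and "f i x \<noteq> 0"
  shows "\<not> hoermander f"
proof
  assume H: "hoermander f"
  obtain w where w: "cross3 w (f i x) \<noteq> 0"
    using cross_basis_nonzero[OF \<open>f i x \<noteq> 0\<close>] by (metis cross_skew neg_equal_0_iff_equal)
  have "w \<in> {g x | g. g \<in> lie_algebra (range f)}"
    using H by (simp add: hoermander_def)
  then obtain g where g: "g \<in> lie_algebra (range f)" "g x = w" by force
  have C1: "Ck (Suc 0) g" if "g \<in> lie_algebra (range f)" for g
    using lie_algebra_smooth[OF that] smooth by blast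
  let ?D = "\<lambda>g p. frechet_derivative g (at p)"
  have dcross: "cross3 (?D g p w) (f i p) = - cross3 (g p) (?D (f i) p w)"
    if g: "Ck (Suc 0) g" and 0: "\<And>q. cross3 (g q) (f i q) = 0" for g p w
  proof -
    have "((\<lambda>q. cross3 (g q) (f i q)) has_derivative
        (\<lambda>w. cross3 (g p) (?D (f i) p w) + cross3 (?D g p w) (f i p))) (at p)"
      by (rule bounded_bilinear.FDERIV[OF bilinear_conv_bounded_bilinear[THEN iffD1, OF bilinear_cross]])
        (intro Ck_has_derivative[OF g] Ck_has_derivative[OF smooth[of "Suc 0" i]])+
    then have "((\<lambda>q. 0) has_derivative
        (\<lambda>w. cross3 (g p) (?D (f i) p w) + cross3 (?D g p w) (f i p))) (at p)"
      by (simp only: 0)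
    from has_derivative_unique[OF this has_derivative_const]
    have "cross3 (g p) (?D (f i) p w) + cross3 (?D g p w) (f i p) = 0"
      by (rule fun_cong)
    then show ?thesis by (simp add: add_eq_0_iff)
  qed
  have scal: "\<exists>c. v = c *\<^sub>R f i p" if "cross3 v (f i p) = 0" "f i p \<noteq> 0" for v p
  proof -
    have "cross3 (f i p) (cross3 (f i p) v) = (f i p \<bullet> v) *\<^sub>R f i p - (f i p \<bullet> f i p) *\<^sub>R v"
      by (rule Lagrange)
    moreover have "cross3 (f i p) v = 0" using that(1) cross_skew[of "f i p" v] by simp
    ultimately have "(f i p \<bullet> f i p) *\<^sub>R v = (f i p \<bullet> v) *\<^sub>R f i p" by simp
    then have "(1 / (f i p \<bullet> f i p)) *\<^sub>R (f i p \<bullet> f i p) *\<^sub>R v = (1 / (f i p \<bullet> f i p)) *\<^sub>R (f i p \<bullet> v) *\<^sub>R f i p"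
      by simp
    then show ?thesis using that(2) by (intro exI[of _ "(f i p \<bullet> v) / (f i p \<bullet> f i p)"]) simp
  qed
  from g(1) have "\<forall>p. cross3 (g p) (f i p) = 0"
  proof induction
    case (gen g)
    then show ?case using par by auto
  next
    case (bracket g h)
    show ?case
    proof
      fix p
      show "cross3 (lie_bracket g h p) (f i p) = 0"
      proof (cases "f i p = 0")
        case False
        interpret bounded_linear "?D (f i) p"
          using Ck_has_derivative[OF smooth[of "Suc 0" i]] by (rule has_derivative_bounded_linear)
        obtain a b where "g p = a *\<^sub>R f i p" "h p = b *\<^sub>R f i p"
          using scal[OF _ False] bracket.IH by blast
        \<comment> \<open>Differentiating the vanishing cross products moves the derivative onto
          \<open>f i\<close>. With values \<open>a\<close> and \<open>b\<close> times
          \<open>f i p\<close>, the two halves of the bracket become a b times the same vector, with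
          opposite signs.\<close>
        then show ?thesis
          using dcross[OF C1[OF bracket.hyps(1)], of p "h p"] dcross[OF C1[OF bracket.hyps(2)], of p "g p"] bracket.IH
          by (simp add: lie_bracket_def Cross3.left_diff_distrib scaleR cross_mult_left cross_mult_right)
      qed simp
    qed
  qed (auto simp: cross_add_left cross_mult_left)
  then show False using g(2) w by metis
qed

lemma not_hoermander_zero:
  fixes f :: "'m::finite \<Rightarrow> real^3 \<Rightarrow> real^3"
  assumes "\<And>i p. f i p = 0"
  shows "\<not> hoermander f"
proof
  assume "hoermander f"
  then have "axis 1 1 \<in> {g (0::real^3) | g. g \<in> lie_algebra (range f)}"
    by (simp add: hoermander_def)
  then obtain g where g: "g \<in> lie_algebra (range f)" "g 0 = axis 1 1" by force
  from g(1) have "g = (\<lambda>p. 0)"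
  proof induction
    case (bracket g h)
    show ?case
      unfolding bracket.IH by (rule ext) (simp add: lie_bracket_def)
  qed (auto simp: assms fun_eq_iff)
  then show False using g(2) by (simp add: axis_eq_0_iff)
qed

section \<open>Analyticity of brackets and triple products along lines\<close>

lemma real_analytic_derivative_along:
  fixes f g :: "real^'n \<Rightarrow> real^'n"
  assumes f: "real_analytic f" and g: "real_analytic g"
  shows "line_analytic (\<lambda>x. frechet_derivative g (at x) (f x) $ l)"
proof -
  \<comment> \<open>Analyticity is known for derivatives in fixed directions, so the moving
    direction \<open>f x\<close> is expanded along the axes.\<close>
  have "frechet_derivative g (at x) (f x) $ l = (\<Sum>k\<in>UNIV. f x $ k * frechet_derivative g (at x) (axis k 1) $ l)" for x
  proof -
    interpret bounded_linear "frechet_derivative g (at x)"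
      by (rule has_derivative_bounded_linear[OF Ck_has_derivative[OF real_analytic_Ck[OF g, of "Suc 0"]]])
    show ?thesis
      by (subst basis_expansion[of "f x", symmetric]) (simp add: sum scalar_mult_eq_scaleR scaleR)
  qed
  moreover have "line_analytic (\<lambda>x. \<Sum>k\<in>UNIV. f x $ k * frechet_derivative g (at x) (axis k 1) $ l)"
    by (intro line_analytic_sum line_analytic_mult real_analytic_line_analytic f
        real_analytic_directional_derivative g)
  ultimately show ?thesis by simp
qed

lemma real_analytic_lie_bracket:
  fixes f g :: "real^'n \<Rightarrow> real^'n"
  assumes "real_analytic f" "real_analytic g"
  shows "line_analytic (\<lambda>x. lie_bracket f g x $ l)"
  unfolding lie_bracket_def by (simp add: line_analytic_diff real_analytic_derivative_along assms)

lemma line_analytic_triple: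
  fixes u v w :: "'a::real_vector \<Rightarrow> real^3"
  assumes "\<And>l. line_analytic (\<lambda>x. u x $ l)" "\<And>l. line_analytic (\<lambda>x. v x $ l)" "\<And>l. line_analytic (\<lambda>x. w x $ l)"
  shows "line_analytic (\<lambda>x. u x \<bullet> cross3 (v x) (w x))"
  unfolding inner_vec_def sum_3 cross_components inner_real_def
  by (intro line_analytic_add line_analytic_mult line_analytic_diff assms)

text \<open>Completeness of Lebesgue measure supplies the measurability of the singular support: it
  is a subset of a null set.\<close>

lemma sing_supp_Lip_null:
  assumes "{x. h x = 0} \<in> null_sets lebesgue"
    and "\<And>x. \<lbrakk>x \<in> \<Omega>; h x \<noteq> 0\<rbrakk> \<Longrightarrow> \<exists>U. open U \<and> x \<in> U \<and> U \<subseteq> \<Omega> \<and> (\<exists>L. L-lipschitz_on U g)"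
  shows "sing_supp_Lip \<Omega> g \<in> null_sets lebesgue"
proof -
  have "sing_supp_Lip \<Omega> g \<subseteq> {x. h x = 0}"
    using assms(2) by (auto simp: sing_supp_Lip_def)
  then show ?thesis
    using assms(1) by (metis negligible_iff_null_sets negligible_subset)
qed

theorem theorem9:
  fixes f :: "'m::finite \<Rightarrow> real^3 \<Rightarrow> real^3" and K :: "(real^3) set"
  assumes "\<And>i. real_analytic (f i)"
    and "hoermander f"
    and "closed K" and "K \<noteq> {}"
  shows "sing_supp_Lip (- K) (min_time f K) \<in> null_sets lebesgue"
proof -
  have smooth: "Ck k (f i)" for k i by (rule real_analytic_Ck[OF assms(1)])
  have la: "line_analytic (\<lambda>x. f i x $ l)" for i l by (rule real_analytic_line_analytic[OF assms(1)])
  have cont: "continuous_on UNIV (f i)" for i by (rule Ck_continuous[OF smooth[of 0]])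
  \<comment> \<open>If every triple product vanishes identically, all fields stay in the plane of
    any two of them; then some bracket leaves such a plane somewhere, or none ever does.\<close>
  consider (rank3) i j k p where "f i p \<bullet> cross3 (f j p) (f k p) \<noteq> 0"
    | (contact) i j p where "\<And>l p. cross3 (f i p) (f j p) \<bullet> f l p = 0"
        "cross3 (f i p) (f j p) \<bullet> lie_bracket (f i) (f j) p \<noteq> 0"
    | (involutive) "\<And>i j l p. cross3 (f i p) (f j p) \<bullet> f l p = 0"
        "\<And>i j p. cross3 (f i p) (f j p) \<bullet> lie_bracket (f i) (f j) p = 0"
    by (metis inner_commute)
  then show ?thesis
  proof cases
    case rank3
    let ?h = "\<lambda>x. f i x \<bullet> cross3 (f j x) (f k x)"
    have "{x. ?h x = 0} \<in> null_sets lebesgue"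
    proof (rule line_analytic_null_zeros[OF line_analytic_triple[OF la la la] _ rank3])
      show "continuous_on UNIV ?h" by (intro continuous_on_inner continuous_on_cross cont)
    qed
    then show ?thesis
      by (rule sing_supp_Lip_null)
        (rule min_time_locally_lipschitz_rank3[OF smooth \<open>closed K\<close>], simp_all)
  next
    case contact
    let ?h = "\<lambda>x. lie_bracket (f i) (f j) x \<bullet> cross3 (f i x) (f j x)"
    have "{x. ?h x = 0} \<in> null_sets lebesgue"
    proof (rule line_analytic_null_zeros[OF line_analytic_triple[OF real_analytic_lie_bracket la la]])
      show "?h p \<noteq> 0" using contact(2) by (simp add: inner_commute)
      show "continuous_on UNIV ?h"
        by (intro continuous_on_inner continuous_on_cross cont Ck_continuous[OF Ck_lie_bracket[OF smooth smooth, of 0]])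
    qed (rule assms(1))+
    then show ?thesis
    proof (rule sing_supp_Lip_null)
      fix x assume "x \<in> - K" "?h x \<noteq> 0"
      then show "\<exists>U. open U \<and> x \<in> U \<and> U \<subseteq> - K \<and> (\<exists>L. L-lipschitz_on U (min_time f K))"
        by (intro min_time_locally_lipschitz_contact[OF smooth \<open>closed K\<close> _ contact(1)])
          (simp_all add: inner_commute)
    qed
  next
    case involutive
    \<comment> \<open>Descent in rank: two fields independent at some point would confine the whole
      Lie algebra to their plane, so all fields are parallel; then one nonzero value would confine
      it to a line, so all fields vanish.\<close>
    have indep: "cross3 (f i x) (f j x) = 0" for i j x
    proof (rule ccontr)
      assume "cross3 (f i x) (f j x) \<noteq> 0"
      then have "\<not> hoermander f"
        by (rule not_hoermander_of_involutive[rotated 3]) (rule smooth involutive)+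
      then show False using assms(2) by blast
    qed
    have "f i x = 0" for i x
    proof (rule ccontr)
      assume "f i x \<noteq> 0"
      then have "\<not> hoermander f"
        by (rule not_hoermander_of_parallel[rotated 2]) (rule smooth indep)+
      then show False using assms(2) by blast
    qed
    then show ?thesis
      using not_hoermander_zero[of f] assms(2) by blast
  qed
qed

end
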